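(* Let $\Omega\subset\mathbb{R}^n$ be a bounded connected Lipschitz domain, $1<q<\infty$, $0\le\lambda<n$, and let $U\subset\Omega$ be measurable with positive measure. Then there is $c>0$ such that $\|f\|_{H_{q,\lambda}(\Omega)}\le c\|\nabla f\|_{H_{q,\lambda}(\Omega)}$ for every $f$ which either lies in $L^1(\Omega)$ with $\nabla f\in H_{q,\lambda}(\Omega)$ and $\int_Uf=0$, or lies in $W^1_0H_{q,\lambda}(\Omega)$.
   Context: For $x\in\mathbb{R}^n$, $R>0$: $\Omega_R(x):=\Omega\cap B(x,R)$; $q'=q/(q-1)$. A $(q,\lambda)$-block is $\rho\in L^q_{\mathrm{loc}}(\overline\Omega)$ with $\mathrm{supp}\,\rho\subset\overline{\Omega_R(x)}$ for some $R>0$, $x\in\Omega$, and $R^{\lambda/q'}\|\rho\|_{L^q(\Omega_R(x))}\le1$. The block space $H_{q,\lambda}(\Omega)$ consists of all $\sum_k c_k\phi_k$ with $\phi_k$ $(q,\lambda)$-blocks and $(c_k)\in\ell^1$, normed by the infimum of $\|(c_k)\|_{\ell^1}$. $W^1H_{q,\lambda}(\Omega)$: $f\in H_{q,\lambda}(\Omega)$ with weak gradient in $H_{q,\lambda}(\Omega)$; $W^1_0H_{q,\lambda}(\Omega)$: closure of $C_0^\infty(\Omega)$ in $W^1H_{q,\lambda}(\Omega)$. Lipschitz domain: boundary locally the graph of a Lipschitz function. *)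

theory Defs
  imports "HOL-Analysis.Analysis"
begin

text \<open>Ambient space: a Euclidean space 'n (playing the role of R^n, n = DIM('n)).
  Functions on the domain are functions 'n => real; only their values on the domain
  matter (all conditions are a.e. on the domain).\<close>

text \<open>Lipschitz domain: open set whose boundary is locally the graph of a Lipschitz
  function: near every boundary point p there is an open neighbourhood V, a unit
  direction e (the local "vertical" coordinate) and a Lipschitz function gam of the
  orthogonal coordinates y - (y.e)e such that inside V the set is exactly the region
  above the graph.\<close>
definition lipschitz_domain :: "'n::euclidean_space set \<Rightarrow> bool" where
  "lipschitz_domain \<Omega> \<longleftrightarrow> open \<Omega> \<and>
     (\<forall>p\<in>frontier \<Omega>. \<exists>V e (gam :: 'n \<Rightarrow> real) L.
        open V \<and> p \<in> V \<and> norm e = 1 \<and>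
        (\<forall>u v. \<bar>gam u - gam v\<bar> \<le> L * norm (u - v)) \<and>
        (\<forall>y\<in>V. y \<in> \<Omega> \<longleftrightarrow> y \<bullet> e > gam (y - (y \<bullet> e) *\<^sub>R e)))"

text \<open>C-infinity on S: a family D of all iterated partial derivatives
  (D vs = partial derivative along the basis vectors in the list vs, applied to D []),
  each continuous and Frechet differentiable with partials D (i # vs).\<close>
definition smooth_with :: "'n::euclidean_space set \<Rightarrow> ('n \<Rightarrow> real) \<Rightarrow> ('n list \<Rightarrow> 'n \<Rightarrow> real) \<Rightarrow> bool" where
  "smooth_with S f D \<longleftrightarrow> D [] = f \<and> (\<forall>vs. continuous_on S (D vs)) \<and>
     (\<forall>vs x. x \<in> S \<longrightarrow>
        (D vs has_derivative (\<lambda>h. \<Sum>i\<in>Basis. (h \<bullet> i) * D (i # vs) x)) (at x))"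

definition test_fun :: "'n::euclidean_space set \<Rightarrow> ('n \<Rightarrow> real) \<Rightarrow> ('n list \<Rightarrow> 'n \<Rightarrow> real) \<Rightarrow> bool" where
  "test_fun \<Omega> \<phi> D \<longleftrightarrow> smooth_with UNIV \<phi> D \<and>
     compact (closure (support_on UNIV \<phi>)) \<and> closure (support_on UNIV \<phi>) \<subseteq> \<Omega>"

definition loc_integrable :: "'n::euclidean_space set \<Rightarrow> ('n \<Rightarrow> real) \<Rightarrow> bool" where
  "loc_integrable \<Omega> f \<longleftrightarrow> (\<forall>K. compact K \<and> K \<subseteq> \<Omega> \<longrightarrow> set_integrable lebesgue K f)"

definition weak_gradient :: "'n::euclidean_space set \<Rightarrow> ('n \<Rightarrow> real) \<Rightarrow> ('n \<Rightarrow> 'n) \<Rightarrow> bool" where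
  "weak_gradient \<Omega> f g \<longleftrightarrow> loc_integrable \<Omega> f \<and>
     (\<forall>i\<in>Basis. loc_integrable \<Omega> (\<lambda>y. g y \<bullet> i)) \<and>
     (\<forall>\<phi> D. test_fun \<Omega> \<phi> D \<longrightarrow> (\<forall>i\<in>Basis.
        (LINT y:\<Omega>|lebesgue. f y * D [i] y) = - (LINT y:\<Omega>|lebesgue. (g y \<bullet> i) * \<phi> y)))"

definition q_block :: "'n::euclidean_space set \<Rightarrow> real \<Rightarrow> real \<Rightarrow> ('n \<Rightarrow> real) \<Rightarrow> bool" where
  "q_block \<Omega> q lam \<rho> \<longleftrightarrow> (\<exists>x R. x \<in> \<Omega> \<and> R > 0 \<and>
     set_borel_measurable lebesgue \<Omega> \<rho> \<and>
     (AE y in lebesgue. y \<in> \<Omega> - closure (\<Omega> \<inter> ball x R) \<longrightarrow> \<rho> y = 0) \<and>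
     set_integrable lebesgue (\<Omega> \<inter> ball x R) (\<lambda>y. \<bar>\<rho> y\<bar> powr q) \<and>
     R powr (lam / (q / (q - 1))) *
       (LINT y:(\<Omega> \<inter> ball x R)|lebesgue. \<bar>\<rho> y\<bar> powr q) powr (1 / q) \<le> 1)"

text \<open>f = sum_k c_k phi_k with (c_k) in l^1 and phi_k blocks (the series converges
  absolutely in L^1(Omega), hence a.e.; we require a.e. convergence on Omega).\<close>
definition H_decomp :: "'n::euclidean_space set \<Rightarrow> real \<Rightarrow> real \<Rightarrow> ('n \<Rightarrow> real) \<Rightarrow> (nat \<Rightarrow> real) \<Rightarrow> (nat \<Rightarrow> 'n \<Rightarrow> real) \<Rightarrow> bool" where
  "H_decomp \<Omega> q lam f c \<phi> \<longleftrightarrow> summable (\<lambda>k. \<bar>c k\<bar>) \<and> (\<forall>k. q_block \<Omega> q lam (\<phi> k)) \<and>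
     (AE y in lebesgue. y \<in> \<Omega> \<longrightarrow> (\<lambda>k. c k * \<phi> k y) sums f y)"

definition in_H :: "'n::euclidean_space set \<Rightarrow> real \<Rightarrow> real \<Rightarrow> ('n \<Rightarrow> real) \<Rightarrow> bool" where
  "in_H \<Omega> q lam f \<longleftrightarrow> (\<exists>c \<phi>. H_decomp \<Omega> q lam f c \<phi>)"

definition H_norm :: "'n::euclidean_space set \<Rightarrow> real \<Rightarrow> real \<Rightarrow> ('n \<Rightarrow> real) \<Rightarrow> real" where
  "H_norm \<Omega> q lam f = Inf {(\<Sum>k. \<bar>c k\<bar>) | c \<phi>. H_decomp \<Omega> q lam f c \<phi>}"

definition H_norm_vec :: "'n::euclidean_space set \<Rightarrow> real \<Rightarrow> real \<Rightarrow> ('n \<Rightarrow> 'n) \<Rightarrow> real" where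
  "H_norm_vec \<Omega> q lam g = (\<Sum>i\<in>Basis. H_norm \<Omega> q lam (\<lambda>y. g y \<bullet> i))"

definition in_W1H :: "'n::euclidean_space set \<Rightarrow> real \<Rightarrow> real \<Rightarrow> ('n \<Rightarrow> real) \<Rightarrow> bool" where
  "in_W1H \<Omega> q lam f \<longleftrightarrow> in_H \<Omega> q lam f \<and>
     (\<exists>g. weak_gradient \<Omega> f g \<and> (\<forall>i\<in>Basis. in_H \<Omega> q lam (\<lambda>y. g y \<bullet> i)))"

definition in_W10H :: "'n::euclidean_space set \<Rightarrow> real \<Rightarrow> real \<Rightarrow> ('n \<Rightarrow> real) \<Rightarrow> bool" where
  "in_W10H \<Omega> q lam f \<longleftrightarrow> in_H \<Omega> q lam f \<and>
     (\<exists>g. weak_gradient \<Omega> f g \<and> (\<forall>i\<in>Basis. in_H \<Omega> q lam (\<lambda>y. g y \<bullet> i)) \<and>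
       (\<exists>\<phi> D. (\<forall>j. test_fun \<Omega> (\<phi> j) (D j)) \<and>
          (\<forall>j. in_H \<Omega> q lam (\<lambda>y. f y - \<phi> j y)) \<and>
          (\<forall>j. \<forall>i\<in>Basis. in_H \<Omega> q lam (\<lambda>y. g y \<bullet> i - D j [i] y)) \<and>
          (\<lambda>j. H_norm \<Omega> q lam (\<lambda>y. f y - \<phi> j y) +
               (\<Sum>i\<in>Basis. H_norm \<Omega> q lam (\<lambda>y. g y \<bullet> i - D j [i] y))) \<longlonglongrightarrow> 0))"

end

theory Submission
  imports Defs
begin

text \<open>
  Averages of \<open>f\<close> against smooth bumps on two cubes differ by at most a power of the side length
  times the integral of \<open>\<bar>\<nabla>f\<bar>\<close> over a common cube. In a bounded Lipschitz domain every point \<open>x\<close> is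
  the vertex of a cone of uniform size inside the domain; descending this cone along cubes of side
  comparable to \<open>t\<^sub>k = t\<^sub>0 \<theta>\<^sup>k\<close> gives, at every Lebesgue point \<open>x\<close>,
  \<open>\<bar>f x - A x\<bar> \<le> C (\<Sum>k. t\<^sub>k M\<^sub>k \<bar>\<nabla>f\<bar> x)\<close>, where \<open>M\<^sub>k\<close> averages over the ball of radius \<open>2 t\<^sub>k\<close> and \<open>A x\<close> is
  the average over the largest cube of the chain. The operators \<open>M\<^sub>k\<close> map blocks to multiples of blocks,
  uniformly in \<open>k\<close>, and \<open>\<Sum>k. t\<^sub>k\<close> converges, so the right-hand side has block norm at most
  \<open>C \<parallel>\<nabla>f\<parallel>\<close>; the block space is solid, so this bound passes to the left-hand side.

  By connectedness \<open>A x\<close> differs from the average over one fixed cube by at most \<open>C \<parallel>\<nabla>f\<parallel>\<close>, and the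
  condition on \<open>U\<close> bounds that average. For \<open>f\<close> in the closure of the test functions the extension by
  zero is weakly differentiable on the whole space, and the chain may start at a cube outside the
  domain, where the average vanishes.
\<close>

section \<open>Smooth steps\<close>


text \<open>The block norm is an infimum over signed decompositions. Estimates are therefore made
  for nonnegative \<open>ennreal\<close> majorants, and signs return only in one pointwise
  redistribution at the end. A maximal function in place of single averages would not keep a block
  supported in a ball of comparable radius, whereas one average of radius t only enlarges a ball of
  radius R to R + t. The price is a sum over scales, affordable because every link of the chain
  carries a factor \<open>t k\<close>. That factor comes from the shape of the bumps: they are
  products of one-dimensional bumps, so the difference of two of them is an explicit sum of partial
  derivatives of compactly supported smooth functions, each having one factor of size 1 in place of
  a factor of size 1/t. This is also why cubes rather than balls carry the averages. Weak gradients
  are tested only against functions that come with a full family of derivatives, so the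
  one-dimensional profiles are built together with all of theirs.\<close>

definition deriv_seq :: "(nat \<Rightarrow> real \<Rightarrow> real) \<Rightarrow> bool" where
  "deriv_seq d \<longleftrightarrow> (\<forall>n x. (d n has_real_derivative d (Suc n) x) (at x))"

text \<open>With y = 1/x one has dy/dx = - y^2, so the derivative of p(y) exp(- y) with respect to x
  is y^2 (p(y) - p'(y)) exp(- y). The recursion records the polynomial part.\<close>

primrec flat_poly :: "nat \<Rightarrow> real poly" where
  "flat_poly 0 = 1"
| "flat_poly (Suc n) = monom 1 2 * (flat_poly n - pderiv (flat_poly n))"

definition flat :: "nat \<Rightarrow> real \<Rightarrow> real" where
  "flat n x = (if x > 0 then poly (flat_poly n) (1 / x) * exp (- (1 / x)) else 0)"

lemma poly_times_exp_tendsto_0: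
  fixes p :: "real poly"
  shows "((\<lambda>y. poly p y * exp (- y)) \<longlongrightarrow> 0) at_top"
proof -
  have "((\<lambda>y. \<Sum>i\<le>degree p. coeff p i * (y ^ i / exp y)) \<longlongrightarrow> (\<Sum>i\<le>degree p. coeff p i * 0)) at_top"
    by (intro tendsto_sum tendsto_mult tendsto_const tendsto_power_div_exp_0)
  moreover have "(\<lambda>y. \<Sum>i\<le>degree p. coeff p i * (y ^ i / exp y)) = (\<lambda>y. poly p y * exp (- y))"
    by (auto simp: poly_altdef sum_distrib_right sum_divide_distrib exp_minus field_simps)
  ultimately show ?thesis by simp
qed

lemma deriv_seq_flat: "deriv_seq flat"
  unfolding deriv_seq_def
proof (intro allI)
  fix n :: nat and x :: real
  consider "x > 0" | "x < 0" | "x = 0" by linarith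
  then show "(flat n has_real_derivative flat (Suc n) x) (at x)"
  proof cases
    case 1
    have "((\<lambda>y. poly (flat_poly n) (1 / y) * exp (- (1 / y))) has_real_derivative flat (Suc n) x) (at x)"
      using 1 by (auto intro!: derivative_eq_intros DERIV_chain2[OF poly_DERIV]
          simp: flat_def poly_monom field_simps power2_eq_square)
    then show ?thesis
      by (rule DERIV_cong_ev[OF refl _ refl, THEN iffD1, rotated])
        (use 1 in \<open>auto simp: flat_def eventually_nhds intro!: exI[of _ "{0<..}"]\<close>)
  next
    case 2
    have "((\<lambda>y. 0) has_real_derivative flat (Suc n) x) (at x)"
      using 2 by (simp add: flat_def)
    then show ?thesis
      by (rule DERIV_cong_ev[OF refl _ refl, THEN iffD1, rotated])
        (use 2 in \<open>auto simp: flat_def eventually_nhds intro!: exI[of _ "{..<0}"]\<close>)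
  next
    case 3
    have "((\<lambda>y. flat n y / y) \<longlongrightarrow> 0) (at_right 0)"
    proof -
      \<comment> \<open>\<open>pCons 0\<close> multiplies by the variable 1/x: the difference
        quotient of \<open>flat n\<close> at 0 is again a polynomial in 1/x times exp(-
        1/x).\<close>
      have "((\<lambda>y. poly (pCons 0 (flat_poly n)) (inverse y) * exp (- inverse y)) \<longlongrightarrow> 0) (at_right 0)"
        by (rule filterlim_compose[OF poly_times_exp_tendsto_0 filterlim_inverse_at_top_right])
      then show ?thesis
        by (rule Lim_transform_eventually)
          (auto simp: flat_def eventually_at_right_field field_simps intro!: exI[of _ 1])
    qed
    moreover have "((\<lambda>y. flat n y / y) \<longlongrightarrow> 0) (at_left 0)"
      by (rule Lim_transform_eventually[OF tendsto_const])
        (auto simp: flat_def eventually_at_left_field intro!: exI[of _ "-1"])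
    ultimately show ?thesis
      unfolding has_field_derivative_iff using 3 by (simp add: filterlim_at_split flat_def)
  qed
qed

lemma flat_0: "x \<le> 0 \<Longrightarrow> flat 0 x = 0" "flat 0 x \<ge> 0" "x > 0 \<Longrightarrow> flat 0 x > 0"
  by (auto simp: flat_def)

text \<open>The witness is the binomial sum of Leibniz; Pascal's rule turns its derivative into the
  next sum.\<close>

lemma deriv_seq_mult:
  assumes "deriv_seq a" "deriv_seq b"
  shows "\<exists>d. deriv_seq d \<and> d 0 = (\<lambda>x. a 0 x * b 0 x)"
proof -
  define d where "d = (\<lambda>n x. \<Sum>k\<le>n. real (n choose k) * a k x * b (n - k) x)"
  have "(d n has_real_derivative d (Suc n) x) (at x)" for n x
  proof -
    have "(d n has_real_derivative
        (\<Sum>k\<le>n. real (n choose k) * (a (Suc k) x * b (n - k) x + a k x * b (Suc (n - k)) x))) (at x)"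
      using assms unfolding d_def deriv_seq_def
      by (auto intro!: derivative_eq_intros sum.cong simp: algebra_simps)
    moreover have "(\<Sum>k\<le>n. real (n choose k) * (a (Suc k) x * b (n - k) x + a k x * b (Suc (n - k)) x)) = d (Suc n) x"
    proof -
      let ?t = "\<lambda>k. a k x * b (Suc n - k) x"
      have 1: "(\<Sum>k\<le>n. real (n choose k) * (a (Suc k) x * b (n - k) x)) = (\<Sum>k\<le>n. real (n choose k) * ?t (Suc k))"
        by simp
      have 2: "(\<Sum>k\<le>n. real (n choose k) * (a k x * b (Suc (n - k)) x)) = (\<Sum>k\<le>n. real (n choose k) * ?t k)"
        by (rule sum.cong) (auto simp: Suc_diff_le)
      have 3: "(\<Sum>k\<le>n. real (n choose k) * ?t k) = ?t 0 + (\<Sum>k\<le>n. real (n choose Suc k) * ?t (Suc k))"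
      proof -
        have "(\<Sum>k\<le>n. real (n choose k) * ?t k) = (\<Sum>k\<le>Suc n. real (n choose k) * ?t k)" by simp
        also have "\<dots> = ?t 0 + (\<Sum>k\<le>n. real (n choose Suc k) * ?t (Suc k))"
          by (subst sum.atMost_Suc_shift) simp
        finally show ?thesis .
      qed
      have "d (Suc n) x = (\<Sum>k\<le>Suc n. real (Suc n choose k) * ?t k)"
        unfolding d_def by (simp add: mult.assoc)
      also have "\<dots> = ?t 0 + (\<Sum>k\<le>n. real (Suc n choose Suc k) * ?t (Suc k))"
        by (subst sum.atMost_Suc_shift) simp
      also have "\<dots> = ?t 0 + (\<Sum>k\<le>n. real (n choose Suc k) * ?t (Suc k)) + (\<Sum>k\<le>n. real (n choose k) * ?t (Suc k))"
        by (simp add: sum.distrib[symmetric] algebra_simps)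
      finally show ?thesis
        unfolding distrib_left sum.distrib 1 2 3 by linarith
    qed
    ultimately show ?thesis by simp
  qed
  then show ?thesis
    by (intro exI[of _ d]) (auto simp: deriv_seq_def d_def)
qed

lemma deriv_seq_affine:
  assumes "deriv_seq d"
  shows "deriv_seq (\<lambda>n x. c ^ n * d n (c * x + b))"
  unfolding deriv_seq_def
proof (intro allI)
  fix n x
  have "((\<lambda>x. d n (c * x + b)) has_real_derivative d (Suc n) (c * x + b) * c) (at x)"
    using assms unfolding deriv_seq_def
    by (intro DERIV_chain2[where g = "\<lambda>x. c * x + b"]) (auto intro!: derivative_eq_intros)
  from DERIV_cmult[OF this, of "c ^ n"]
  show "((\<lambda>x. c ^ n * d n (c * x + b)) has_real_derivative c ^ Suc n * d (Suc n) (c * x + b)) (at x)"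
    by (simp add: mult_ac)
qed

lemma deriv_seq_scale: "deriv_seq d \<Longrightarrow> deriv_seq (\<lambda>n x. c * d n x)"
  unfolding deriv_seq_def by (auto intro!: DERIV_cmult)

lemma deriv_seq_diff: "deriv_seq a \<Longrightarrow> deriv_seq b \<Longrightarrow> deriv_seq (\<lambda>n x. a n x - b n x)"
  unfolding deriv_seq_def by (auto intro!: DERIV_diff)

lemma deriv_seq_shift: "deriv_seq d \<Longrightarrow> deriv_seq (\<lambda>n. d (Suc n))"
  unfolding deriv_seq_def by auto

lemma deriv_seq_continuous: "deriv_seq d \<Longrightarrow> continuous_on S (d n)"
  unfolding deriv_seq_def
  by (metis DERIV_isCont continuous_at_imp_continuous_on)

text \<open>The step is the primitive of the bump \<open>flat 0 (x + 1) * flat 0 (1 - x)\<close>,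
  divided by the total mass \<open>B 1\<close>. Both levels are wanted: the derivative serves as a
  bump of mass one and height at most M, and the step, bounded by 1, is its primitive in the
  integration by parts.\<close>

lemma smooth_step_exists:
  "\<exists>d M. deriv_seq d \<and> M > 0 \<and> (\<forall>x\<le>-1. d 0 x = 0) \<and> (\<forall>x\<ge>1. d 0 x = 1) \<and>
     (\<forall>x. 0 \<le> d 0 x \<and> d 0 x \<le> 1 \<and> 0 \<le> d 1 x \<and> d 1 x \<le> M) \<and> (\<forall>x. \<bar>x\<bar> \<ge> 1 \<longrightarrow> d 1 x = 0)"
proof -
  have "deriv_seq (\<lambda>n x. 1 ^ n * flat n (1 * x + 1))" "deriv_seq (\<lambda>n x. (-1) ^ n * flat n ((-1) * x + 1))"
    by (intro deriv_seq_affine deriv_seq_flat)+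
  from deriv_seq_mult[OF this] obtain b where b: "deriv_seq b" and b0: "\<And>x. b 0 x = flat 0 (x + 1) * flat 0 (1 - x)"
    by (auto simp: fun_eq_iff)
  have bnn: "b 0 x \<ge> 0" for x by (simp add: b0 flat_0)
  have bz: "b 0 x = 0" if "\<bar>x\<bar> \<ge> 1" for x using that by (auto simp: b0 flat_0 abs_if split: if_splits)
  have cont: "continuous_on S (b 0)" for S by (rule deriv_seq_continuous[OF b])
  define B where "B = (\<lambda>x. integral {-1..x} (b 0))"
  have B': "(B has_real_derivative b 0 x) (at x)" for x
  proof (cases "x \<le> -1")
    case False
    then have "(B has_real_derivative b 0 x) (at x within {-1..x+1})"
      unfolding B_def by (intro integral_has_real_derivative cont) auto
    then show ?thesis using False by (subst (asm) at_within_interior) auto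
  next
    case True
    \<comment> \<open>For x \<le> -1 the set \<open>{-1..x}\<close> contains no neighbourhood of x,
      so the primitive is started at x - 1 instead. Both agree near x because the bump vanishes to
      the left of -1.\<close>
    have "((\<lambda>y. integral {x - 1..y} (b 0)) has_real_derivative b 0 x) (at x within {x-1..x+1})"
      by (intro integral_has_real_derivative cont) auto
    then have 1: "((\<lambda>y. integral {x - 1..y} (b 0)) has_real_derivative b 0 x) (at x)"
      by (subst (asm) at_within_interior) auto
    have 2: "integral {x - 1..y} (b 0) = B y" if "y > x - 1" for y
    proof -
      have z: "integral {c..d} (b 0) = 0" if "d \<le> -1" for c d
        using integral_cong[of "{c..d}" "b 0" "\<lambda>_. 0"] bz that by auto
      show ?thesis
      proof (cases "y \<le> -1")
        case True then show ?thesis unfolding B_def by (simp add: z)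
      next
        case F: False
        have "integral {x - 1..-1} (b 0) + integral {-1..y} (b 0) = integral {x - 1..y} (b 0)"
          using F True by (intro Henstock_Kurzweil_Integration.integral_combine integrable_continuous_interval cont) auto
        then show ?thesis unfolding B_def by (simp add: z)
      qed
    qed
    show ?thesis
      by (rule DERIV_cong_ev[OF refl _ refl, THEN iffD1, OF _ 1])
        (auto simp: eventually_nhds 2 intro!: exI[of _ "{x-1<..}"])
  qed
  have mono: "B x \<le> B y" if "x \<le> y" for x y
    by (rule DERIV_nonneg_imp_nondecreasing[OF that]) (use B' bnn in blast)
  have Bz: "B x = 0" if "x \<le> -1" for x
    unfolding B_def using integral_cong[of "{-1..x}" "b 0" "\<lambda>_. 0"] bz that by auto
  have Bc: "B x = B 1" if "x \<ge> 1" for x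
  proof -
    have "B x = B 1" if x: "x > 1"
    proof -
      obtain z where "1 < z" "B x - B 1 = (x - 1) * b 0 z"
        using MVT2[OF x B'] by blast
      then show ?thesis by (simp add: bz)
    qed
    then show ?thesis using that by (cases "x = 1") auto
  qed
  have Bp: "B 1 > 0"
  proof -
    have "(-1::real) < 1" by simp
    from MVT2[OF this B'] obtain z where "-1 < z" "z < 1" "B 1 - B (-1) = (1 - (-1)) * b 0 z"
      by blast
    moreover from this have "b 0 z > 0" by (auto simp: b0 intro!: mult_pos_pos flat_0)
    ultimately show ?thesis using Bz[of "-1"] by simp
  qed
  have "compact ((b 0) ` {-1..1})" by (intro compact_continuous_image cont) auto
  then obtain K where K: "\<And>x. x \<in> {-1..1} \<Longrightarrow> \<bar>b 0 x\<bar> \<le> K"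
    using compact_imp_bounded bounded_iff by (metis image_eqI real_norm_def)
  define d where "d = (\<lambda>n x. (1 / B 1) * (case n of 0 \<Rightarrow> B x | Suc m \<Rightarrow> b m x))"
  have K2: "b 0 x \<le> \<bar>K\<bar> + 1" for x
  proof (cases "\<bar>x\<bar> \<ge> 1")
    case True then show ?thesis by (simp add: bz)
  next
    case False
    then have "x \<in> {-1..1}" by auto
    then show ?thesis using K[of x] by linarith
  qed
  show ?thesis
  proof (intro exI[of _ d] exI[of _ "(\<bar>K\<bar> + 1) / B 1"] conjI allI impI)
    show "deriv_seq d" unfolding d_def
    proof (rule deriv_seq_scale)
      have "((case n of 0 \<Rightarrow> B | Suc m \<Rightarrow> b m) has_real_derivative b n x) (at x)" for n x
        using B' b by (cases n) (auto simp: deriv_seq_def)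
      moreover have "(\<lambda>x. case n of 0 \<Rightarrow> B x | Suc m \<Rightarrow> b m x) = (case n of 0 \<Rightarrow> B | Suc m \<Rightarrow> b m)" for n
        by (cases n) auto
      ultimately show "deriv_seq (\<lambda>n x. case n of 0 \<Rightarrow> B x | Suc m \<Rightarrow> b m x)"
        by (simp add: deriv_seq_def)
    qed
    show "(\<bar>K\<bar> + 1) / B 1 > 0" using Bp by simp
    fix x
    show "d 0 x = 0" if "x \<le> -1" using Bz that by (simp add: d_def)
    show "d 0 x = 1" if "x \<ge> 1" using Bc[OF that] Bp by (simp add: d_def)
    show "0 \<le> d 0 x"
      using mono[of "-1" x] Bz[of x] Bz[of "-1"] Bp by (cases "x \<le> -1") (auto simp: d_def)
    show "d 0 x \<le> 1"
      using mono[of x 1] Bc[of x] Bp by (cases "x \<ge> 1") (auto simp: d_def)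
    show "0 \<le> d 1 x" using bnn Bp by (auto simp: d_def)
    show "d 1 x \<le> (\<bar>K\<bar> + 1) / B 1" using K2[of x] Bp by (auto simp: d_def divide_right_mono)
    show "d 1 x = 0" if "1 \<le> \<bar>x\<bar>" using bz that by (auto simp: d_def)
  qed
qed


section \<open>Averages over cubes\<close>

definition is_step :: "(nat \<Rightarrow> real \<Rightarrow> real) \<times> real \<Rightarrow> bool" where
  "is_step p \<longleftrightarrow> (let d = fst p; M = snd p in deriv_seq d \<and> M > 0 \<and> (\<forall>x\<le>-1. d 0 x = 0) \<and>
     (\<forall>x\<ge>1. d 0 x = 1) \<and> (\<forall>x. 0 \<le> d 0 x \<and> d 0 x \<le> 1 \<and> 0 \<le> d 1 x \<and> d 1 x \<le> M) \<and>
     (\<forall>x. \<bar>x\<bar> \<ge> 1 \<longrightarrow> d 1 x = 0))"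

text \<open>One profile is fixed once and for all, so that every bump is built from its translates
  and dilates, and later constants see the profile only through \<open>step_bound\<close>.\<close>

definition step_fun :: "nat \<Rightarrow> real \<Rightarrow> real" where
  "step_fun = fst (SOME p. is_step p)"

definition step_bound :: real where
  "step_bound = snd (SOME p. is_step p)"

lemma is_step: "is_step (step_fun, step_bound)"
proof -
  from smooth_step_exists obtain d M where "is_step (d, M)"
    unfolding is_step_def Let_def fst_conv snd_conv by blast
  then have "\<exists>p. is_step p" by blast
  then have "is_step (SOME p. is_step p)" by (rule someI_ex)
  then show ?thesis unfolding step_fun_def step_bound_def by simp
qed

lemma step_fun:
  "deriv_seq step_fun" "step_bound > 0"
  "x \<le> -1 \<Longrightarrow> step_fun 0 x = 0" "x \<ge> 1 \<Longrightarrow> step_fun 0 x = 1"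
  "0 \<le> step_fun 0 x" "step_fun 0 x \<le> 1" "0 \<le> step_fun (Suc 0) x" "step_fun (Suc 0) x \<le> step_bound"
  "\<bar>x\<bar> \<ge> 1 \<Longrightarrow> step_fun (Suc 0) x = 0"
  using is_step unfolding is_step_def Let_def by auto

text \<open>The power of 1/s is the chain rule. Order 0 climbs from 0 to 1 across [c - s, c + s], so
  order 1 is a bump there whose integral is 1 without further normalisation.\<close>

definition axis_step :: "real \<Rightarrow> real \<Rightarrow> nat \<Rightarrow> real \<Rightarrow> real" where
  "axis_step c s n x = (1 / s) ^ n * step_fun n ((1 / s) * x + (- c / s))"

lemma deriv_seq_axis_step: "deriv_seq (axis_step c s)"
  unfolding axis_step_def by (rule deriv_seq_affine[OF step_fun(1)])

lemma axis_step_arg: "s > 0 \<Longrightarrow> (1 / s) * x + (- c / s) = (x - c) / (s::real)"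
  by (simp add: field_simps)

lemma axis_step_bounds:
  assumes "s > 0"
  shows "0 \<le> axis_step c s 0 x" "axis_step c s 0 x \<le> 1"
    "x \<le> c - s \<Longrightarrow> axis_step c s 0 x = 0" "x \<ge> c + s \<Longrightarrow> axis_step c s 0 x = 1"
    "0 \<le> axis_step c s (Suc 0) x" "axis_step c s (Suc 0) x \<le> step_bound / s"
    "x \<le> c - s \<or> x \<ge> c + s \<Longrightarrow> axis_step c s (Suc 0) x = 0"
proof -
  note e = axis_step_arg[OF assms, of x c]
  let ?t = "(x - c) / s"
  have l: "?t \<le> -1" if "x \<le> c - s" using that assms by (simp add: field_simps)
  have u: "?t \<ge> 1" if "x \<ge> c + s" using that assms by (simp add: field_simps)
  show "0 \<le> axis_step c s 0 x" "axis_step c s 0 x \<le> 1"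
    unfolding axis_step_def e using step_fun(5,6)[of ?t] by simp_all
  show "axis_step c s 0 x = 0" if "x \<le> c - s"
    unfolding axis_step_def e using step_fun(3)[OF l[OF that]] by simp
  show "axis_step c s 0 x = 1" if "x \<ge> c + s"
    unfolding axis_step_def e using step_fun(4)[OF u[OF that]] by simp
  show "0 \<le> axis_step c s (Suc 0) x"
    unfolding axis_step_def e using step_fun(7)[of ?t] assms by simp
  show "axis_step c s (Suc 0) x \<le> step_bound / s"
    unfolding axis_step_def e using divide_right_mono[OF step_fun(8)[of ?t], of s] assms by simp
  show "axis_step c s (Suc 0) x = 0" if "x \<le> c - s \<or> x \<ge> c + s"
  proof -
    have "\<bar>?t\<bar> \<ge> 1" using that l u by linarith
    then show ?thesis unfolding axis_step_def e using step_fun(9)[of ?t] by simp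
  qed
qed

definition cube_bump :: "'n::euclidean_space \<Rightarrow> real \<Rightarrow> 'n \<Rightarrow> real" where
  "cube_bump z s x = (\<Prod>i\<in>Basis. axis_step (z \<bullet> i) s (Suc 0) (x \<bullet> i))"

definition cube_avg :: "'n::euclidean_space set \<Rightarrow> ('n \<Rightarrow> real) \<Rightarrow> 'n \<Rightarrow> real \<Rightarrow> real" where
  "cube_avg W f z s = (LINT y:W|lebesgue. f y * cube_bump z s y)"

text \<open>In a product of functions of separate coordinates an iterated partial derivative depends
  only on how often each basis vector was used, hence \<open>count_list\<close>.\<close>

lemma smooth_with_prod:
  fixes u :: "'n::euclidean_space \<Rightarrow> nat \<Rightarrow> real \<Rightarrow> real"
  assumes "\<And>i. i \<in> Basis \<Longrightarrow> deriv_seq (u i)"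
  shows "smooth_with UNIV (\<lambda>x. \<Prod>i\<in>Basis. u i 0 (x \<bullet> i))
    (\<lambda>vs x. \<Prod>i\<in>Basis. u i (count_list vs i) (x \<bullet> i))"
proof -
  have der: "((\<lambda>x. \<Prod>i\<in>Basis. u i (count_list vs i) (x \<bullet> i)) has_derivative
      (\<lambda>h. \<Sum>i\<in>Basis. (h \<bullet> i) * (\<Prod>j\<in>Basis. u j (count_list (i # vs) j) (x \<bullet> j)))) (at x)"
    for vs and x :: 'n
  proof -
    have 1: "((\<lambda>x. u i m (x \<bullet> i)) has_derivative (\<lambda>h. u i (Suc m) (x \<bullet> i) * (h \<bullet> i))) (at x)"
      if "i \<in> Basis" for i m
    proof -
      have "(u i m has_derivative (*) (u i (Suc m) (x \<bullet> i))) (at (x \<bullet> i))"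
        using assms[OF that] unfolding deriv_seq_def has_field_derivative_def by blast
      from has_derivative_compose[OF bounded_linear_imp_has_derivative[OF bounded_linear_inner_left, of i] this]
      show ?thesis .
    qed
    have 2: "((\<lambda>x. \<Prod>i\<in>Basis. u i (count_list vs i) (x \<bullet> i)) has_derivative
      (\<lambda>h. \<Sum>i\<in>Basis. u i (Suc (count_list vs i)) (x \<bullet> i) * (h \<bullet> i) * (\<Prod>j\<in>Basis - {i}. u j (count_list vs j) (x \<bullet> j)))) (at x)"
      by (rule has_derivative_prod[OF 1])
    have 3: "u i (Suc (count_list vs i)) (x \<bullet> i) * (h \<bullet> i) * (\<Prod>j\<in>Basis - {i}. u j (count_list vs j) (x \<bullet> j))
      = (h \<bullet> i) * (\<Prod>j\<in>Basis. u j (count_list (i # vs) j) (x \<bullet> j))" if "i \<in> Basis" for h i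
    proof -
      have "(\<Prod>j\<in>Basis. u j (count_list (i # vs) j) (x \<bullet> j)) = 
        u i (count_list (i # vs) i) (x \<bullet> i) * (\<Prod>j\<in>Basis - {i}. u j (count_list (i # vs) j) (x \<bullet> j))"
        using that by (subst prod.remove[of _ i]) auto
      also have "(\<Prod>j\<in>Basis - {i}. u j (count_list (i # vs) j) (x \<bullet> j)) = (\<Prod>j\<in>Basis - {i}. u j (count_list vs j) (x \<bullet> j))"
        by (rule prod.cong) auto
      finally show ?thesis by simp
    qed
    show ?thesis using 2 by (simp add: 3 cong: sum.cong)
  qed
  then show ?thesis
    unfolding smooth_with_def
    by (auto intro!: continuous_at_imp_continuous_on has_derivative_continuous)
qed

lemma test_funI_compact:
  assumes "smooth_with UNIV \<phi> D" "compact K" "K \<subseteq> W" "\<And>x. x \<notin> K \<Longrightarrow> \<phi> x = 0"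
  shows "test_fun W \<phi> D"
proof -
  have "support_on UNIV \<phi> \<subseteq> K" using assms(4) by (auto simp: support_on_def)
  then have "closure (support_on UNIV \<phi>) \<subseteq> K"
    using assms(2) by (simp add: closure_minimal compact_imp_closed)
  moreover from this have "compact (closure (support_on UNIV \<phi>))"
    using assms(2) closed_closure compact_Int_closed by (metis inf.absorb_iff2 inf_commute)
  ultimately show ?thesis using assms unfolding test_fun_def by auto
qed

text \<open>The support of h lets f, integrable only on compact subsets, be replaced by its
  truncation to K. The estimate is kept in \<open>ennreal\<close> so that it can be chained with
  averages and block series without integrability conditions.\<close>

lemma loc_integrable_mult:
  assumes f: "loc_integrable W f" and h: "h \<in> borel_measurable borel" and K: "compact K" "K \<subseteq> W"
    and 0: "\<And>x. x \<notin> K \<Longrightarrow> h x = 0" and B: "\<And>x. \<bar>h x\<bar> \<le> B"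
  shows "set_integrable lebesgue W (\<lambda>y. f y * h y)"
    and "ennreal \<bar>LINT y:W|lebesgue. f y * h y\<bar> \<le> ennreal B * (\<integral>\<^sup>+y\<in>K. ennreal \<bar>f y\<bar> \<partial>lebesgue)"
proof -
  have F: "integrable lebesgue (\<lambda>y. indicator K y *\<^sub>R f y)"
    using f K unfolding loc_integrable_def set_integrable_def by auto
  have eq: "(\<lambda>y. indicator W y *\<^sub>R (f y * h y)) = (\<lambda>y. (indicator K y *\<^sub>R f y) * h y)"
    using 0 K by (auto simp: indicator_def fun_eq_iff)
  have h': "h \<in> borel_measurable lebesgue" using h by (simp add: measurable_completion)
  have [measurable]: "(\<lambda>y. indicator K y *\<^sub>R f y) \<in> borel_measurable lebesgue"
    using F by blast
  have B0: "B \<ge> 0" using B[of undefined] by linarith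
  have int: "integrable lebesgue (\<lambda>y. (indicator K y *\<^sub>R f y) * h y)"
  proof (rule Bochner_Integration.integrable_bound)
    show "integrable lebesgue (\<lambda>y. B * (indicator K y *\<^sub>R f y))" using F by auto
    show "(\<lambda>y. (indicator K y *\<^sub>R f y) * h y) \<in> borel_measurable lebesgue" using h' by measurable
    show "AE y in lebesgue. norm ((indicator K y *\<^sub>R f y) * h y) \<le> norm (B * (indicator K y *\<^sub>R f y))"
      using B B0 by (auto simp: abs_mult mult.commute intro!: AE_I2 mult_right_mono)
  qed
  then show "set_integrable lebesgue W (\<lambda>y. f y * h y)" unfolding set_integrable_def eq .
  have "ennreal \<bar>LINT y:W|lebesgue. f y * h y\<bar> \<le> (\<integral>\<^sup>+y. ennreal (norm ((indicator K y *\<^sub>R f y) * h y)) \<partial>lebesgue)"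
    unfolding set_lebesgue_integral_def eq real_norm_def[symmetric]
    by (rule integral_norm_bound_ennreal[OF int])
  also have "\<dots> \<le> (\<integral>\<^sup>+y. ennreal B * (ennreal \<bar>f y\<bar> * indicator K y) \<partial>lebesgue)"
  proof (rule nn_integral_mono)
    fix y
    have "\<bar>f y\<bar> * \<bar>h y\<bar> \<le> B * \<bar>f y\<bar>"
      using mult_left_mono[OF B[of y], of "\<bar>f y\<bar>"] by (simp add: mult.commute)
    then show "ennreal (norm ((indicator K y *\<^sub>R f y) * h y)) \<le> ennreal B * (ennreal \<bar>f y\<bar> * indicator K y)"
      using B0 by (cases "y \<in> K") (auto simp: abs_mult ennreal_mult'[symmetric] intro!: ennreal_leI)
  qed
  also have "\<dots> = ennreal B * (\<integral>\<^sup>+y\<in>K. ennreal \<bar>f y\<bar> \<partial>lebesgue)"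
  proof (rule nn_integral_cmult)
    have "(\<lambda>y. ennreal \<bar>indicator K y *\<^sub>R f y\<bar>) \<in> borel_measurable lebesgue" by measurable
    also have "(\<lambda>y. ennreal \<bar>indicator K y *\<^sub>R f y\<bar>) = (\<lambda>y. ennreal \<bar>f y\<bar> * indicator K y)"
      by (auto simp: indicator_def fun_eq_iff)
    finally show "(\<lambda>y. ennreal \<bar>f y\<bar> * indicator K y) \<in> borel_measurable lebesgue" .
  qed
  finally show "ennreal \<bar>LINT y:W|lebesgue. f y * h y\<bar> \<le> ennreal B * (\<integral>\<^sup>+y\<in>K. ennreal \<bar>f y\<bar> \<partial>lebesgue)" .
qed

lemma smooth_with_continuous: "smooth_with UNIV \<phi> D \<Longrightarrow> D vs \<in> borel_measurable borel"
  unfolding smooth_with_def by (auto intro!: borel_measurable_continuous_onI)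

text \<open>The bumps of the two cubes are exchanged one coordinate at a time: the difference of two
  one-dimensional bumps is the derivative of the difference of two steps, which has compact support.\<close>

lemma cube_avg_diff:
  fixes W :: "'n::euclidean_space set"
  assumes wg: "weak_gradient W f g" and sub: "cbox a b \<subseteq> W" and r: "0 < r" "r \<le> s0" "r \<le> s1"
    and c0: "\<And>i. i \<in> Basis \<Longrightarrow> a \<bullet> i \<le> z0 \<bullet> i - s0 \<and> z0 \<bullet> i + s0 \<le> b \<bullet> i"
    and c1: "\<And>i. i \<in> Basis \<Longrightarrow> a \<bullet> i \<le> z1 \<bullet> i - s1 \<and> z1 \<bullet> i + s1 \<le> b \<bullet> i"
  shows "ennreal \<bar>cube_avg W f z0 s0 - cube_avg W f z1 s1\<bar> \<le>
    ennreal ((step_bound / r) ^ (DIM('n) - 1)) * (\<Sum>i\<in>Basis. \<integral>\<^sup>+y\<in>cbox a b. ennreal \<bar>g y \<bullet> i\<bar> \<partial>lebesgue)"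
proof -
  let ?M = "step_bound / r"
  have s: "s0 > 0" "s1 > 0" using r by auto
  define v0 where "v0 = (\<lambda>i. axis_step (z0 \<bullet> i) s0)"
  define v1 where "v1 = (\<lambda>i. axis_step (z1 \<bullet> i) s1)"
  \<comment> \<open>The shift by \<open>Suc\<close> makes order 0 of \<open>mix\<close> a bump and
    not a step: coordinates in A already carry the bump of the second cube, the others still that of
    the first.\<close>
  define mix where "mix = (\<lambda>A i n. if i \<in> A then v1 i (Suc n) else v0 i (Suc n))"
  have mixd: "deriv_seq (mix A i)" for A i
    unfolding mix_def v0_def v1_def by (cases "i \<in> A") (auto intro!: deriv_seq_shift deriv_seq_axis_step)
  have lb: "step_bound / s0 \<le> ?M" "step_bound / s1 \<le> ?M"
    using r s step_fun(2) by (auto intro!: divide_left_mono)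
  have mixb: "0 \<le> mix A i 0 t \<and> mix A i 0 t \<le> ?M" for A i t
    using lb axis_step_bounds(5,6)[OF s(1), of "z0 \<bullet> i" t] axis_step_bounds(5,6)[OF s(2), of "z1 \<bullet> i" t]
    unfolding mix_def v0_def v1_def by auto
  have mixz: "mix A i 0 t = 0" if "i \<in> Basis" "t < a \<bullet> i \<or> b \<bullet> i < t" for A i t
    using that c0[OF that(1)] c1[OF that(1)] unfolding mix_def v0_def v1_def
    by (auto intro!: axis_step_bounds s)
  define P where "P = (\<lambda>A x. \<Prod>i\<in>Basis. mix A i 0 (x \<bullet> i))"
  have Pz: "P A x = 0" if "x \<notin> cbox a b" for A x
  proof -
    from that obtain i where "i \<in> Basis" "x \<bullet> i < a \<bullet> i \<or> b \<bullet> i < x \<bullet> i"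
      by (auto simp: mem_box not_le)
    then show ?thesis unfolding P_def using mixz by (auto intro!: prod_zero)
  qed
  have Pm: "P A \<in> borel_measurable borel" for A
  proof -
    have "smooth_with UNIV (P A) (\<lambda>vs x. \<Prod>i\<in>Basis. mix A i (count_list vs i) (x \<bullet> i))"
      unfolding P_def by (rule smooth_with_prod) (rule mixd)
    from smooth_with_continuous[OF this, of "[]"] show ?thesis by (simp add: P_def)
  qed
  have Pb: "\<bar>P A x\<bar> \<le> ?M ^ DIM('n)" for A x
  proof -
    have "\<bar>P A x\<bar> \<le> (\<Prod>i\<in>(Basis::'n set). ?M)"
      unfolding P_def abs_prod
    proof (rule prod_mono)
      fix i :: 'n
      show "0 \<le> \<bar>mix A i 0 (x \<bullet> i)\<bar> \<and> \<bar>mix A i 0 (x \<bullet> i)\<bar> \<le> ?M"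
        using mixb[of A i "x \<bullet> i"] by linarith
    qed
    then show ?thesis by simp
  qed
  have lf: "loc_integrable W f" and lg: "\<And>i. i \<in> Basis \<Longrightarrow> loc_integrable W (\<lambda>y. g y \<bullet> i)"
    using wg unfolding weak_gradient_def by auto
  have Pint: "set_integrable lebesgue W (\<lambda>y. f y * P A y)" for A
    by (rule loc_integrable_mult[OF lf Pm compact_cbox sub Pz Pb])
  have step: "ennreal \<bar>(LINT y:W|lebesgue. f y * P (insert j A) y) - (LINT y:W|lebesgue. f y * P A y)\<bar> \<le>
      ennreal (?M ^ (DIM('n) - 1)) * (\<integral>\<^sup>+y\<in>cbox a b. ennreal \<bar>g y \<bullet> j\<bar> \<partial>lebesgue)"
    if j: "j \<in> Basis" "j \<notin> A" for j A
  proof -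
    \<comment> \<open>In coordinate j the factor starts one order lower, with the difference of the
      two steps; one derivative along j turns it into the difference of bumps that separates
      \<open>P (insert j A)\<close> from \<open>P A\<close>.\<close>
    define w where "w = (\<lambda>i n. if i = j then (\<lambda>t. v1 j n t - v0 j n t) else mix A i n)"
    define \<phi> where "\<phi> = (\<lambda>x. \<Prod>i\<in>Basis. w i 0 (x \<bullet> i))"
    define D where "D = (\<lambda>vs x. \<Prod>i\<in>Basis. w i (count_list vs i) (x \<bullet> i))"
    have wj: "w j = (\<lambda>n t. v1 j n t - v0 j n t)" unfolding w_def by auto
    have wi: "w i = mix A i" if "i \<noteq> j" for i using that unfolding w_def by auto
    have wd: "deriv_seq (w i)" for i
      by (cases "i = j") (auto simp: wj wi mixd v0_def v1_def intro!: deriv_seq_diff deriv_seq_axis_step)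
    have sm: "smooth_with UNIV \<phi> D" unfolding \<phi>_def D_def by (rule smooth_with_prod[OF wd])
    \<comment> \<open>A single step has no compact support, but to the right of both intervals both
      steps equal 1, so their difference vanishes there too.\<close>
    have wz: "w i 0 t = 0" if "i \<in> Basis" "t < a \<bullet> i \<or> b \<bullet> i < t" for i t
    proof (cases "i = j")
      case True
      then show ?thesis
        using that(2) c0[OF j(1)] c1[OF j(1)] axis_step_bounds(3,4)[OF s(1), where x = t and c = "z0 \<bullet> j"]
          axis_step_bounds(3,4)[OF s(2), where x = t and c = "z1 \<bullet> j"]
        by (auto simp: wj v0_def v1_def)
    next
      case False then show ?thesis using mixz that by (simp add: wi)
    qed
    have \<phi>z: "\<phi> x = 0" if "x \<notin> cbox a b" for x
    proof -
      from that obtain i where "i \<in> Basis" "x \<bullet> i < a \<bullet> i \<or> b \<bullet> i < x \<bullet> i"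
        by (auto simp: mem_box not_le)
      then show ?thesis unfolding \<phi>_def using wz by (auto intro!: prod_zero)
    qed
    have tf: "test_fun W \<phi> D" by (rule test_funI_compact[OF sm compact_cbox sub \<phi>z])
    \<comment> \<open>The factor in coordinate j is a difference of two values in [0, 1] and costs
      nothing, so only \<open>DIM('n) - 1\<close> powers of 1/r remain. The missing power is the
      factor \<open>t k\<close> gained at each link of the chain.\<close>
    have \<phi>b: "\<bar>\<phi> x\<bar> \<le> ?M ^ (DIM('n) - 1)" for x
    proof -
      have "\<bar>\<phi> x\<bar> = \<bar>w j 0 (x \<bullet> j)\<bar> * (\<Prod>i\<in>Basis - {j}. \<bar>w i 0 (x \<bullet> i)\<bar>)"
        unfolding \<phi>_def abs_prod using j by (subst prod.remove[of _ j]) auto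
      also have "\<dots> \<le> 1 * (\<Prod>i\<in>Basis - {j}. ?M)"
      proof (intro mult_mono prod_mono prod_nonneg)
        show "\<bar>w j 0 (x \<bullet> j)\<bar> \<le> 1"
          using axis_step_bounds(1,2)[OF s(1), of "z0 \<bullet> j" "x \<bullet> j"] axis_step_bounds(1,2)[OF s(2), of "z1 \<bullet> j" "x \<bullet> j"]
          by (auto simp: wj v0_def v1_def)
        show "0 \<le> \<bar>w i 0 (x \<bullet> i)\<bar> \<and> \<bar>w i 0 (x \<bullet> i)\<bar> \<le> ?M" if "i \<in> Basis - {j}" for i
          using that mixb[of A i "x \<bullet> i"] by (auto simp: wi)
      qed auto
      finally show ?thesis using j by (simp add: card_Diff_singleton)
    qed
    have Dj: "D [j] x = P (insert j A) x - P A x" for x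
    proof -
      have mj: "mix (insert j A) j 0 = v1 j (Suc 0)" "mix A j 0 = v0 j (Suc 0)"
        using j(2) by (auto simp: mix_def)
      have pr: "(\<Prod>i\<in>Basis - {j}. mix (insert j A) i 0 (x \<bullet> i)) = (\<Prod>i\<in>Basis - {j}. mix A i 0 (x \<bullet> i))"
        by (intro prod.cong) (auto simp: mix_def)
      have "D [j] x = w j (Suc 0) (x \<bullet> j) * (\<Prod>i\<in>Basis - {j}. w i (count_list [j] i) (x \<bullet> i))"
        unfolding D_def using j by (subst prod.remove[of _ j]) auto
      also have "(\<Prod>i\<in>Basis - {j}. w i (count_list [j] i) (x \<bullet> i)) = (\<Prod>i\<in>Basis - {j}. mix A i 0 (x \<bullet> i))"
        by (rule prod.cong) (auto simp: wi)
      finally have 1: "D [j] x = (v1 j (Suc 0) (x \<bullet> j) - v0 j (Suc 0) (x \<bullet> j)) * (\<Prod>i\<in>Basis - {j}. mix A i 0 (x \<bullet> i))"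
        by (simp add: wj)
      have 2: "P (insert j A) x = v1 j (Suc 0) (x \<bullet> j) * (\<Prod>i\<in>Basis - {j}. mix A i 0 (x \<bullet> i))"
        unfolding P_def using j by (subst prod.remove[of _ j]) (auto simp: pr mj)
      have 3: "P A x = v0 j (Suc 0) (x \<bullet> j) * (\<Prod>i\<in>Basis - {j}. mix A i 0 (x \<bullet> i))"
        unfolding P_def using j by (subst prod.remove[of _ j]) (auto simp: mj)
      show ?thesis unfolding 1 2 3 by (simp add: algebra_simps)
    qed
    have "(LINT y:W|lebesgue. f y * P (insert j A) y) - (LINT y:W|lebesgue. f y * P A y) =
        (LINT y:W|lebesgue. f y * D [j] y)"
      unfolding Dj by (subst set_integral_diff(2)[symmetric, OF Pint Pint]) (simp add: algebra_simps)
    also have "\<dots> = - (LINT y:W|lebesgue. (g y \<bullet> j) * \<phi> y)"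
      using wg tf j(1) unfolding weak_gradient_def by blast
    finally have e: "\<bar>(LINT y:W|lebesgue. f y * P (insert j A) y) - (LINT y:W|lebesgue. f y * P A y)\<bar> =
      \<bar>LINT y:W|lebesgue. (g y \<bullet> j) * \<phi> y\<bar>" by simp
    have \<phi>m: "\<phi> \<in> borel_measurable borel"
      using smooth_with_continuous[OF sm, of "[]"] by (simp add: D_def \<phi>_def)
    show ?thesis unfolding e
      by (rule loc_integrable_mult(2)[OF lg[OF j(1)] \<phi>m compact_cbox sub \<phi>z \<phi>b])
  qed
  have "ennreal \<bar>(LINT y:W|lebesgue. f y * P A y) - (LINT y:W|lebesgue. f y * P {} y)\<bar> \<le>
      ennreal (?M ^ (DIM('n) - 1)) * (\<Sum>i\<in>A. \<integral>\<^sup>+y\<in>cbox a b. ennreal \<bar>g y \<bullet> i\<bar> \<partial>lebesgue)"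
    if "finite A" "A \<subseteq> Basis" for A
    using that
  proof (induction A rule: finite_induct)
    case empty
    then show ?case by simp
  next
    case (insert j A)
    let ?I = "\<lambda>A. LINT y:W|lebesgue. f y * P A y"
    have "ennreal \<bar>?I (insert j A) - ?I {}\<bar> \<le> ennreal (\<bar>?I (insert j A) - ?I A\<bar> + \<bar>?I A - ?I {}\<bar>)"
      by (intro ennreal_leI) auto
    also have "\<dots> = ennreal \<bar>?I (insert j A) - ?I A\<bar> + ennreal \<bar>?I A - ?I {}\<bar>" by simp
    also have "\<dots> \<le> ennreal (?M ^ (DIM('n) - 1)) * (\<integral>\<^sup>+y\<in>cbox a b. ennreal \<bar>g y \<bullet> j\<bar> \<partial>lebesgue) +
       ennreal (?M ^ (DIM('n) - 1)) * (\<Sum>i\<in>A. \<integral>\<^sup>+y\<in>cbox a b. ennreal \<bar>g y \<bullet> i\<bar> \<partial>lebesgue)"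
      using insert by (intro add_mono step) auto
    finally show ?case using insert by (simp add: distrib_left)
  qed
  from this[of Basis] have *: "ennreal \<bar>(LINT y:W|lebesgue. f y * P Basis y) - (LINT y:W|lebesgue. f y * P {} y)\<bar> \<le>
      ennreal (?M ^ (DIM('n) - 1)) * (\<Sum>i\<in>Basis. \<integral>\<^sup>+y\<in>cbox a b. ennreal \<bar>g y \<bullet> i\<bar> \<partial>lebesgue)"
    by simp
  have "P Basis = cube_bump z1 s1" "P {} = cube_bump z0 s0"
    by (auto simp: P_def cube_bump_def mix_def v0_def v1_def fun_eq_iff)
  then show ?thesis using * unfolding cube_avg_def by (simp add: abs_minus_commute)
qed


section \<open>Lebesgue points\<close>

text \<open>The closed ball is a section of a closed subset of the product space, so the claim is
  part of Tonelli's theorem.\<close>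

lemma measurable_cball_integral [measurable]:
  fixes F :: "'n::euclidean_space \<Rightarrow> ennreal"
  assumes [measurable]: "F \<in> borel_measurable borel"
  shows "(\<lambda>x. \<integral>\<^sup>+y\<in>cball x r. F y \<partial>lborel) \<in> borel_measurable borel"
proof -
  have "(\<lambda>x. \<integral>\<^sup>+y. F y * indicator {p::'n \<times> 'n. dist (fst p) (snd p) \<le> r} (x, y) \<partial>lborel) \<in> borel_measurable borel"
    by measurable
  moreover have "indicator {p::'n \<times> 'n. dist (fst p) (snd p) \<le> r} (x, y) = (indicator (cball x r) y :: ennreal)" for x y
    by (auto simp: indicator_def)
  ultimately show ?thesis by simp
qed

text \<open>Let \<mu> have density F and let S be the set in question. Then \<mu>(S) \<le> a |S|
  because F < a on S, while a Vitali covering of S by disjoint balls inside an open U \<supseteq> S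
  gives b |S| \<le> \<mu>(U). Outer regularity of the finite measure \<mu> yields b |S| \<le> a |S|,
  and |S| is finite because S lies in a ball. Restricting the radii to a sequence keeps S
  measurable.\<close>

lemma upper_density_null:
  fixes F :: "'n::euclidean_space \<Rightarrow> ennreal" and t :: "nat \<Rightarrow> real"
  assumes F [measurable]: "F \<in> borel_measurable borel" and fin: "(\<integral>\<^sup>+y. F y \<partial>lborel) < \<infinity>"
    and t: "\<And>k. t k > 0" "t \<longlonglongrightarrow> 0" and ab: "0 \<le> a" "a < b"
  shows "{x \<in> ball 0 n. F x < ennreal a \<and> (\<exists>\<^sub>F k in sequentially.
      ennreal b * emeasure lborel (cball x (t k)) < (\<integral>\<^sup>+y\<in>cball x (t k). F y \<partial>lborel))} \<in> null_sets lborel"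
    (is "?S \<in> _")
proof -
  define v where "v = (\<lambda>k. emeasure lborel (cball (0::'n) (t k)))"
  have vol: "emeasure lborel (cball x (t k)) = v k" for x :: 'n and k
    using t(1)[of k] unfolding v_def by (simp add: emeasure_cball less_imp_le)
  have S [measurable]: "?S \<in> sets borel"
  proof -
    define I where "I = (\<lambda>k x. \<integral>\<^sup>+y\<in>cball x (t k). F y \<partial>lborel)"
    have [measurable]: "I k \<in> borel_measurable borel" for k
      unfolding I_def by (rule measurable_cball_integral[OF F])
    have [measurable]: "ball (0::'n) n \<in> sets borel" by simp
    have "?S = {x \<in> space borel. x \<in> ball 0 n \<and> F x < ennreal a \<and> (\<forall>m. \<exists>k. k \<ge> m \<and> ennreal b * v k < I k x)}"
      unfolding frequently_sequentially vol I_def by auto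
    also have "\<dots> \<in> sets borel" by measurable
    finally show ?thesis .
  qed
  let ?\<mu> = "density lborel F"
  have mu: "emeasure ?\<mu> A = (\<integral>\<^sup>+y\<in>A. F y \<partial>lborel)" if "A \<in> sets borel" for A
    using that by (simp add: emeasure_density)
  have finmu: "emeasure ?\<mu> (space ?\<mu>) \<noteq> \<infinity>"
    using fin mu[of UNIV] by simp
  have muS: "emeasure ?\<mu> ?S \<le> ennreal a * emeasure lborel ?S"
  proof -
    have "emeasure ?\<mu> ?S \<le> (\<integral>\<^sup>+y. ennreal a * indicator ?S y \<partial>lborel)"
      unfolding mu[OF S] by (intro nn_integral_mono) (auto simp: indicator_def)
    also have "\<dots> = ennreal a * emeasure lborel ?S"
      using S by (intro nn_integral_cmult_indicator) (simp only: sets_lborel)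
    finally show ?thesis .
  qed
  have Sfin: "emeasure lborel ?S < \<infinity>"
  proof -
    have "emeasure lborel ?S \<le> emeasure lborel (ball (0::'n) n)" by (intro emeasure_mono) auto
    then show ?thesis using emeasure_lborel_ball_finite[of "0::'n" n] by (simp add: order_le_less_trans)
  qed
  have main: "ennreal b * emeasure lborel ?S \<le> emeasure ?\<mu> U" if U: "?S \<subseteq> U" "open U" for U
  proof -
    define K where "K = {p :: 'n \<times> nat. fst p \<in> ?S \<and> cball (fst p) (t (snd p)) \<subseteq> U \<and>
      ennreal b * emeasure lborel (cball (fst p) (t (snd p))) < (\<integral>\<^sup>+y\<in>cball (fst p) (t (snd p)). F y \<partial>lborel)}"
    have cov: "\<exists>p. p \<in> K \<and> x \<in> cball (fst p) (t (snd p)) \<and> t (snd p) < d" if x: "x \<in> ?S" "0 < d" for x d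
    proof -
      obtain e where e: "e > 0" "cball x e \<subseteq> U" using U x open_contains_cball by blast
      have "eventually (\<lambda>k. t k < min d e) sequentially"
        using t(2) e x(2) by (intro order_tendstoD(2)) auto
      moreover have "\<exists>\<^sub>F k in sequentially.
        ennreal b * emeasure lborel (cball x (t k)) < (\<integral>\<^sup>+y\<in>cball x (t k). F y \<partial>lborel)" using x by blast
      ultimately have "\<exists>\<^sub>F k in sequentially. 
        ennreal b * emeasure lborel (cball x (t k)) < (\<integral>\<^sup>+y\<in>cball x (t k). F y \<partial>lborel) \<and> t k < min d e"
        by (intro frequently_eventually_frequently)
      then obtain k where k: "ennreal b * emeasure lborel (cball x (t k)) < (\<integral>\<^sup>+y\<in>cball x (t k). F y \<partial>lborel)"
        "t k < d" "t k < e" by (auto dest!: frequently_ex)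
      have "cball x (t k) \<subseteq> U" using k(3) e(2) by (meson less_imp_le order_trans subset_cball)
      then show ?thesis using k x t(1)[of k] by (intro exI[of _ "(x, k)"]) (auto simp: K_def less_imp_le)
    qed
    obtain C where C: "countable C" "C \<subseteq> K"
      "pairwise (\<lambda>i j. disjnt (cball (fst i) (t (snd i))) (cball (fst j) (t (snd j)))) C"
      "negligible (?S - (\<Union>i \<in> C. cball (fst i) (t (snd i))))"
      by (rule Vitali_covering_theorem_cballs[of K "\<lambda>p. t (snd p)" ?S fst]) (use cov t in auto)
    let ?B = "\<lambda>i. cball (fst i) (t (snd i))"
    have dis: "disjoint_family_on ?B C"
      using C(3) unfolding disjoint_family_on_def pairwise_def disjnt_def by blast
    have un [measurable]: "(\<Union>i\<in>C. ?B i) \<in> sets borel"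
      using C(1) by (intro sets.countable_UN') auto
    define T where "T = ?S"
    have T: "T \<in> sets lborel" using S unfolding T_def by (simp only: sets_lborel)
    have un': "(\<Union>i\<in>C. ?B i) \<in> sets lborel" using un by (simp only: sets_lborel)
    have nul: "T - (\<Union>i\<in>C. ?B i) \<in> null_sets lborel"
      using C(4) null_sets_completion_iff[OF sets.Diff[OF T un']] unfolding T_def negligible_iff_null_sets by blast
    have "emeasure lborel T \<le> emeasure lborel ((\<Union>i\<in>C. ?B i) \<union> (T - (\<Union>i\<in>C. ?B i)))"
      using T un' by (intro emeasure_mono) auto
    also have "\<dots> = emeasure lborel (\<Union>i\<in>C. ?B i)"
      using nul un' by (intro emeasure_Un_null_set) auto
    finally have "ennreal b * emeasure lborel ?S \<le> ennreal b * emeasure lborel (\<Union>i\<in>C. ?B i)"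
      unfolding T_def by (rule mult_left_mono) simp
    also have "\<dots> = ennreal b * (\<integral>\<^sup>+i. emeasure lborel (?B i) \<partial>count_space C)"
      using C(1) dis by (subst emeasure_UN_countable[of C]) auto
    also have "\<dots> = (\<integral>\<^sup>+i. ennreal b * emeasure lborel (?B i) \<partial>count_space C)"
      by (rule nn_integral_cmult[symmetric]) simp
    also have "\<dots> \<le> (\<integral>\<^sup>+i. emeasure ?\<mu> (?B i) \<partial>count_space C)"
      using C(2) by (intro nn_integral_mono) (auto simp: mu K_def intro!: less_imp_le)
    also have "\<dots> = emeasure ?\<mu> (\<Union>i\<in>C. ?B i)"
      using C(1) dis by (subst emeasure_UN_countable) auto
    also have "\<dots> \<le> emeasure ?\<mu> U"
      using C(2) U by (intro emeasure_mono) (auto simp: K_def)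
    finally show ?thesis .
  qed
  have "ennreal b * emeasure lborel ?S \<le> emeasure ?\<mu> ?S"
    by (subst outer_regular[of ?\<mu>, OF _ finmu S]) (simp, intro INF_greatest main, blast+)
  with muS have "ennreal b * emeasure lborel ?S \<le> ennreal a * emeasure lborel ?S" by (rule order_trans[rotated])
  then have "emeasure lborel ?S = 0"
  proof -
    obtain m where m: "emeasure lborel ?S = ennreal m" "m \<ge> 0"
      using Sfin by (cases "emeasure lborel ?S") auto
    have "b * m \<le> a * m"
      using \<open>ennreal b * emeasure lborel ?S \<le> ennreal a * emeasure lborel ?S\<close> ab m
      by (simp add: ennreal_mult[symmetric] ennreal_le_iff)
    then have "m = 0" using ab m(2) by (simp add: mult_le_cancel_right)
    then show ?thesis using m by simp
  qed
  then show ?thesis using S unfolding null_sets_def sets_lborel by blast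
qed

text \<open>Rational a < b make the exceptional set a countable union of the null sets above. A
  one-sided statement suffices, because it is applied to |f - c|, whose averages only have to be
  small.\<close>

lemma lebesgue_differentiation_upper:
  fixes F :: "'n::euclidean_space \<Rightarrow> real" and t :: "nat \<Rightarrow> real"
  assumes F [measurable]: "F \<in> borel_measurable borel" and fin: "(\<integral>\<^sup>+y. ennreal (F y) \<partial>lborel) < \<infinity>"
    and nn: "\<And>x. F x \<ge> 0" and t: "\<And>k. t k > 0" "t \<longlonglongrightarrow> 0"
  shows "AE x in lborel. \<forall>b>F x. \<forall>\<^sub>F k in sequentially.
    (\<integral>\<^sup>+y\<in>cball x (t k). ennreal (F y) \<partial>lborel) \<le> ennreal b * emeasure lborel (cball x (t k))"
proof -
  have "AE x in lborel. \<forall>a\<in>\<rat>. \<forall>b\<in>\<rat>. \<forall>n::nat. 0 \<le> a \<and> a < b \<longrightarrow> \<not> (x \<in> ball 0 n \<and> F x < a \<and>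
    (\<exists>\<^sub>F k in sequentially.
      ennreal b * emeasure lborel (cball x (t k)) < (\<integral>\<^sup>+y\<in>cball x (t k). ennreal (F y) \<partial>lborel)))"
  proof (intro AE_ball_countable[THEN iffD2] ballI countable_rat AE_all_countable[THEN iffD2] allI)
    fix a b :: real and n :: nat
    show "AE x in lborel. 0 \<le> a \<and> a < b \<longrightarrow> \<not> (x \<in> ball 0 n \<and> F x < a \<and>
      (\<exists>\<^sub>F k in sequentially.
        ennreal b * emeasure lborel (cball x (t k)) < (\<integral>\<^sup>+y\<in>cball x (t k). ennreal (F y) \<partial>lborel)))"
    proof (cases "0 \<le> a \<and> a < b")
      case True
      have "(\<lambda>y. ennreal (F y)) \<in> borel_measurable borel" by measurable
      from upper_density_null[OF this fin t, of a b n] True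
      have N: "{x \<in> ball 0 n. ennreal (F x) < ennreal a \<and> (\<exists>\<^sub>F k in sequentially.
        ennreal b * emeasure lborel (cball x (t k)) < (\<integral>\<^sup>+y\<in>cball x (t k). ennreal (F y) \<partial>lborel))} \<in> null_sets lborel"
        by blast
      show ?thesis
        by (rule AE_I'[OF N]) (auto simp: ennreal_less_iff nn)
    qed auto
  qed
  then show ?thesis
  proof eventually_elim
    fix x assume *: "\<forall>a\<in>\<rat>. \<forall>b\<in>\<rat>. \<forall>n::nat. 0 \<le> a \<and> a < b \<longrightarrow> \<not> (x \<in> ball 0 n \<and> F x < a \<and>
    (\<exists>\<^sub>F k in sequentially.
      ennreal b * emeasure lborel (cball x (t k)) < (\<integral>\<^sup>+y\<in>cball x (t k). ennreal (F y) \<partial>lborel)))"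
    show "\<forall>b>F x. \<forall>\<^sub>F k in sequentially.
      (\<integral>\<^sup>+y\<in>cball x (t k). ennreal (F y) \<partial>lborel) \<le> ennreal b * emeasure lborel (cball x (t k))"
    proof (intro allI impI)
      fix b assume b: "F x < b"
      obtain b' where b': "b' \<in> \<rat>" "F x < b'" "b' < b" using Rats_dense_in_real[OF b] by blast
      obtain a where a: "a \<in> \<rat>" "F x < a" "a < b'" using Rats_dense_in_real[OF b'(2)] by blast
      obtain n :: nat where n: "norm x < n" using reals_Archimedean2 by blast
      have "0 \<le> a" using a nn[of x] by linarith
      then have "\<not> (\<exists>\<^sub>F k in sequentially.
        ennreal b' * emeasure lborel (cball x (t k)) < (\<integral>\<^sup>+y\<in>cball x (t k). ennreal (F y) \<partial>lborel))"
        using * a b' n by (auto simp: dist_norm)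
      then have ev: "\<forall>\<^sub>F k in sequentially.
        (\<integral>\<^sup>+y\<in>cball x (t k). ennreal (F y) \<partial>lborel) \<le> ennreal b' * emeasure lborel (cball x (t k))"
        by (simp add: not_frequently not_less)
      show "\<forall>\<^sub>F k in sequentially.
        (\<integral>\<^sup>+y\<in>cball x (t k). ennreal (F y) \<partial>lborel) \<le> ennreal b * emeasure lborel (cball x (t k))"
        using ev
      proof eventually_elim
        case (elim k)
        have "ennreal b' * emeasure lborel (cball x (t k)) \<le> ennreal b * emeasure lborel (cball x (t k))"
          using b' by (intro mult_right_mono ennreal_leI) auto
        with elim show ?case by (rule order_trans)
      qed
    qed
  qed
qed

text \<open>The functions |f - c| with rational c form a countable family. Choosing c within e/2 of
  f x bounds the average of |f - f x| by e/2 plus the average of |f - c|, which is eventually at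
  most e/2. The cut-off to \<open>ball 0 n\<close> keeps |f - c| integrable.\<close>

lemma lebesgue_points_lborel:
  fixes f :: "'n::euclidean_space \<Rightarrow> real" and t :: "nat \<Rightarrow> real"
  assumes f [measurable]: "f \<in> borel_measurable borel" and fin: "(\<integral>\<^sup>+y. ennreal \<bar>f y\<bar> \<partial>lborel) < \<infinity>"
    and t: "\<And>k. t k > 0" "t \<longlonglongrightarrow> 0"
  shows "AE x in lborel. \<forall>e>0. \<forall>\<^sub>F k in sequentially.
    (\<integral>\<^sup>+y\<in>cball x (t k). ennreal \<bar>f y - f x\<bar> \<partial>lborel) \<le> ennreal e * emeasure lborel (cball x (t k))"
proof -
  have bm [measurable]: "ball (0::'n) r \<in> sets borel" "cball (y::'n) r \<in> sets borel" for r y by simp_all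
  define G where "G = (\<lambda>c (n::nat) y. \<bar>f y - c\<bar> * indicator (ball 0 n) y)"
  have "AE x in lborel. \<forall>c\<in>\<rat>. \<forall>n. \<forall>b>G c n x. \<forall>\<^sub>F k in sequentially.
    (\<integral>\<^sup>+y\<in>cball x (t k). ennreal (G c n y) \<partial>lborel) \<le> ennreal b * emeasure lborel (cball x (t k))"
  proof (intro AE_ball_countable[THEN iffD2] ballI countable_rat AE_all_countable[THEN iffD2] allI)
    fix c :: real and n :: nat
    show "AE x in lborel. \<forall>b>G c n x. \<forall>\<^sub>F k in sequentially.
      (\<integral>\<^sup>+y\<in>cball x (t k). ennreal (G c n y) \<partial>lborel) \<le> ennreal b * emeasure lborel (cball x (t k))"
    proof (rule lebesgue_differentiation_upper[OF _ _ _ t])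
      show "G c n \<in> borel_measurable borel" unfolding G_def
        by (intro borel_measurable_times borel_measurable_indicator) auto
      show "G c n x \<ge> 0" for x unfolding G_def by simp
      have "(\<integral>\<^sup>+y. ennreal (G c n y) \<partial>lborel) \<le> (\<integral>\<^sup>+y. ennreal \<bar>f y\<bar> + ennreal \<bar>c\<bar> * indicator (ball (0::'n) n) y \<partial>lborel)"
        by (intro nn_integral_mono)
          (auto simp: G_def indicator_def ennreal_plus[symmetric] simp del: ennreal_plus intro!: ennreal_leI)
      also have "\<dots> = (\<integral>\<^sup>+y. ennreal \<bar>f y\<bar> \<partial>lborel) + ennreal \<bar>c\<bar> * emeasure lborel (ball (0::'n) n)"
        by (subst nn_integral_add) (measurable, simp add: nn_integral_cmult_indicator)
      also have "\<dots> < \<infinity>"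
        using fin emeasure_lborel_ball_finite[of "0::'n" n] by (simp add: ennreal_mult_less_top)
      finally show "(\<integral>\<^sup>+y. ennreal (G c n y) \<partial>lborel) < \<infinity>" .
    qed
  qed
  then show ?thesis
  proof eventually_elim
    fix x assume *: "\<forall>c\<in>\<rat>. \<forall>n. \<forall>b>G c n x. \<forall>\<^sub>F k in sequentially.
      (\<integral>\<^sup>+y\<in>cball x (t k). ennreal (G c n y) \<partial>lborel) \<le> ennreal b * emeasure lborel (cball x (t k))"
    show "\<forall>e>0. \<forall>\<^sub>F k in sequentially.
      (\<integral>\<^sup>+y\<in>cball x (t k). ennreal \<bar>f y - f x\<bar> \<partial>lborel) \<le> ennreal e * emeasure lborel (cball x (t k))"
    proof (intro allI impI)
      fix e :: real assume e: "e > 0"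
      obtain c where c: "c \<in> \<rat>" "f x < c" "c < f x + e / 2" using Rats_dense_in_real[of "f x" "f x + e / 2"] e by auto
      obtain n :: nat where n: "norm x + 1 < n" using reals_Archimedean2 by blast
      have "G c n x < e / 2" using c n by (auto simp: G_def indicator_def dist_norm)
      then have 1: "\<forall>\<^sub>F k in sequentially.
        (\<integral>\<^sup>+y\<in>cball x (t k). ennreal (G c n y) \<partial>lborel) \<le> ennreal (e / 2) * emeasure lborel (cball x (t k))"
        using * c by blast
      have 2: "\<forall>\<^sub>F k in sequentially. t k < 1" using t(2) by (rule order_tendstoD) simp
      show "\<forall>\<^sub>F k in sequentially.
        (\<integral>\<^sup>+y\<in>cball x (t k). ennreal \<bar>f y - f x\<bar> \<partial>lborel) \<le> ennreal e * emeasure lborel (cball x (t k))"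
        using 1 2
      proof eventually_elim
        case (elim k)
        have "(\<integral>\<^sup>+y\<in>cball x (t k). ennreal \<bar>f y - f x\<bar> \<partial>lborel) \<le>
          (\<integral>\<^sup>+y. ennreal (G c n y) * indicator (cball x (t k)) y + ennreal (e / 2) * indicator (cball x (t k)) y \<partial>lborel)"
        proof (rule nn_integral_mono)
          fix y
          show "ennreal \<bar>f y - f x\<bar> * indicator (cball x (t k)) y \<le>
            ennreal (G c n y) * indicator (cball x (t k)) y + ennreal (e / 2) * indicator (cball x (t k)) y"
          proof (cases "y \<in> cball x (t k)")
            case True
            have "norm y \<le> norm x + dist x y"
              by (metis dist_norm norm_minus_commute norm_triangle_sub)
            then have "y \<in> ball 0 n" using True elim(2) n by (auto simp: dist_norm)
            then have "G c n y = \<bar>f y - c\<bar>" by (simp add: G_def)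
            then show ?thesis using True c e
              by (auto simp: ennreal_plus[symmetric] simp del: ennreal_plus intro!: ennreal_leI)
          qed auto
        qed
        also have "\<dots> = (\<integral>\<^sup>+y\<in>cball x (t k). ennreal (G c n y) \<partial>lborel) + ennreal (e / 2) * emeasure lborel (cball x (t k))"
          unfolding G_def by (subst nn_integral_add) (measurable, simp add: nn_integral_cmult_indicator)
        also have "\<dots> \<le> ennreal (e / 2) * emeasure lborel (cball x (t k)) + ennreal (e / 2) * emeasure lborel (cball x (t k))"
          using elim(1) by (rule add_right_mono)
        also have "\<dots> = ennreal e * emeasure lborel (cball x (t k))"
          using e by (simp add: distrib_right[symmetric] ennreal_plus[symmetric] del: ennreal_plus)
        finally show ?case .
      qed
    qed
  qed
qed

lemma lebesgue_points:
  fixes f :: "'n::euclidean_space \<Rightarrow> real" and t :: "nat \<Rightarrow> real"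
  assumes f: "loc_integrable W f" and W: "open W" and t: "\<And>k. t k > 0" "t \<longlonglongrightarrow> 0"
  shows "AE x in lebesgue. x \<in> W \<longrightarrow> (\<forall>e>0. \<forall>\<^sub>F k in sequentially.
    (\<integral>\<^sup>+y\<in>cball x (t k). ennreal \<bar>f y - f x\<bar> \<partial>lebesgue) \<le> ennreal e * emeasure lborel (cball x (t k)))"
proof -
  obtain C where C: "\<And>n. compact (C n)" "\<And>n. C n \<subseteq> W" "\<And>n. C n \<subseteq> interior (C (Suc n))" "\<Union> (range C) = W"
    using open_Union_compact_subsets[OF W] by metis
  have "AE x in lebesgue. \<forall>n. x \<in> C n \<longrightarrow> (\<forall>e>0. \<forall>\<^sub>F k in sequentially.
    (\<integral>\<^sup>+y\<in>cball x (t k). ennreal \<bar>f y - f x\<bar> \<partial>lebesgue) \<le> ennreal e * emeasure lborel (cball x (t k)))"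
    unfolding AE_all_countable
  proof
    fix n
    \<comment> \<open>A point of \<open>C n\<close> is interior to the next set of the exhaustion,
      so small balls around it do not see the truncation of f.\<close>
    let ?K = "C (Suc n)"
    have int: "integrable lebesgue (\<lambda>y. indicator ?K y *\<^sub>R f y)"
      using f C unfolding loc_integrable_def set_integrable_def by auto
    then have "(\<lambda>y. indicator ?K y *\<^sub>R f y) \<in> borel_measurable lebesgue" by blast
    from completion_ex_borel_measurable_real[OF this] obtain h where h: "h \<in> borel_measurable lborel"
      and eq: "AE y in lborel. indicator ?K y *\<^sub>R f y = h y" by blast
    have [measurable]: "h \<in> borel_measurable borel" using h by simp
    have eq': "AE y in lebesgue. indicator ?K y *\<^sub>R f y = h y" by (rule AE_completion[OF eq])
    have "(\<integral>\<^sup>+y. ennreal \<bar>h y\<bar> \<partial>lborel) = (\<integral>\<^sup>+y. ennreal \<bar>h y\<bar> \<partial>lebesgue)"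
      by (simp add: nn_integral_completion)
    also have "\<dots> = (\<integral>\<^sup>+y. ennreal (norm (indicator ?K y *\<^sub>R f y)) \<partial>lebesgue)"
      by (rule nn_integral_cong_AE) (use eq' in \<open>auto\<close>)
    also have "\<dots> < \<infinity>" using int unfolding integrable_iff_bounded by blast
    finally have "(\<integral>\<^sup>+y. ennreal \<bar>h y\<bar> \<partial>lborel) < \<infinity>" .
    then have "AE x in lborel. \<forall>e>0. \<forall>\<^sub>F k in sequentially.
      (\<integral>\<^sup>+y\<in>cball x (t k). ennreal \<bar>h y - h x\<bar> \<partial>lborel) \<le> ennreal e * emeasure lborel (cball x (t k))"
      by (intro lebesgue_points_lborel t) measurable
    then have "AE x in lebesgue. \<forall>e>0. \<forall>\<^sub>F k in sequentially.
      (\<integral>\<^sup>+y\<in>cball x (t k). ennreal \<bar>h y - h x\<bar> \<partial>lborel) \<le> ennreal e * emeasure lborel (cball x (t k))"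
      by (rule AE_completion)
    with eq' show "AE x in lebesgue. x \<in> C n \<longrightarrow> (\<forall>e>0. \<forall>\<^sub>F k in sequentially.
      (\<integral>\<^sup>+y\<in>cball x (t k). ennreal \<bar>f y - f x\<bar> \<partial>lebesgue) \<le> ennreal e * emeasure lborel (cball x (t k)))"
    proof eventually_elim
      case (elim x)
      show ?case
      proof (intro impI allI)
        fix e :: real assume x: "x \<in> C n" and e: "e > 0"
        then have "x \<in> interior ?K" using C(3) by blast
        then obtain d where d: "d > 0" "cball x d \<subseteq> ?K" by (meson mem_interior_cball)
        have "x \<in> ?K" using d by auto
        then have hx: "f x = h x" using elim(1) by (simp add: indicator_def)
        have ev: "\<forall>\<^sub>F k in sequentially. t k < d" using t(2) d(1) by (rule order_tendstoD)
        have ev2: "\<forall>\<^sub>F k in sequentially.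
          (\<integral>\<^sup>+y\<in>cball x (t k). ennreal \<bar>h y - h x\<bar> \<partial>lborel) \<le> ennreal e * emeasure lborel (cball x (t k))"
          using elim(2) e by blast
        show "\<forall>\<^sub>F k in sequentially.
          (\<integral>\<^sup>+y\<in>cball x (t k). ennreal \<bar>f y - f x\<bar> \<partial>lebesgue) \<le> ennreal e * emeasure lborel (cball x (t k))"
          using ev ev2
        proof eventually_elim
          case (elim k)
          have "(\<integral>\<^sup>+y\<in>cball x (t k). ennreal \<bar>f y - f x\<bar> \<partial>lebesgue) = (\<integral>\<^sup>+y\<in>cball x (t k). ennreal \<bar>h y - h x\<bar> \<partial>lebesgue)"
          proof (rule nn_integral_cong_AE)
            show "AE y in lebesgue. ennreal \<bar>f y - f x\<bar> * indicator (cball x (t k)) y = ennreal \<bar>h y - h x\<bar> * indicator (cball x (t k)) y"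
              using eq'
            proof eventually_elim
              case (elim y)
              have "y \<in> cball x (t k) \<Longrightarrow> y \<in> ?K" using d(2) \<open>t k < d\<close> by auto
              then show ?case using elim hx by (auto simp: indicator_def)
            qed
          qed
          then show ?case using elim(2) by (simp add: nn_integral_completion)
        qed
      qed
    qed
  qed
  then show ?thesis by eventually_elim (use C(4) in blast)
qed


section \<open>Majorisation by blocks\<close>

text \<open>Integrating this and optimising over \<open>s\<close> replaces both Hoelder's and Jensen's inequality.\<close>

lemma young_split:
  fixes y s q :: real
  assumes "y \<ge> 0" "s > 0" "q > 1"
  shows "y \<le> s + s powr (1 - q) * y powr q"
proof (cases "y \<le> s")
  case True
  then show ?thesis by (simp add: add_increasing2)
next
  case False
  then have y: "y > s" "y > 0" using assms by auto
  have "y = y powr (1 - q) * y powr q" using y by (simp add: powr_add[symmetric])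
  also have "\<dots> \<le> s powr (1 - q) * y powr q"
    using assms y by (intro mult_right_mono powr_mono2') auto
  finally show ?thesis using assms by linarith
qed

lemma set_nn_integral_young:
  fixes \<psi> :: "'n::euclidean_space \<Rightarrow> real"
  assumes [measurable]: "\<psi> \<in> borel_measurable borel" "S \<in> sets borel" and nn: "\<And>y. 0 \<le> \<psi> y"
    and m: "emeasure lborel S \<le> ennreal m" "0 \<le> m" and J: "(\<integral>\<^sup>+y\<in>S. ennreal (\<psi> y powr q) \<partial>lborel) \<le> ennreal J" "0 \<le> J"
    and s: "0 < s" "1 < q"
  shows "(\<integral>\<^sup>+y\<in>S. ennreal (\<psi> y) \<partial>lborel) \<le> ennreal (s * m + s powr (1 - q) * J)"
proof -
  have "(\<integral>\<^sup>+y\<in>S. ennreal (\<psi> y) \<partial>lborel) \<le>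
    (\<integral>\<^sup>+y. ennreal s * indicator S y + ennreal (s powr (1 - q)) * (ennreal (\<psi> y powr q) * indicator S y) \<partial>lborel)"
  proof (rule nn_integral_mono)
    fix y
    have "ennreal (\<psi> y) \<le> ennreal (s + s powr (1 - q) * \<psi> y powr q)"
      using young_split[OF nn[of y] s] by (rule ennreal_leI)
    also have "\<dots> = ennreal s + ennreal (s powr (1 - q)) * ennreal (\<psi> y powr q)"
      using s by (simp add: ennreal_mult)
    finally show "ennreal (\<psi> y) * indicator S y \<le>
      ennreal s * indicator S y + ennreal (s powr (1 - q)) * (ennreal (\<psi> y powr q) * indicator S y)"
      by (simp add: indicator_def)
  qed
  also have "\<dots> = ennreal s * emeasure lborel S + ennreal (s powr (1 - q)) * (\<integral>\<^sup>+y\<in>S. ennreal (\<psi> y powr q) \<partial>lborel)"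
    by (subst nn_integral_add) (measurable, simp add: nn_integral_cmult nn_integral_cmult_indicator)
  also have "\<dots> \<le> ennreal s * ennreal m + ennreal (s powr (1 - q)) * ennreal J"
    using m J by (intro add_mono mult_left_mono) auto
  also have "\<dots> = ennreal (s * m + s powr (1 - q) * J)"
    using s m J by (simp add: ennreal_mult)
  finally show ?thesis .
qed

locale block_space =
  fixes \<Omega> :: "'n::euclidean_space set" and q lam :: real
  assumes open_domain: "open \<Omega>" and bounded_domain: "bounded \<Omega>" and nonempty_domain: "\<Omega> \<noteq> {}"
    and q: "1 < q" and lam: "0 \<le> lam" "lam < real DIM('n)"
begin

definition vol :: real where "vol = unit_ball_vol (real DIM('n))"

lemma vol_pos: "vol > 0" unfolding vol_def by (rule unit_ball_vol_pos) simp

lemma emeasure_cball_vol: "r \<ge> 0 \<Longrightarrow> emeasure lborel (cball (x::'n) r) = ennreal (vol * r ^ DIM('n))"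
  unfolding vol_def by (rule emeasure_cball)

text \<open>The bound is the \<open>q\<close>-th power of the normalisation of a block, as \<open>lam * q / q' = lam * (q - 1)\<close>.\<close>

definition nonneg_block :: "('n \<Rightarrow> real) \<Rightarrow> bool" where
  "nonneg_block \<psi> \<longleftrightarrow> \<psi> \<in> borel_measurable borel \<and> (\<forall>y. 0 \<le> \<psi> y) \<and>
     (\<exists>x\<in>\<Omega>. \<exists>R>0. (\<forall>y. y \<notin> cball x R \<longrightarrow> \<psi> y = 0) \<and>
        (\<integral>\<^sup>+y. ennreal (\<psi> y powr q) \<partial>lborel) \<le> ennreal (R powr (- (lam * (q - 1)))))"

lemma nonneg_block_measurable [measurable_dest]: "nonneg_block \<psi> \<Longrightarrow> \<psi> \<in> borel_measurable borel"
  and nonneg_block_nonneg: "nonneg_block \<psi> \<Longrightarrow> 0 \<le> \<psi> y"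
  unfolding nonneg_block_def by auto

text \<open>A solid form of the block norm: it asks only for an upper bound by a nonnegative series
  with values in \<open>ennreal\<close>, so countable sums, averages and pointwise estimates pass
  through without questions of convergence or of measurability of F. Signs and exact sums are
  recovered in \<open>in_H_of_majorized\<close>.\<close>

definition majorized :: "('n \<Rightarrow> ennreal) \<Rightarrow> ennreal \<Rightarrow> bool" where
  "majorized F s \<longleftrightarrow> (\<exists>a \<psi>. (\<forall>k. nonneg_block (\<psi> k)) \<and> (\<Sum>k. a k) \<le> s \<and>
     (AE y in lebesgue. y \<in> \<Omega> \<longrightarrow> F y \<le> (\<Sum>k. a k * ennreal (\<psi> k y))))"

lemma majorized_mono:
  assumes "majorized G s" "AE y in lebesgue. y \<in> \<Omega> \<longrightarrow> F y \<le> G y" "s \<le> s'"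
  shows "majorized F s'"
proof -
  from assms(1) obtain a \<psi> where a: "\<And>k. nonneg_block (\<psi> k)" "(\<Sum>k. a k) \<le> s"
    "AE y in lebesgue. y \<in> \<Omega> \<longrightarrow> G y \<le> (\<Sum>k. a k * ennreal (\<psi> k y))"
    unfolding majorized_def by blast
  have "AE y in lebesgue. y \<in> \<Omega> \<longrightarrow> F y \<le> (\<Sum>k. a k * ennreal (\<psi> k y))"
    using a(3) assms(2) by eventually_elim auto
  then show ?thesis unfolding majorized_def using a(1,2) assms(3) by (meson order_trans)
qed

lemma majorized_suminf:
  assumes "\<And>k::nat. majorized (F k) (s k)"
  shows "majorized (\<lambda>y. \<Sum>k. F k y) (\<Sum>k. s k)"
proof -
  from assms have "\<forall>k. \<exists>a \<psi>. (\<forall>j. nonneg_block (\<psi> j)) \<and> (\<Sum>j. a j) \<le> s k \<and>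
     (AE y in lebesgue. y \<in> \<Omega> \<longrightarrow> F k y \<le> (\<Sum>j. a j * ennreal (\<psi> j y)))"
    unfolding majorized_def by blast
  then obtain a \<psi> where a: "\<And>k j. nonneg_block (\<psi> k j)" "\<And>k. (\<Sum>j. a k j) \<le> s k"
    "\<And>k. AE y in lebesgue. y \<in> \<Omega> \<longrightarrow> F k y \<le> (\<Sum>j. a k j * ennreal (\<psi> k j y))"
    unfolding choice_iff by blast
  show ?thesis
    unfolding majorized_def
  proof (intro exI conjI allI)
    let ?a = "\<lambda>i. case prod_decode i of (k, j) \<Rightarrow> a k j"
    let ?\<psi> = "\<lambda>i. case prod_decode i of (k, j) \<Rightarrow> \<psi> k j"
    show "nonneg_block (?\<psi> i)" for i using a(1) by (simp split: prod.split)
    have "(\<Sum>i. ?a i) = (\<Sum>k. \<Sum>j. a k j)"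
      by (rule suminf_ennreal_2dimen[where f = "\<lambda>(k, j). a k j"]) simp
    also have "\<dots> \<le> (\<Sum>k. s k)" by (intro suminf_le a) auto
    finally show "(\<Sum>i. ?a i) \<le> (\<Sum>k. s k)" .
    have e: "(\<Sum>i. ?a i * ennreal (?\<psi> i y)) = (\<Sum>k. \<Sum>j. a k j * ennreal (\<psi> k j y))" for y
      using suminf_ennreal_2dimen[where f = "\<lambda>(k, j). a k j * ennreal (\<psi> k j y)"
          and g = "\<lambda>k. \<Sum>j. a k j * ennreal (\<psi> k j y)"]
      by (simp add: split_beta)
    have "AE y in lebesgue. \<forall>k. y \<in> \<Omega> \<longrightarrow> F k y \<le> (\<Sum>j. a k j * ennreal (\<psi> k j y))"
      unfolding AE_all_countable using a(3) by blast
    then show "AE y in lebesgue. y \<in> \<Omega> \<longrightarrow> (\<Sum>k. F k y) \<le> (\<Sum>i. ?a i * ennreal (?\<psi> i y))"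
      unfolding e by eventually_elim (auto intro!: suminf_le)
  qed
qed

lemma majorized_cmult:
  assumes "majorized F s"
  shows "majorized (\<lambda>y. c * F y) (c * s)"
proof -
  from assms obtain a \<psi> where a: "\<And>k. nonneg_block (\<psi> k)" "(\<Sum>k. a k) \<le> s"
    "AE y in lebesgue. y \<in> \<Omega> \<longrightarrow> F y \<le> (\<Sum>k. a k * ennreal (\<psi> k y))"
    unfolding majorized_def by blast
  show ?thesis
    unfolding majorized_def
  proof (intro exI conjI allI)
    show "nonneg_block (\<psi> k)" for k by (rule a)
    show "(\<Sum>k. c * a k) \<le> c * s" using a(2) by (simp add: mult_left_mono)
    show "AE y in lebesgue. y \<in> \<Omega> \<longrightarrow> c * F y \<le> (\<Sum>k. (c * a k) * ennreal (\<psi> k y))"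
      using a(3) by eventually_elim (auto simp: mult.assoc intro!: mult_left_mono)
  qed
qed

lemma nonneg_block_0: "nonneg_block (\<lambda>_. 0)"
proof -
  obtain x where "x \<in> \<Omega>" using nonempty_domain by blast
  then show ?thesis unfolding nonneg_block_def using q by (auto intro!: bexI[of _ x] exI[of _ 1])
qed

lemma majorized_block:
  assumes "nonneg_block \<psi>"
  shows "majorized (\<lambda>y. ennreal (\<psi> y)) 1"
  unfolding majorized_def
proof (intro exI conjI allI)
  let ?a = "\<lambda>k::nat. if k = 0 then 1 else 0 :: ennreal"
  show "nonneg_block \<psi>" for k :: nat by (rule assms)
  have e: "(\<Sum>k. ?a k * c) = c" for c by (subst suminf_finite[of "{0}"]) auto
  from e[of 1] show "(\<Sum>k. ?a k) \<le> 1" by simp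
  show "AE y in lebesgue. y \<in> \<Omega> \<longrightarrow> ennreal (\<psi> y) \<le> (\<Sum>k. ?a k * ennreal (\<psi> y))"
    unfolding e by simp
qed

lemma majorized_0: "majorized (\<lambda>_. 0) 0"
  using majorized_cmult[OF majorized_block[OF nonneg_block_0], of 0] by simp

lemma majorized_add:
  assumes "majorized F s" "majorized G t"
  shows "majorized (\<lambda>y. F y + G y) (s + t)"
proof -
  let ?F = "\<lambda>k::nat. if k = 0 then F else if k = 1 then G else (\<lambda>_. 0)"
  let ?s = "\<lambda>k::nat. if k = 0 then s else if k = 1 then t else 0"
  have "majorized (\<lambda>y. \<Sum>k. ?F k y) (\<Sum>k. ?s k)"
    by (rule majorized_suminf) (auto simp: assms majorized_0)
  moreover have "(\<Sum>k. ?F k y) = F y + G y" for y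
    by (subst suminf_finite[of "{0,1}"]) auto
  moreover have "(\<Sum>k. ?s k) = s + t"
    by (subst suminf_finite[of "{0,1}"]) auto
  ultimately show ?thesis by simp
qed

lemma majorized_sum:
  assumes "finite I" "\<And>i. i \<in> I \<Longrightarrow> majorized (F i) (s i)"
  shows "majorized (\<lambda>y. \<Sum>i\<in>I. F i y) (\<Sum>i\<in>I. s i)"
  using assms by (induction I rule: finite_induct) (auto simp: majorized_0 intro!: majorized_add)

lemma majorized_of_powr_bound:
  assumes [measurable]: "h \<in> borel_measurable borel" and nn: "\<And>y. 0 \<le> h y" and x: "x \<in> \<Omega>" and R: "R > 0" and c: "c > 0"
    and supp: "\<And>y. y \<notin> cball x R \<Longrightarrow> h y = 0"
    and bd: "(\<integral>\<^sup>+y. ennreal (h y powr q) \<partial>lborel) \<le> ennreal (c powr q * R powr (- (lam * (q - 1))))"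
  shows "majorized (\<lambda>y. ennreal (h y)) (ennreal c)"
proof -
  have "nonneg_block (\<lambda>y. h y / c)"
    unfolding nonneg_block_def
  proof (intro conjI allI bexI[OF _ x] exI[of _ R] R impI)
    show "(\<lambda>y. h y / c) \<in> borel_measurable borel" by measurable
    show "0 \<le> h y / c" for y using nn c by simp
    show "h y / c = 0" if "y \<notin> cball x R" for y using supp that by simp
    have "(\<integral>\<^sup>+y. ennreal ((h y / c) powr q) \<partial>lborel) = (\<integral>\<^sup>+y. ennreal (c powr (- q)) * ennreal (h y powr q) \<partial>lborel)"
      using c nn by (intro nn_integral_cong) (simp add: ennreal_mult[symmetric] powr_divide powr_minus field_simps)
    also have "\<dots> = ennreal (c powr (- q)) * (\<integral>\<^sup>+y. ennreal (h y powr q) \<partial>lborel)"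
      by (rule nn_integral_cmult) measurable
    also have "\<dots> \<le> ennreal (c powr (- q)) * ennreal (c powr q * R powr (- (lam * (q - 1))))"
      by (rule mult_left_mono[OF bd]) simp
    also have "\<dots> = ennreal (R powr (- (lam * (q - 1))))"
      using c by (simp add: ennreal_mult[symmetric] powr_minus field_simps)
    finally show "(\<integral>\<^sup>+y. ennreal ((h y / c) powr q) \<partial>lborel) \<le> ennreal (R powr (- (lam * (q - 1))))" .
  qed
  from majorized_cmult[OF majorized_block[OF this], of "ennreal c"]
  show ?thesis using c nn by (simp add: ennreal_mult[symmetric])
qed

lemma majorized_const: "\<exists>C. majorized (\<lambda>_. 1) (ennreal C) \<and> C > 0"
proof -
  obtain x where x: "x \<in> \<Omega>" using nonempty_domain by blast
  obtain R where R: "R > 0" "\<Omega> \<subseteq> cball x R"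
    using bounded_subset_ballD[OF bounded_domain, of x] ball_subset_cball by blast
  \<comment> \<open>Solved from
    \<open>vol * R ^ DIM('n) = c powr q * R powr (- (lam * (q - 1)))\<close>, the condition for the
    indicator of the ball to be c times a block.\<close>
  define c where "c = (vol * R ^ DIM('n) / R powr (- (lam * (q - 1)))) powr (1 / q)"
  have c: "c > 0" unfolding c_def using vol_pos R by simp
  have cq: "c powr q = vol * R ^ DIM('n) / R powr (- (lam * (q - 1)))"
    unfolding c_def using vol_pos R q by (simp add: powr_powr)
  have [measurable]: "cball x R \<in> sets borel" by simp
  have "majorized (\<lambda>y. ennreal (indicator (cball x R) y)) (ennreal c)"
  proof (rule majorized_of_powr_bound[OF _ _ x R(1) c])
    have "(\<integral>\<^sup>+y. ennreal (indicator (cball x R) y powr q) \<partial>lborel) = (\<integral>\<^sup>+y. indicator (cball x R) y \<partial>lborel)"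
      using q by (intro nn_integral_cong) (auto simp: indicator_def)
    also have "\<dots> = ennreal (vol * R ^ DIM('n))" using R by (simp add: emeasure_cball_vol)
    also have "vol * R ^ DIM('n) = c powr q * R powr (- (lam * (q - 1)))"
      unfolding cq using R by simp
    finally show "(\<integral>\<^sup>+y. ennreal (indicator (cball x R) y powr q) \<partial>lborel) \<le> ennreal (c powr q * R powr (- (lam * (q - 1))))"
      by simp
  qed auto
  then have "majorized (\<lambda>_. 1) (ennreal c)"
    by (rule majorized_mono) (use R in \<open>auto intro!: AE_I2\<close>)
  then show ?thesis using c by blast
qed

text \<open>The exponent (n - \<open>lam\<close>)/q': the total mass of a block of radius R is at
  most of order \<open>R powr gam\<close>. Since \<open>lam\<close> < n, small blocks have small
  mass.\<close>

definition gam :: real where "gam = (q - 1) * (real DIM('n) - lam) / q"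

lemma gam_pos: "gam > 0" unfolding gam_def using q lam by simp

lemma block_integral_le:
  fixes \<psi> :: "'n \<Rightarrow> real"
  assumes b: "\<psi> \<in> borel_measurable borel" "\<And>y. 0 \<le> \<psi> y" and R: "R > 0" and supp: "\<And>y. y \<notin> cball x R \<Longrightarrow> \<psi> y = 0"
    and bd: "(\<integral>\<^sup>+y. ennreal (\<psi> y powr q) \<partial>lborel) \<le> ennreal (R powr (- (lam * (q - 1))))"
  shows "(\<integral>\<^sup>+y. ennreal (\<psi> y) \<partial>lborel) \<le> ennreal ((vol + 1) * R powr gam)"
proof -
  \<comment> \<open>The value at which \<open>s * R ^ DIM('n)\<close> and
    \<open>s powr (1 - q) * R powr (- (lam * (q - 1)))\<close> coincide.\<close>
  define s where "s = R powr (- (real DIM('n) + lam * (q - 1)) / q)"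
  have "(\<integral>\<^sup>+y. ennreal (\<psi> y) \<partial>lborel) = (\<integral>\<^sup>+y\<in>cball x R. ennreal (\<psi> y) \<partial>lborel)"
    using supp by (intro nn_integral_cong) (auto simp: indicator_def)
  also have "\<dots> \<le> ennreal (s * (vol * R ^ DIM('n)) + s powr (1 - q) * R powr (- (lam * (q - 1))))"
  proof (rule set_nn_integral_young[OF b(1) _ b(2)])
    show "(\<integral>\<^sup>+y\<in>cball x R. ennreal (\<psi> y powr q) \<partial>lborel) \<le> ennreal (R powr (- (lam * (q - 1))))"
      by (rule order_trans[OF nn_integral_mono bd]) (auto simp: indicator_def)
  qed (use R vol_pos q in \<open>auto simp: emeasure_cball_vol s_def\<close>)
  also have "s * (vol * R ^ DIM('n)) + s powr (1 - q) * R powr (- (lam * (q - 1))) = (vol + 1) * R powr gam"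
  proof -
    have "s * R ^ DIM('n) = R powr (- (real DIM('n) + lam * (q - 1)) / q + real DIM('n))"
      unfolding s_def using R by (simp add: powr_add powr_realpow)
    also have "- (real DIM('n) + lam * (q - 1)) / q + real DIM('n) = gam"
      unfolding gam_def using q by (simp add: field_simps)
    finally have 1: "s * R ^ DIM('n) = R powr gam" .
    have "s powr (1 - q) * R powr (- (lam * (q - 1))) =
      R powr (- (real DIM('n) + lam * (q - 1)) / q * (1 - q) + - (lam * (q - 1)))"
      unfolding s_def powr_powr powr_add ..
    also have "- (real DIM('n) + lam * (q - 1)) / q * (1 - q) + - (lam * (q - 1)) = gam"
      unfolding gam_def using q by (simp add: field_simps)
    finally have 2: "s powr (1 - q) * R powr (- (lam * (q - 1))) = R powr gam" .
    show ?thesis unfolding 2 using 1 by (simp add: algebra_simps)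
  qed
  finally show ?thesis .
qed

text \<open>Blocks have uniformly bounded mass on the domain: for R \<le> 1 because
  \<open>gam\<close> > 0, and for R > 1 because the domain has finite measure and the bound on the
  q-th powers is then at most 1, so that Young's split with s = 1 is enough.\<close>

lemma majorized_integral: "\<exists>C>0. \<forall>F s. majorized F s \<longrightarrow> (\<integral>\<^sup>+y\<in>\<Omega>. F y \<partial>lebesgue) \<le> ennreal C * s"
proof -
  define m where "m = measure lborel \<Omega>"
  have [measurable]: "\<Omega> \<in> sets borel" using open_domain by simp
  have m: "emeasure lborel \<Omega> \<le> ennreal m" "0 \<le> m"
    unfolding m_def using emeasure_bounded_finite[OF bounded_domain]
    by (auto simp: emeasure_eq_ennreal_measure less_top)
  define C where "C = m + vol + 2"
  have C: "C > 0" unfolding C_def using m vol_pos by linarith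
  have blk: "(\<integral>\<^sup>+y\<in>\<Omega>. ennreal (\<psi> y) \<partial>lborel) \<le> ennreal C" if "nonneg_block \<psi>" for \<psi>
  proof -
    from that obtain x R where \<psi> [measurable]: "\<psi> \<in> borel_measurable borel" and nn: "\<And>y. 0 \<le> \<psi> y" and R: "R > 0"
      and supp: "\<And>y. y \<notin> cball x R \<Longrightarrow> \<psi> y = 0"
      and bd: "(\<integral>\<^sup>+y. ennreal (\<psi> y powr q) \<partial>lborel) \<le> ennreal (R powr (- (lam * (q - 1))))"
      unfolding nonneg_block_def by blast
    show ?thesis
    proof (cases "R \<le> 1")
      case True
      have "(\<integral>\<^sup>+y\<in>\<Omega>. ennreal (\<psi> y) \<partial>lborel) \<le> (\<integral>\<^sup>+y. ennreal (\<psi> y) \<partial>lborel)"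
        by (intro nn_integral_mono) (auto simp: indicator_def)
      also have "\<dots> \<le> ennreal ((vol + 1) * R powr gam)"
        by (rule block_integral_le[OF \<psi> nn R supp bd])
      also have "\<dots> \<le> ennreal C"
      proof (rule ennreal_leI)
        have "R powr gam \<le> 1" using True R gam_pos by (simp add: powr_le1)
        then have "(vol + 1) * R powr gam \<le> (vol + 1) * 1" using vol_pos by (intro mult_left_mono) auto
        then show "(vol + 1) * R powr gam \<le> C" unfolding C_def using m by simp
      qed
      finally show ?thesis .
    next
      case False
      have "(\<integral>\<^sup>+y\<in>\<Omega>. ennreal (\<psi> y) \<partial>lborel) \<le> ennreal (1 * m + 1 powr (1 - q) * R powr (- (lam * (q - 1))))"
      proof (rule set_nn_integral_young[OF \<psi> _ nn m])
        show "(\<integral>\<^sup>+y\<in>\<Omega>. ennreal (\<psi> y powr q) \<partial>lborel) \<le> ennreal (R powr (- (lam * (q - 1))))"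
          by (rule order_trans[OF nn_integral_mono bd]) (auto simp: indicator_def)
      qed (use q in auto)
      also have "\<dots> \<le> ennreal C"
      proof (rule ennreal_leI)
        have "R powr (- (lam * (q - 1))) \<le> R powr 0"
          using False q lam by (intro powr_mono) auto
        then show "1 * m + 1 powr (1 - q) * R powr (- (lam * (q - 1))) \<le> C"
          unfolding C_def using vol_pos R by simp
      qed
      finally show ?thesis .
    qed
  qed
  show ?thesis
  proof (intro exI[of _ C] conjI C allI impI)
    fix F s assume "majorized F s"
    then obtain a \<psi> where a: "\<And>k. nonneg_block (\<psi> k)" "(\<Sum>k. a k) \<le> s"
      "AE y in lebesgue. y \<in> \<Omega> \<longrightarrow> F y \<le> (\<Sum>k. a k * ennreal (\<psi> k y))"
      unfolding majorized_def by blast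
    have [measurable]: "\<psi> k \<in> borel_measurable borel" for k using a(1) by (rule nonneg_block_measurable)
    have "(\<integral>\<^sup>+y\<in>\<Omega>. F y \<partial>lebesgue) \<le> (\<integral>\<^sup>+y. (\<Sum>k. a k * (ennreal (\<psi> k y) * indicator \<Omega> y)) \<partial>lebesgue)"
    proof (rule nn_integral_mono_AE)
      show "AE y in lebesgue. F y * indicator \<Omega> y \<le> (\<Sum>k. a k * (ennreal (\<psi> k y) * indicator \<Omega> y))"
        using a(3) by eventually_elim (auto simp: indicator_def)
    qed
    also have "\<dots> = (\<integral>\<^sup>+y. (\<Sum>k. a k * (ennreal (\<psi> k y) * indicator \<Omega> y)) \<partial>lborel)"
      by (rule nn_integral_completion)
    also have "\<dots> = (\<Sum>k. a k * (\<integral>\<^sup>+y\<in>\<Omega>. ennreal (\<psi> k y) \<partial>lborel))"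
      by (subst nn_integral_suminf) (measurable, simp add: nn_integral_cmult)
    also have "\<dots> \<le> (\<Sum>k. a k * ennreal C)"
      by (intro suminf_le mult_left_mono blk a) auto
    also have "\<dots> = (\<Sum>k. a k) * ennreal C" by (rule ennreal_suminf_multc)
    also have "\<dots> \<le> s * ennreal C" using a(2) by (rule mult_right_mono) simp
    finally show "(\<integral>\<^sup>+y\<in>\<Omega>. F y \<partial>lebesgue) \<le> ennreal C * s" by (simp add: mult.commute)
  qed
qed


section \<open>Averaging operators on blocks\<close>

definition ball_avg :: "real \<Rightarrow> ('n \<Rightarrow> ennreal) \<Rightarrow> 'n \<Rightarrow> ennreal" where
  "ball_avg t F x = ennreal (1 / t ^ DIM('n)) * (\<integral>\<^sup>+y\<in>cball x t \<inter> \<Omega>. F y \<partial>lebesgue)"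

text \<open>\<open>(vol + 1) powr q\<close> is the loss in Young's split,
  \<open>vol * 2 ^ DIM('n)\<close> covers both the volume that Tonelli produces and the volume of a
  ball of doubled radius, and the last factor pays for doubling the radius in the normalisation of a
  block.\<close>

definition avg_const :: real where
  "avg_const = ((vol + 1) powr q * vol * 2 ^ DIM('n) * 2 powr (lam * (q - 1))) powr (1 / q)"

lemma avg_const_pos: "avg_const > 0"
  and avg_const_powr: "avg_const powr q = (vol + 1) powr q * vol * 2 ^ DIM('n) * 2 powr (lam * (q - 1))"
  unfolding avg_const_def using vol_pos q by (auto simp: powr_powr)

lemma powr_local_avg_le:
  fixes \<psi> :: "'n \<Rightarrow> real"
  assumes \<psi>: "\<psi> \<in> borel_measurable borel" and nn: "\<And>y. 0 \<le> \<psi> y" and t: "t > 0"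
    and fin: "(\<integral>\<^sup>+y\<in>cball x t. ennreal (\<psi> y powr q) \<partial>lborel) < \<infinity>"
  shows "ennreal ((enn2real (\<integral>\<^sup>+y\<in>cball x t. ennreal (\<psi> y) \<partial>lborel) / t ^ DIM('n)) powr q) \<le>
    ennreal ((vol + 1) powr q / t ^ DIM('n)) * (\<integral>\<^sup>+y\<in>cball x t. ennreal (\<psi> y powr q) \<partial>lborel)"
proof -
  let ?I = "\<integral>\<^sup>+y\<in>cball x t. ennreal (\<psi> y) \<partial>lborel"
  let ?T = "t ^ DIM('n)"
  obtain J where J: "(\<integral>\<^sup>+y\<in>cball x t. ennreal (\<psi> y powr q) \<partial>lborel) = ennreal J" "0 \<le> J"
    using fin by (cases "\<integral>\<^sup>+y\<in>cball x t. ennreal (\<psi> y powr q) \<partial>lborel") auto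
  have T: "?T > 0" using t by simp
  have *: "?I \<le> ennreal (s * (vol * ?T) + s powr (1 - q) * J)" if "s > 0" for s
    by (rule set_nn_integral_young[OF \<psi> _ nn]) (use that J t vol_pos q in \<open>auto simp: emeasure_cball_vol\<close>)
  have nonneg: "0 \<le> s * (vol * ?T) + s powr (1 - q) * J" if "s > 0" for s
    using that T vol_pos J by (intro add_nonneg_nonneg mult_nonneg_nonneg) auto
  have **: "enn2real ?I \<le> s * (vol * ?T) + s powr (1 - q) * J" if "s > 0" for s
    using enn2real_mono[OF *[OF that]] nonneg[OF that] by simp
  have "(enn2real ?I / ?T) powr q \<le> (vol + 1) powr q / ?T * J"
  proof (cases "J = 0")
    case True
    \<comment> \<open>The best s would be 0, which Young's split excludes; letting s tend to 0 has
      the same effect.\<close>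
    have "enn2real ?I \<le> 0"
    proof (rule field_le_epsilon)
      fix e :: real assume e: "e > 0"
      then show "enn2real ?I \<le> 0 + e" using **[of "e / (vol * ?T)"] T t vol_pos True by simp
    qed
    then have "enn2real ?I = 0" using enn2real_nonneg[of ?I] by linarith
    then show ?thesis using True q by simp
  next
    case False
    \<comment> \<open>With this s, whose q-th power is the mean \<open>J / ?T\<close>, the second
      term \<open>s powr (1 - q) * J\<close> becomes \<open>s * ?T\<close> and so balances the first
      up to \<open>vol\<close>.\<close>
    define s where "s = (J / ?T) powr (1 / q)"
    have s: "s > 0" "s powr q = J / ?T" unfolding s_def using J(2) False T t q by (auto simp: powr_powr)
    have "s powr (1 - q) * J = s powr (1 - q) * s powr q * ?T" using s T t by simp
    also have "\<dots> = s * ?T" using s(1) by (simp add: powr_add[symmetric])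
    finally have "enn2real ?I \<le> (vol + 1) * s * ?T" using **[OF s(1)] by (simp add: algebra_simps)
    then have "enn2real ?I / ?T \<le> (vol + 1) * s" using T by (simp add: divide_le_eq)
    then have "(enn2real ?I / ?T) powr q \<le> ((vol + 1) * s) powr q"
      using T q by (intro powr_mono2) auto
    also have "\<dots> = (vol + 1) powr q * (J / ?T)" using s vol_pos by (simp add: powr_mult)
    finally show ?thesis by simp
  qed
  then show ?thesis unfolding J(1) using J(2) T
    by (subst ennreal_mult[symmetric]) (auto intro!: ennreal_leI divide_nonneg_pos)
qed

text \<open>The averaged block lives in the ball of radius R + t about the old centre, and R + t is
  at most twice the larger of R and t, so it is compared with a block at that doubled radius. The
  constant does not depend on t, as the sum over all scales requires.\<close>

lemma majorized_local_avg_block: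
  assumes blk: "nonneg_block \<psi>" and t: "t > 0"
  shows "majorized (\<lambda>x. ennreal (1 / t ^ DIM('n)) * (\<integral>\<^sup>+y\<in>cball x t. ennreal (\<psi> y) \<partial>lborel)) (ennreal avg_const)"
proof -
  from blk obtain x0 R where \<psi> [measurable]: "\<psi> \<in> borel_measurable borel" and nn: "\<And>y. 0 \<le> \<psi> y"
    and x0: "x0 \<in> \<Omega>" and R: "R > 0" and supp: "\<And>y. y \<notin> cball x0 R \<Longrightarrow> \<psi> y = 0"
    and bd: "(\<integral>\<^sup>+y. ennreal (\<psi> y powr q) \<partial>lborel) \<le> ennreal (R powr (- (lam * (q - 1))))"
    unfolding nonneg_block_def by blast
  let ?T = "t ^ DIM('n)" and ?e = "lam * (q - 1)"
  have T: "?T > 0" using t by simp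
  have e: "?e \<ge> 0" using q lam by simp
  let ?I = "\<lambda>x. \<integral>\<^sup>+y\<in>cball x t. ennreal (\<psi> y) \<partial>lborel"
  define h where "h = (\<lambda>x. enn2real (?I x) / ?T)"
  have tot: "(\<integral>\<^sup>+y. ennreal (\<psi> y) \<partial>lborel) \<le> ennreal ((vol + 1) * R powr gam)"
    by (rule block_integral_le[OF \<psi> nn R supp bd])
  have Ile: "?I x \<le> ennreal ((vol + 1) * R powr gam)" for x
    by (rule order_trans[OF nn_integral_mono tot]) (auto simp: indicator_def)
  have Ifin: "?I x < \<infinity>" for x using Ile[of x] by (simp add: order_le_less_trans)
  have Im [measurable]: "?I \<in> borel_measurable borel" by (rule measurable_cball_integral) measurable
  have hm: "h \<in> borel_measurable borel" unfolding h_def by measurable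
  have h0: "0 \<le> h x" for x unfolding h_def using T by simp
  have heq: "ennreal (1 / ?T) * ?I x = ennreal (h x)" for x
    unfolding h_def using Ifin[of x] T
    by (cases "?I x") (auto simp: ennreal_mult[symmetric] divide_inverse mult.commute)
  have hz: "h x = 0" if "x \<notin> cball x0 (R + t)" for x
  proof -
    have "ennreal (\<psi> y) * indicator (cball x t) y = 0" for y
    proof (cases "y \<in> cball x t")
      case True
      then have "y \<notin> cball x0 R" using that dist_triangle[of x0 x y] by (auto simp: dist_commute)
      then show ?thesis using supp by simp
    qed simp
    then have "?I x = (\<integral>\<^sup>+y. 0 \<partial>(lborel::'n measure))"
      by (intro nn_integral_cong)
    then show ?thesis unfolding h_def by simp
  qed
  \<comment> \<open>For \<open>t \<le> R\<close> averaging is bounded on \<open>L\<^sup>q\<close>; for \<open>t > R\<close> only the total mass of the block counts,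
    and \<open>lam \<le> DIM('n)\<close> makes the resulting factor \<open>(R / t) powr (gam * q)\<close> harmless.\<close>
  have maj: "majorized (\<lambda>y. ennreal (h y)) (ennreal avg_const)"
  proof (cases "t \<le> R")
    case True
    show ?thesis
    proof (rule majorized_of_powr_bound[OF hm h0 x0 _ avg_const_pos])
      show "2 * R > 0" using R by simp
      show "h y = 0" if "y \<notin> cball x0 (2 * R)" for y using hz[of y] that True by simp
      have fin: "(\<integral>\<^sup>+y\<in>cball x t. ennreal (\<psi> y powr q) \<partial>lborel) < \<infinity>" for x
      proof -
        have "(\<integral>\<^sup>+y\<in>cball x t. ennreal (\<psi> y powr q) \<partial>lborel) \<le> ennreal (R powr (- ?e))"
          by (rule order_trans[OF nn_integral_mono bd]) (auto simp: indicator_def)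
        then show ?thesis by (simp add: order_le_less_trans)
      qed
      \<comment> \<open>The condition \<open>dist x y \<le> t\<close> is symmetric, so after Tonelli
        the inner integral is just the volume of a ball.\<close>
      have sw: "(\<integral>\<^sup>+x. (\<integral>\<^sup>+y\<in>cball x t. ennreal (\<psi> y powr q) \<partial>lborel) \<partial>lborel) =
        ennreal (vol * ?T) * (\<integral>\<^sup>+y. ennreal (\<psi> y powr q) \<partial>lborel)"
      proof -
        let ?D = "{p::'n \<times> 'n. dist (fst p) (snd p) \<le> t}"
        have "(\<integral>\<^sup>+x. (\<integral>\<^sup>+y\<in>cball x t. ennreal (\<psi> y powr q) \<partial>lborel) \<partial>lborel) =
          (\<integral>\<^sup>+x. \<integral>\<^sup>+y. ennreal (\<psi> y powr q) * indicator ?D (x, y) \<partial>lborel \<partial>lborel)"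
          by (intro nn_integral_cong) (auto simp: indicator_def)
        also have "\<dots> = (\<integral>\<^sup>+y. \<integral>\<^sup>+x. ennreal (\<psi> y powr q) * indicator ?D (x, y) \<partial>lborel \<partial>lborel)"
          by (rule lborel_pair.Fubini') measurable
        also have "\<dots> = (\<integral>\<^sup>+y. \<integral>\<^sup>+x. ennreal (\<psi> y powr q) * indicator (cball y t) x \<partial>lborel \<partial>lborel)"
          by (intro nn_integral_cong) (auto simp: indicator_def dist_commute)
        also have "\<dots> = (\<integral>\<^sup>+y. ennreal (vol * ?T) * ennreal (\<psi> y powr q) \<partial>lborel)"
          using t by (intro nn_integral_cong) (simp add: nn_integral_cmult_indicator emeasure_cball_vol mult.commute)
        also have "\<dots> = ennreal (vol * ?T) * (\<integral>\<^sup>+y. ennreal (\<psi> y powr q) \<partial>lborel)"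
          by (rule nn_integral_cmult) measurable
        finally show ?thesis .
      qed
      have "(\<integral>\<^sup>+x. ennreal (h x powr q) \<partial>lborel) \<le>
        (\<integral>\<^sup>+x. ennreal ((vol + 1) powr q / ?T) * (\<integral>\<^sup>+y\<in>cball x t. ennreal (\<psi> y powr q) \<partial>lborel) \<partial>lborel)"
        unfolding h_def by (intro nn_integral_mono powr_local_avg_le[OF \<psi> nn t fin])
      also have "\<dots> = ennreal ((vol + 1) powr q / ?T) * (\<integral>\<^sup>+x. (\<integral>\<^sup>+y\<in>cball x t. ennreal (\<psi> y powr q) \<partial>lborel) \<partial>lborel)"
      proof (rule nn_integral_cmult)
        have "(\<lambda>x. \<integral>\<^sup>+y\<in>cball x t. ennreal (\<psi> y powr q) \<partial>lborel) \<in> borel_measurable borel"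
          by (rule measurable_cball_integral) measurable
        then show "(\<lambda>x. \<integral>\<^sup>+y\<in>cball x t. ennreal (\<psi> y powr q) \<partial>lborel) \<in> borel_measurable lborel" by simp
      qed
      also have "\<dots> = ennreal ((vol + 1) powr q / ?T) * (ennreal (vol * ?T) * (\<integral>\<^sup>+y. ennreal (\<psi> y powr q) \<partial>lborel))"
        unfolding sw ..
      also have "\<dots> \<le> ennreal ((vol + 1) powr q / ?T) * (ennreal (vol * ?T) * ennreal (R powr (- ?e)))"
        by (intro mult_left_mono bd) auto
      also have "\<dots> = ennreal ((vol + 1) powr q / ?T * (vol * ?T * R powr (- ?e)))"
        using T vol_pos by (simp add: ennreal_mult[symmetric])
      also have "(vol + 1) powr q / ?T * (vol * ?T * R powr (- ?e)) = (vol + 1) powr q * vol * R powr (- ?e)"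
        using t by simp
      also have "ennreal \<dots> \<le> ennreal (avg_const powr q * (2 * R) powr (- ?e))"
      proof (rule ennreal_leI)
        have "avg_const powr q * (2 * R) powr (- ?e) =
          (vol + 1) powr q * vol * 2 ^ DIM('n) * R powr (- ?e) * (2 powr ?e * 2 powr (- ?e))"
          unfolding avg_const_powr using R by (simp add: powr_mult)
        also have "2 powr ?e * 2 powr (- ?e) = (1::real)" by (simp add: powr_add[symmetric])
        finally have eq: "avg_const powr q * (2 * R) powr (- ?e) = (vol + 1) powr q * vol * R powr (- ?e) * 2 ^ DIM('n)"
          by simp
        show "(vol + 1) powr q * vol * R powr (- ?e) \<le> avg_const powr q * (2 * R) powr (- ?e)"
          unfolding eq
          using mult_left_mono[of 1 "2 ^ DIM('n)" "(vol + 1) powr q * vol * R powr (- ?e)"] vol_pos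
          by simp
      qed
      finally show "(\<integral>\<^sup>+x. ennreal (h x powr q) \<partial>lborel) \<le> ennreal (avg_const powr q * (2 * R) powr (- ?e))" .
    qed
  next
    case False
    show ?thesis
    proof (rule majorized_of_powr_bound[OF hm h0 x0 _ avg_const_pos])
      show "2 * t > 0" using t by simp
      show hz': "h y = 0" if "y \<notin> cball x0 (2 * t)" for y using hz[of y] that False by simp
      define K where "K = (vol + 1) * R powr gam / ?T"
      have hK: "h x \<le> K" for x
      proof -
        have "enn2real (?I x) \<le> (vol + 1) * R powr gam"
          using enn2real_mono[OF Ile[of x]] vol_pos by simp
        then show ?thesis unfolding h_def K_def using T by (simp add: divide_right_mono)
      qed
      have "(\<integral>\<^sup>+x. ennreal (h x powr q) \<partial>lborel) \<le> (\<integral>\<^sup>+x. ennreal (K powr q) * indicator (cball x0 (2 * t)) x \<partial>lborel)"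
      proof (rule nn_integral_mono)
        fix x
        show "ennreal (h x powr q) \<le> ennreal (K powr q) * indicator (cball x0 (2 * t)) x"
        proof (cases "x \<in> cball x0 (2 * t)")
          case True
          then show ?thesis using hK[of x] h0[of x] q by (auto intro!: ennreal_leI powr_mono2)
        next
          case False
          then show ?thesis using hz'[OF False] q by simp
        qed
      qed
      also have "\<dots> = ennreal (K powr q) * ennreal (vol * (2 * t) ^ DIM('n))"
        using t by (simp add: nn_integral_cmult_indicator emeasure_cball_vol)
      also have "\<dots> = ennreal (K powr q * (vol * (2 * t) ^ DIM('n)))"
        by (simp add: ennreal_mult')
      also have "\<dots> \<le> ennreal (avg_const powr q * (2 * t) powr (- ?e))"
      proof (rule ennreal_leI)
        let ?N = "real DIM('n)"
        have gq: "gam * q = (q - 1) * (?N - lam)" unfolding gam_def using q by simp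
        have Tp: "?T = t powr ?N" using t by (simp add: powr_realpow)
        have "K powr q = (vol + 1) powr q * R powr (gam * q) / t powr (?N * q)"
          unfolding K_def Tp using vol_pos R t by (simp add: powr_divide powr_mult powr_powr)
        also have "\<dots> \<le> (vol + 1) powr q * t powr (gam * q) / t powr (?N * q)"
          using False R q gam_pos vol_pos by (intro divide_right_mono mult_left_mono powr_mono2) auto
        also have "\<dots> = (vol + 1) powr q * t powr (gam * q - ?N * q)" by (simp add: powr_diff)
        finally have 1: "K powr q \<le> (vol + 1) powr q * t powr (gam * q - ?N * q)" .
        have "K powr q * (vol * (2 * t) ^ DIM('n)) \<le> (vol + 1) powr q * t powr (gam * q - ?N * q) * (vol * (2 * t) ^ DIM('n))"
          using 1 vol_pos t by (intro mult_right_mono) auto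
        also have "\<dots> = (vol + 1) powr q * vol * 2 ^ DIM('n) * (t powr (gam * q - ?N * q) * t powr ?N)"
          unfolding Tp[symmetric] by (simp add: power_mult_distrib)
        also have "t powr (gam * q - ?N * q) * t powr ?N = t powr (- ?e)"
          unfolding powr_add[symmetric] gq by (simp add: algebra_simps)
        also have "(vol + 1) powr q * vol * 2 ^ DIM('n) * t powr (- ?e) = 
          (vol + 1) powr q * vol * 2 ^ DIM('n) * t powr (- ?e) * (2 powr ?e * 2 powr (- ?e))"
          by (simp add: powr_add[symmetric])
        also have "\<dots> = avg_const powr q * (2 * t) powr (- ?e)"
          unfolding avg_const_powr using t by (simp add: powr_mult)
        finally show "K powr q * (vol * (2 * t) ^ DIM('n)) \<le> avg_const powr q * (2 * t) powr (- ?e)" .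
      qed
      finally show "(\<integral>\<^sup>+x. ennreal (h x powr q) \<partial>lborel) \<le> ennreal (avg_const powr q * (2 * t) powr (- ?e))" .
    qed
  qed
  then show ?thesis unfolding heq .
qed

text \<open>The average of a series is the series of averages, which carries the estimate from
  single blocks to majorants. The intersection with the domain in \<open>ball_avg\<close> is
  essential, because a majorant says nothing about F elsewhere.\<close>

lemma majorized_ball_avg:
  assumes "majorized F s" "t > 0"
  shows "majorized (ball_avg t F) (ennreal avg_const * s)"
proof -
  from assms obtain a \<psi> where a: "\<And>k. nonneg_block (\<psi> k)" "(\<Sum>k. a k) \<le> s"
    "AE y in lebesgue. y \<in> \<Omega> \<longrightarrow> F y \<le> (\<Sum>k. a k * ennreal (\<psi> k y))"
    unfolding majorized_def by blast
  have [measurable]: "\<psi> k \<in> borel_measurable borel" for k using a(1) by (rule nonneg_block_measurable)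
  let ?A = "\<lambda>k x. ennreal (1 / t ^ DIM('n)) * (\<integral>\<^sup>+y\<in>cball x t. ennreal (\<psi> k y) \<partial>lborel)"
  have "majorized (\<lambda>x. \<Sum>k. a k * ?A k x) (\<Sum>k. a k * ennreal avg_const)"
    by (intro majorized_suminf majorized_cmult majorized_local_avg_block a assms)
  then show ?thesis
  proof (rule majorized_mono)
    show "(\<Sum>k. a k * ennreal avg_const) \<le> ennreal avg_const * s"
      using mult_right_mono[OF a(2), of "ennreal avg_const"] by (simp add: mult.commute)
    show "AE x in lebesgue. x \<in> \<Omega> \<longrightarrow> ball_avg t F x \<le> (\<Sum>k. a k * ?A k x)"
    proof (intro AE_I2 impI)
      fix x :: 'n
      have cb [measurable]: "cball x t \<in> sets borel" by simp
      have "(\<integral>\<^sup>+y\<in>cball x t \<inter> \<Omega>. F y \<partial>lebesgue) \<le> (\<integral>\<^sup>+y. (\<Sum>k. a k * (ennreal (\<psi> k y) * indicator (cball x t) y)) \<partial>lebesgue)"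
      proof (rule nn_integral_mono_AE)
        show "AE y in lebesgue. F y * indicator (cball x t \<inter> \<Omega>) y \<le> (\<Sum>k. a k * (ennreal (\<psi> k y) * indicator (cball x t) y))"
          using a(3) by eventually_elim (auto simp: indicator_def)
      qed
      also have "\<dots> = (\<integral>\<^sup>+y. (\<Sum>k. a k * (ennreal (\<psi> k y) * indicator (cball x t) y)) \<partial>lborel)"
        by (rule nn_integral_completion)
      also have "\<dots> = (\<Sum>k. a k * (\<integral>\<^sup>+y\<in>cball x t. ennreal (\<psi> k y) \<partial>lborel))"
        by (subst nn_integral_suminf) (measurable, simp add: nn_integral_cmult)
      finally have "ball_avg t F x \<le> ennreal (1 / t ^ DIM('n)) * (\<Sum>k. a k * (\<integral>\<^sup>+y\<in>cball x t. ennreal (\<psi> k y) \<partial>lborel))"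
        unfolding ball_avg_def by (rule mult_left_mono) simp
      also have "\<dots> = (\<Sum>k. a k * ?A k x)"
        by (simp add: mult.left_commute flip: ennreal_suminf_cmult)
      finally show "ball_avg t F x \<le> (\<Sum>k. a k * ?A k x)" .
    qed
  qed
qed

end


section \<open>Majorants and the block norm\<close>

lemma sums_ennreal_abs_le:
  fixes a :: "nat \<Rightarrow> real"
  assumes "a sums b"
  shows "ennreal \<bar>b\<bar> \<le> (\<Sum>k. ennreal \<bar>a k\<bar>)"
proof (rule LIMSEQ_le_const2)
  show "(\<lambda>n. ennreal \<bar>\<Sum>k<n. a k\<bar>) \<longlonglongrightarrow> ennreal \<bar>b\<bar>"
    using assms unfolding sums_def by (intro tendsto_ennrealI tendsto_rabs)
  have "ennreal \<bar>\<Sum>k<n. a k\<bar> \<le> (\<Sum>k. ennreal \<bar>a k\<bar>)" for n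
  proof -
    have "ennreal \<bar>\<Sum>k<n. a k\<bar> \<le> ennreal (\<Sum>k<n. \<bar>a k\<bar>)" by (intro ennreal_leI sum_abs)
    also have "\<dots> = (\<Sum>k<n. ennreal \<bar>a k\<bar>)" by (simp add: sum_ennreal)
    also have "\<dots> \<le> (\<Sum>k. ennreal \<bar>a k\<bar>)" by (intro sum_le_suminf) auto
    finally show ?thesis .
  qed
  then show "\<exists>N. \<forall>n\<ge>N. ennreal \<bar>\<Sum>k<n. a k\<bar> \<le> (\<Sum>k. ennreal \<bar>a k\<bar>)" by blast
qed

text \<open>Without a decomposition the infimum would run over the empty set and have no meaningful
  value, hence the membership.\<close>

lemma H_norm_nonneg:
  assumes "in_H \<Omega> q lam f"
  shows "0 \<le> H_norm \<Omega> q lam f"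
proof -
  obtain c \<phi> where "H_decomp \<Omega> q lam f c \<phi>" using assms unfolding in_H_def by blast
  then have "{(\<Sum>k. \<bar>c k\<bar>) | c \<phi>. H_decomp \<Omega> q lam f c \<phi>} \<noteq> {}" by blast
  then show ?thesis unfolding H_norm_def
    by (rule cInf_greatest) (auto simp: H_decomp_def intro!: suminf_nonneg)
qed

context block_space
begin

lemma domain_borel [measurable]: "\<Omega> \<in> sets borel"
  using open_domain by simp

lemma domain_lebesgue [measurable]: "\<Omega> \<in> sets lebesgue"
  using open_domain by simp

text \<open>Bridges two conventions: a nonnegative block vanishes off a closed ball, while the norm
  of a \<open>q_block\<close> is taken over an open one. The difference is a null set.\<close>

lemma AE_off_sphere: "AE y in lebesgue. y \<notin> sphere (x::'n) R"
  using negligible_sphere[of x R] unfolding negligible_iff_null_sets by (rule AE_not_in)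

lemma q_block_of_abs_le:
  assumes b: "nonneg_block \<psi>" and m: "set_borel_measurable lebesgue \<Omega> \<phi>"
    and le: "AE y in lebesgue. y \<in> \<Omega> \<longrightarrow> \<bar>\<phi> y\<bar> \<le> \<psi> y"
  shows "q_block \<Omega> q lam \<phi>"
proof -
  from b obtain x R where \<psi> [measurable]: "\<psi> \<in> borel_measurable borel" and nn: "\<And>y. 0 \<le> \<psi> y"
    and x: "x \<in> \<Omega>" and R: "R > 0" and supp: "\<And>y. y \<notin> cball x R \<Longrightarrow> \<psi> y = 0"
    and bd: "(\<integral>\<^sup>+y. ennreal (\<psi> y powr q) \<partial>lborel) \<le> ennreal (R powr (- (lam * (q - 1))))"
    unfolding nonneg_block_def by blast
  let ?E = "\<Omega> \<inter> ball x R"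
  let ?u = "\<lambda>y. indicator ?E y *\<^sub>R (\<bar>\<phi> y\<bar> powr q)"
  have ball_l: "ball x R \<in> sets lebesgue" by simp
  have um: "?u \<in> borel_measurable lebesgue"
  proof -
    have "(\<lambda>y. indicator (ball x R) y * (\<bar>indicator \<Omega> y *\<^sub>R \<phi> y\<bar> powr q)) \<in> borel_measurable lebesgue"
      using m ball_l unfolding set_borel_measurable_def by measurable
    moreover have "(\<lambda>y. indicator (ball x R) y * (\<bar>indicator \<Omega> y *\<^sub>R \<phi> y\<bar> powr q)) = ?u"
      using q by (auto simp: indicator_def fun_eq_iff)
    ultimately show ?thesis by simp
  qed
  have ub: "(\<integral>\<^sup>+y. ennreal (?u y) \<partial>lebesgue) \<le> ennreal (R powr (- (lam * (q - 1))))"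
  proof -
    have "(\<integral>\<^sup>+y. ennreal (?u y) \<partial>lebesgue) \<le> (\<integral>\<^sup>+y. ennreal (\<psi> y powr q) \<partial>lebesgue)"
    proof (rule nn_integral_mono_AE)
      show "AE y in lebesgue. ennreal (?u y) \<le> ennreal (\<psi> y powr q)"
        using le by eventually_elim (use q in \<open>auto simp: indicator_def intro!: ennreal_leI powr_mono2\<close>)
    qed
    with bd show ?thesis by (simp add: nn_integral_completion)
  qed
  have int: "integrable lebesgue ?u"
    unfolding integrable_iff_bounded using um ub by (auto simp: order_le_less_trans)
  define I where "I = (LINT y:?E|lebesgue. \<bar>\<phi> y\<bar> powr q)"
  have I0: "I \<ge> 0" unfolding I_def set_lebesgue_integral_def by (intro integral_nonneg_AE) auto
  have "ennreal I = (\<integral>\<^sup>+y. ennreal (?u y) \<partial>lebesgue)"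
    unfolding I_def set_lebesgue_integral_def by (rule nn_integral_eq_integral[OF int, symmetric]) auto
  with ub have "ennreal I \<le> ennreal (R powr (- (lam * (q - 1))))" by (simp only:)
  then have "I \<le> R powr (- (lam * (q - 1)))" by (simp add: ennreal_le_iff)
  then have "I powr (1 / q) \<le> (R powr (- (lam * (q - 1)))) powr (1 / q)"
    using I0 q by (intro powr_mono2) auto
  then have "R powr (lam / (q / (q - 1))) * I powr (1 / q) \<le>
    R powr (lam / (q / (q - 1))) * (R powr (- (lam * (q - 1)))) powr (1 / q)"
    by (intro mult_left_mono) auto
  also have "\<dots> = R powr (lam / (q / (q - 1)) + - (lam * (q - 1)) * (1 / q))"
    by (simp only: powr_powr powr_add)
  also have "lam / (q / (q - 1)) + - (lam * (q - 1)) * (1 / q) = 0" using q by simp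
  finally have fin: "R powr (lam / (q / (q - 1))) * I powr (1 / q) \<le> 1" using R by simp
  have z: "AE y in lebesgue. y \<in> \<Omega> - closure ?E \<longrightarrow> \<phi> y = 0"
    using le AE_off_sphere[of x R]
  proof eventually_elim
    case (elim y)
    show ?case
    proof
      assume y: "y \<in> \<Omega> - closure ?E"
      then have "y \<notin> ball x R" using closure_subset[of ?E] by blast
      then have "y \<notin> cball x R" using elim(2) by auto
      then have "\<psi> y = 0" by (rule supp)
      then show "\<phi> y = 0" using elim(1) y by auto
    qed
  qed
  show ?thesis unfolding q_block_def
    by (intro exI[of _ x] exI[of _ R] conjI x R m z)
      (use int fin in \<open>simp_all add: set_integrable_def I_def\<close>)
qed

lemma nonneg_block_of_q_block:
  assumes "q_block \<Omega> q lam \<phi>"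
  shows "\<exists>\<psi>. nonneg_block \<psi> \<and> (AE y in lebesgue. y \<in> \<Omega> \<longrightarrow> \<bar>\<phi> y\<bar> \<le> \<psi> y)"
proof -
  from assms obtain x R where x: "x \<in> \<Omega>" and R: "R > 0" and m: "set_borel_measurable lebesgue \<Omega> \<phi>"
    and z: "AE y in lebesgue. y \<in> \<Omega> - closure (\<Omega> \<inter> ball x R) \<longrightarrow> \<phi> y = 0"
    and int: "set_integrable lebesgue (\<Omega> \<inter> ball x R) (\<lambda>y. \<bar>\<phi> y\<bar> powr q)"
    and bd: "R powr (lam / (q / (q - 1))) * (LINT y:(\<Omega> \<inter> ball x R)|lebesgue. \<bar>\<phi> y\<bar> powr q) powr (1 / q) \<le> 1"
    unfolding q_block_def by blast
  let ?E = "\<Omega> \<inter> ball x R"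
  define I where "I = (LINT y:?E|lebesgue. \<bar>\<phi> y\<bar> powr q)"
  have I0: "I \<ge> 0" unfolding I_def set_lebesgue_integral_def by (intro integral_nonneg_AE) auto
  have ball_l: "ball x R \<in> sets lebesgue" by simp
  have "(\<lambda>y. indicator (ball x R) y * \<bar>indicator \<Omega> y *\<^sub>R \<phi> y\<bar>) \<in> borel_measurable lebesgue"
    using m ball_l unfolding set_borel_measurable_def by measurable
  \<comment> \<open>The block is only Lebesgue measurable. Nonnegative blocks are Borel, which
    Tonelli's theorem in the averaging estimate relies on, so a Borel function that agrees almost
    everywhere is taken.\<close>
  from completion_ex_borel_measurable_real[OF this] obtain h where h: "h \<in> borel_measurable lborel"
    and eq: "AE y in lborel. indicator (ball x R) y * \<bar>indicator \<Omega> y *\<^sub>R \<phi> y\<bar> = h y" by blast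
  have [measurable]: "h \<in> borel_measurable borel" using h by simp
  have eq': "AE y in lebesgue. indicator (ball x R) y * \<bar>indicator \<Omega> y *\<^sub>R \<phi> y\<bar> = h y" by (rule AE_completion[OF eq])
  have [measurable]: "cball x R \<in> sets borel" by simp
  define \<psi> where "\<psi> = (\<lambda>y. indicator (cball x R) y * \<bar>h y\<bar>)"
  have "(\<integral>\<^sup>+y. ennreal (\<psi> y powr q) \<partial>lborel) = (\<integral>\<^sup>+y. ennreal (\<psi> y powr q) \<partial>lebesgue)"
    by (simp add: nn_integral_completion)
  also have "\<dots> = (\<integral>\<^sup>+y. ennreal (indicator ?E y *\<^sub>R (\<bar>\<phi> y\<bar> powr q)) \<partial>lebesgue)"
  proof (rule nn_integral_cong_AE)
    show "AE y in lebesgue. ennreal (\<psi> y powr q) = ennreal (indicator ?E y *\<^sub>R (\<bar>\<phi> y\<bar> powr q))"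
      using eq'
    proof eventually_elim
      case (elim y)
      then have "\<psi> y = indicator ?E y * \<bar>\<phi> y\<bar>"
        unfolding \<psi>_def by (auto simp: indicator_def split: if_splits)
      then show ?case using q by (auto simp: indicator_def)
    qed
  qed
  also have "\<dots> = ennreal I"
    unfolding I_def set_lebesgue_integral_def
    using int unfolding set_integrable_def by (intro nn_integral_eq_integral) auto
  also have "\<dots> \<le> ennreal (R powr (- (lam * (q - 1))))"
  proof (rule ennreal_leI)
    have e: "R powr (lam / (q / (q - 1))) > 0" using R by simp
    have "I powr (1 / q) \<le> 1 / R powr (lam / (q / (q - 1)))"
      using bd e unfolding I_def[symmetric] by (simp add: pos_le_divide_eq mult.commute)
    also have "\<dots> = R powr (- (lam / (q / (q - 1))))" by (simp add: powr_minus_divide)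
    finally have "(I powr (1 / q)) powr q \<le> (R powr (- (lam / (q / (q - 1))))) powr q"
      using q by (intro powr_mono2) auto
    then show "I \<le> R powr (- (lam * (q - 1)))" using I0 q by (simp add: powr_powr)
  qed
  finally have 1: "(\<integral>\<^sup>+y. ennreal (\<psi> y powr q) \<partial>lborel) \<le> ennreal (R powr (- (lam * (q - 1))))" .
  have "\<psi> \<in> borel_measurable borel" unfolding \<psi>_def by measurable
  then have "nonneg_block \<psi>"
    unfolding nonneg_block_def using 1 x R by (auto simp: \<psi>_def intro!: bexI[of _ x] exI[of _ R])
  moreover have "AE y in lebesgue. y \<in> \<Omega> \<longrightarrow> \<bar>\<phi> y\<bar> \<le> \<psi> y"
    using eq' z AE_off_sphere[of x R]
  proof eventually_elim
    case (elim y)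
    show ?case
    proof
      assume y: "y \<in> \<Omega>"
      show "\<bar>\<phi> y\<bar> \<le> \<psi> y"
      proof (cases "y \<in> ball x R")
        case True
        then show ?thesis using elim(1) y unfolding \<psi>_def by (auto simp: indicator_def)
      next
        case False
        then have "y \<notin> cball x R" using elim(3) by auto
        moreover have "closure ?E \<subseteq> cball x R" by (rule closure_minimal) auto
        ultimately have "\<phi> y = 0" using elim(2) y by auto
        then show ?thesis unfolding \<psi>_def by simp
      qed
    qed
  qed
  ultimately show ?thesis by blast
qed

text \<open>The infimum need not be attained, so only an s strictly above it is reached by a
  decomposition; the absolute values of its coefficients and blocks form the majorant.\<close>

lemma majorized_of_in_H:
  assumes "in_H \<Omega> q lam f" "H_norm \<Omega> q lam f < s"
  shows "majorized (\<lambda>y. ennreal \<bar>f y\<bar>) (ennreal s)"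
proof -
  have "{(\<Sum>k. \<bar>c k\<bar>) | c \<phi>. H_decomp \<Omega> q lam f c \<phi>} \<noteq> {}"
    using assms(1) unfolding in_H_def by blast
  from cInf_lessD[OF this assms(2)[unfolded H_norm_def]]
  obtain c \<phi> where d: "H_decomp \<Omega> q lam f c \<phi>" and cs: "(\<Sum>k. \<bar>c k\<bar>) < s" by blast
  then have sm: "summable (\<lambda>k. \<bar>c k\<bar>)" and b: "\<And>k. q_block \<Omega> q lam (\<phi> k)"
    and ae: "AE y in lebesgue. y \<in> \<Omega> \<longrightarrow> (\<lambda>k. c k * \<phi> k y) sums f y"
    unfolding H_decomp_def by auto
  have "\<forall>k. \<exists>\<psi>. nonneg_block \<psi> \<and> (AE y in lebesgue. y \<in> \<Omega> \<longrightarrow> \<bar>\<phi> k y\<bar> \<le> \<psi> y)"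
    using nonneg_block_of_q_block b by blast
  then obtain \<psi> where \<psi>: "\<And>k. nonneg_block (\<psi> k)" "\<And>k. AE y in lebesgue. y \<in> \<Omega> \<longrightarrow> \<bar>\<phi> k y\<bar> \<le> \<psi> k y"
    by metis
  show ?thesis unfolding majorized_def
  proof (intro exI conjI allI)
    show "nonneg_block (\<psi> k)" for k by (rule \<psi>)
    show "(\<Sum>k. ennreal \<bar>c k\<bar>) \<le> ennreal s"
      using cs by (simp add: suminf_ennreal2[OF _ sm] ennreal_leI)
    have "AE y in lebesgue. \<forall>k. y \<in> \<Omega> \<longrightarrow> \<bar>\<phi> k y\<bar> \<le> \<psi> k y"
      unfolding AE_all_countable using \<psi>(2) by blast
    with ae show "AE y in lebesgue. y \<in> \<Omega> \<longrightarrow> ennreal \<bar>f y\<bar> \<le> (\<Sum>k. ennreal \<bar>c k\<bar> * ennreal (\<psi> k y))"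
    proof eventually_elim
      case (elim y)
      show ?case
      proof
        assume y: "y \<in> \<Omega>"
        have "ennreal \<bar>f y\<bar> \<le> (\<Sum>k. ennreal \<bar>c k * \<phi> k y\<bar>)"
          using elim(1) y by (intro sums_ennreal_abs_le) blast
        also have "\<dots> \<le> (\<Sum>k. ennreal \<bar>c k\<bar> * ennreal (\<psi> k y))"
          using elim(2) y
          by (intro suminf_le) (auto simp: abs_mult ennreal_mult' intro!: mult_left_mono ennreal_leI)
        finally show "ennreal \<bar>f y\<bar> \<le> (\<Sum>k. ennreal \<bar>c k\<bar> * ennreal (\<psi> k y))" .
      qed
    qed
  qed
qed

text \<open>This is the solidity of the block space. The majorizing series is itself majorized,
  hence has finite integral over the domain and is finite almost everywhere there, which permits
  dividing by it. Measurability of f passes to the redistributed pieces, which have to be measurable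
  to be blocks.\<close>

lemma in_H_of_majorized:
  assumes maj: "majorized (\<lambda>y. ennreal \<bar>f y\<bar>) (ennreal s)" and s: "s \<ge> 0"
    and f: "set_borel_measurable lebesgue \<Omega> f"
  shows "in_H \<Omega> q lam f" "H_norm \<Omega> q lam f \<le> s"
proof -
  from maj obtain a \<psi> where a: "\<And>k. nonneg_block (\<psi> k)" "(\<Sum>k. a k) \<le> ennreal s"
    "AE y in lebesgue. y \<in> \<Omega> \<longrightarrow> ennreal \<bar>f y\<bar> \<le> (\<Sum>k. a k * ennreal (\<psi> k y))"
    unfolding majorized_def by blast
  have \<psi>m [measurable]: "\<psi> k \<in> borel_measurable borel" for k using a(1) by (rule nonneg_block_measurable)
  have \<psi>0: "0 \<le> \<psi> k y" for k y using a(1) by (rule nonneg_block_nonneg)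
  have atop: "a k < \<infinity>" for k
  proof -
    have "a k \<le> (\<Sum>k. a k)" using sum_le_suminf[of a "{k}"] by auto
    then show ?thesis using a(2) by (simp add: order_le_less_trans)
  qed
  define c where "c = (\<lambda>k. enn2real (a k))"
  have ac: "a k = ennreal (c k)" for k unfolding c_def using atop[of k] by simp
  have c0: "0 \<le> c k" for k unfolding c_def by simp
  have csum: "summable c" 
    by (rule summable_suminf_not_top) (use c0 a(2) in \<open>auto simp: ac[symmetric] top_unique\<close>)
  have cs: "(\<Sum>k. c k) \<le> s"
    using a(2) s c0 csum unfolding ac by (simp add: suminf_ennreal2 ennreal_le_iff)
  define S where "S = (\<lambda>y. \<Sum>k. a k * ennreal (\<psi> k y))"
  have Sm [measurable]: "S \<in> borel_measurable borel" unfolding S_def by measurable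
  have "majorized S (ennreal s)"
    unfolding majorized_def S_def using a by (intro exI[of _ a] exI[of _ \<psi>]) auto
  then obtain C where "C > 0" "(\<integral>\<^sup>+y\<in>\<Omega>. S y \<partial>lebesgue) \<le> ennreal C * ennreal s"
    using majorized_integral by blast
  then have "(\<integral>\<^sup>+y\<in>\<Omega>. S y \<partial>lborel) < \<infinity>"
    by (auto simp: nn_integral_completion ennreal_mult[symmetric] s order_le_less_trans)
  then have "AE y in lborel. S y * indicator \<Omega> y \<noteq> \<infinity>"
    by (intro nn_integral_PInf_AE) auto
  then have Sfin: "AE y in lebesgue. y \<in> \<Omega> \<longrightarrow> S y \<noteq> \<infinity>"
    by (intro AE_completion) (auto simp: indicator_def)
  \<comment> \<open>Distributing \<open>f\<close> over the blocks in proportion to the majorant keeps each of them a block;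
    where \<open>S y = 0\<close> also \<open>f y = 0\<close>, so the junk value \<open>x / 0 = 0\<close> is the right one.\<close>
  define \<phi> where "\<phi> = (\<lambda>k y. \<psi> k y * f y / enn2real (S y))"
  have \<phi>m: "set_borel_measurable lebesgue \<Omega> (\<phi> k)" for k
  proof -
    have 1: "(\<lambda>y. \<psi> k y / enn2real (S y)) \<in> borel_measurable lebesgue"
      by (rule measurable_completion) simp
    have "(\<lambda>y. \<psi> k y / enn2real (S y) * (indicator \<Omega> y *\<^sub>R f y)) \<in> borel_measurable lebesgue"
      using f 1 unfolding set_borel_measurable_def by measurable
    then show ?thesis unfolding set_borel_measurable_def \<phi>_def by (simp add: mult_ac)
  qed
  have key: "AE y in lebesgue. y \<in> \<Omega> \<longrightarrow> (\<forall>k. \<bar>\<phi> k y\<bar> \<le> \<psi> k y) \<and> (\<lambda>k. c k * \<phi> k y) sums f y"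
    using a(3) Sfin
  proof eventually_elim
    case (elim y)
    show ?case
    proof
      assume y: "y \<in> \<Omega>"
      then obtain r where r: "S y = ennreal r" "r \<ge> 0" using elim(2) by (cases "S y") auto
      have "ennreal \<bar>f y\<bar> \<le> S y" using elim(1) y unfolding S_def by blast
      then have fr: "\<bar>f y\<bar> \<le> r" using r by (simp add: ennreal_le_iff)
      have er: "enn2real (S y) = r" using r by simp
      have 1: "\<bar>\<phi> k y\<bar> \<le> \<psi> k y" for k
      proof (cases "r = 0")
        case True then show ?thesis unfolding \<phi>_def er using \<psi>0 by simp
      next
        case False
        then have "\<bar>\<phi> k y\<bar> = \<psi> k y * (\<bar>f y\<bar> / r)" unfolding \<phi>_def er using \<psi>0[of k y] r by (simp add: abs_mult)
        also have "\<dots> \<le> \<psi> k y * 1" using fr r False \<psi>0 by (intro mult_left_mono) auto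
        finally show ?thesis by simp
      qed
      have Sr: "(\<Sum>k. ennreal (c k * \<psi> k y)) = ennreal r"
        using r(1) unfolding S_def ac by (simp add: ennreal_mult c0 \<psi>0)
      have sm: "summable (\<lambda>k. c k * \<psi> k y)"
        by (rule summable_suminf_not_top) (use c0 \<psi>0 Sr in auto)
      have "(\<Sum>k. c k * \<psi> k y) = r"
      proof -
        have "ennreal (\<Sum>k. c k * \<psi> k y) = ennreal r"
          using Sr sm c0 \<psi>0 by (simp add: suminf_ennreal2)
        moreover have "0 \<le> (\<Sum>k. c k * \<psi> k y)" using sm c0 \<psi>0 by (intro suminf_nonneg) auto
        ultimately show ?thesis using r(2) by simp
      qed
      then have "(\<lambda>k. c k * \<psi> k y) sums r" using sm by (simp add: sums_iff)
      then have "(\<lambda>k. (c k * \<psi> k y) * (f y / r)) sums (r * (f y / r))" by (rule sums_mult2)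
      moreover have "r * (f y / r) = f y" using fr by auto
      ultimately have "(\<lambda>k. c k * \<phi> k y) sums f y" unfolding \<phi>_def er by (simp add: mult_ac)
      with 1 show "(\<forall>k. \<bar>\<phi> k y\<bar> \<le> \<psi> k y) \<and> (\<lambda>k. c k * \<phi> k y) sums f y" by blast
    qed
  qed
  have blk: "q_block \<Omega> q lam (\<phi> k)" for k
    by (rule q_block_of_abs_le[OF a(1) \<phi>m]) (use key in eventually_elim, blast)
  have d: "H_decomp \<Omega> q lam f c \<phi>"
    unfolding H_decomp_def
  proof (intro conjI allI blk)
    show "summable (\<lambda>k. \<bar>c k\<bar>)" using csum c0 by simp
    show "AE y in lebesgue. y \<in> \<Omega> \<longrightarrow> (\<lambda>k. c k * \<phi> k y) sums f y"
      using key by eventually_elim blast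
  qed
  then show "in_H \<Omega> q lam f" unfolding in_H_def by blast
  have "H_norm \<Omega> q lam f \<le> (\<Sum>k. \<bar>c k\<bar>)"
    unfolding H_norm_def
    by (rule cInf_lower) (use d in \<open>auto intro!: bdd_belowI[of _ 0] suminf_nonneg simp: H_decomp_def\<close>)
  also have "\<dots> \<le> s" using cs c0 by simp
  finally show "H_norm \<Omega> q lam f \<le> s" .
qed

end


section \<open>Chains of cubes\<close>

lemma nn_integral_axis_step:
  assumes "s > 0"
  shows "(\<integral>\<^sup>+x. ennreal (axis_step c s (Suc 0) x) \<partial>lborel) = 1"
proof -
  have "(\<integral>\<^sup>+x. ennreal (axis_step c s (Suc 0) x) \<partial>lborel) =
    (\<integral>\<^sup>+x. ennreal (axis_step c s (Suc 0) x) * indicator {c - s..c + s} x \<partial>lborel)"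
  proof (rule nn_integral_cong)
    fix x
    show "ennreal (axis_step c s (Suc 0) x) = ennreal (axis_step c s (Suc 0) x) * indicator {c - s..c + s} x"
      using axis_step_bounds(7)[OF assms, of x c] by (cases "x \<in> {c - s..c + s}") auto
  qed
  also have "\<dots> = ennreal (axis_step c s 0 (c + s) - axis_step c s 0 (c - s))"
  proof (rule nn_integral_FTC_Icc)
    show "axis_step c s (Suc 0) \<in> borel_measurable borel"
      using deriv_seq_continuous[OF deriv_seq_axis_step] by (rule borel_measurable_continuous_onI)
    show "(axis_step c s 0 has_real_derivative axis_step c s (Suc 0) x) (at x)" for x
      using deriv_seq_axis_step[of c s] unfolding deriv_seq_def by blast
  qed (use assms in \<open>auto simp: axis_step_bounds\<close>)
  also have "\<dots> = 1" using assms by (simp add: axis_step_bounds)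
  finally show ?thesis .
qed

definition cube :: "'n::euclidean_space \<Rightarrow> real \<Rightarrow> 'n set" where
  "cube z s = cbox (z - s *\<^sub>R One) (z + s *\<^sub>R One)"

lemma mem_cube: "y \<in> cube z s \<longleftrightarrow> (\<forall>i\<in>Basis. \<bar>y \<bullet> i - z \<bullet> i\<bar> \<le> s)"
  unfolding cube_def mem_box by (auto simp: algebra_simps abs_le_iff)

text \<open>The Euclidean norm is at most the l1 norm, which gives the factor \<open>DIM('n)\<close>
  that reappears in \<open>chain_ratio\<close>.\<close>

lemma cube_subset_ball:
  fixes z :: "'n::euclidean_space"
  assumes "real DIM('n) * s < r"
  shows "cube z s \<subseteq> ball z r"
proof
  fix y assume "y \<in> cube z s"
  then have "(\<Sum>i\<in>Basis. \<bar>(y - z) \<bullet> i\<bar>) \<le> (\<Sum>i\<in>(Basis::'n set). s)"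
    by (intro sum_mono) (auto simp: mem_cube inner_diff_left)
  then have "norm (y - z) \<le> real DIM('n) * s"
    using norm_le_l1[of "y - z"] by (simp add: mult.commute)
  then show "y \<in> ball z r" using assms by (simp add: dist_norm norm_minus_commute)
qed

lemma cube_bump_props:
  fixes z :: "'n::euclidean_space"
  assumes s: "s > 0"
  shows "cube_bump z s \<in> borel_measurable borel" "0 \<le> cube_bump z s x" "cube_bump z s x \<le> (step_bound / s) ^ DIM('n)"
    "x \<notin> cube z s \<Longrightarrow> cube_bump z s x = 0" "(\<integral>\<^sup>+x. ennreal (cube_bump z s x) \<partial>lborel) = 1"
proof -
  have m: "axis_step (z \<bullet> i) s (Suc 0) \<in> borel_measurable borel" for i
    using deriv_seq_continuous[OF deriv_seq_axis_step] by (rule borel_measurable_continuous_onI)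
  have m' [measurable]: "(\<lambda>x. axis_step (z \<bullet> i) s (Suc 0) (x \<bullet> i)) \<in> borel_measurable borel" for i
    by (rule measurable_compose[OF _ m]) simp
  show "cube_bump z s \<in> borel_measurable borel"
    unfolding cube_bump_def by measurable
  show "0 \<le> cube_bump z s x"
    unfolding cube_bump_def by (intro prod_nonneg) (auto simp: axis_step_bounds s)
  have "cube_bump z s x \<le> (\<Prod>i\<in>(Basis::'n set). step_bound / s)"
    unfolding cube_bump_def by (intro prod_mono) (auto simp: axis_step_bounds s)
  then show "cube_bump z s x \<le> (step_bound / s) ^ DIM('n)" by simp
  show "cube_bump z s x = 0" if "x \<notin> cube z s"
  proof -
    from that obtain i where i: "i \<in> Basis" "\<bar>x \<bullet> i - z \<bullet> i\<bar> > s" by (auto simp: mem_cube)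
    then have "axis_step (z \<bullet> i) s (Suc 0) (x \<bullet> i) = 0"
      by (intro axis_step_bounds(7) s) auto
    then show ?thesis unfolding cube_bump_def using i(1) by (intro prod_zero) auto
  qed
  have "(\<integral>\<^sup>+x. ennreal (cube_bump z s x) \<partial>lborel) = (\<integral>\<^sup>+x. (\<Prod>i\<in>Basis. ennreal (axis_step (z \<bullet> i) s (Suc 0) (x \<bullet> i))) \<partial>lborel)"
    unfolding cube_bump_def by (simp add: prod_ennreal axis_step_bounds s)
  also have "\<dots> = (\<Prod>i\<in>Basis. (\<integral>\<^sup>+x. ennreal (axis_step (z \<bullet> i) s (Suc 0) x) \<partial>lborel))"
    by (rule nn_integral_lborel_prod[where f = "\<lambda>i x. ennreal (axis_step (z \<bullet> i) s (Suc 0) x)"]) (use m in auto)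
  also have "\<dots> = 1" by (simp add: nn_integral_axis_step s)
  finally show "(\<integral>\<^sup>+x. ennreal (cube_bump z s x) \<partial>lborel) = 1" .
qed

lemma loc_integrable_const: "loc_integrable W (\<lambda>_. c)"
  unfolding loc_integrable_def
proof (intro allI impI)
  fix K assume "compact K \<and> K \<subseteq> W"
  then have "emeasure lebesgue K < \<infinity>" "K \<in> sets lebesgue"
    using emeasure_compact_finite[of K] by (auto simp: compact_imp_closed borel_closed)
  then show "set_integrable lebesgue K (\<lambda>_. c)"
    unfolding set_integrable_def by (simp add: integrable_indicator_iff)
qed

lemma loc_integrable_diff:
  "loc_integrable W f \<Longrightarrow> loc_integrable W g \<Longrightarrow> loc_integrable W (\<lambda>y. f y - g y)"
  unfolding loc_integrable_def by (auto intro: set_integral_diff)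

lemma cube_avg_const:
  fixes W :: "'n::euclidean_space set"
  assumes s: "s > 0" and sub: "cube z s \<subseteq> W"
  shows "cube_avg W (\<lambda>_. c) z s = c"
proof -
  note b = cube_bump_props[OF s, where z = z]
  have hb: "has_bochner_integral lborel (cube_bump z s) 1"
    by (rule has_bochner_integral_nn_integral) (use b in auto)
  have "cube_avg W (\<lambda>_. c) z s = (LINT y|lebesgue. c * cube_bump z s y)"
    unfolding cube_avg_def set_lebesgue_integral_def
    using sub b(4) by (intro Bochner_Integration.integral_cong) (auto simp: indicator_def)
  also have "\<dots> = c * (LINT y|lborel. cube_bump z s y)"
    using b(1) by (simp add: integral_completion)
  also have "\<dots> = c" using hb by (simp add: has_bochner_integral_integral_eq)
  finally show ?thesis .
qed

text \<open>Averages reproduce constants, so f x can be moved under the integral; the bump is then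
  estimated by its height.\<close>

lemma cube_avg_near_value:
  fixes W :: "'n::euclidean_space set"
  assumes f: "loc_integrable W f" and s: "s > 0" and sub: "cube z s \<subseteq> W" "cube z s \<subseteq> cball x r"
  shows "ennreal \<bar>cube_avg W f z s - f x\<bar> \<le>
    ennreal ((step_bound / s) ^ DIM('n)) * (\<integral>\<^sup>+y\<in>cball x r. ennreal \<bar>f y - f x\<bar> \<partial>lebesgue)"
proof -
  note b = cube_bump_props[OF s, where z = z]
  have babs: "\<bar>cube_bump z s y\<bar> \<le> (step_bound / s) ^ DIM('n)" for y using b(2,3)[of y] by simp
  have K: "compact (cube z s)" unfolding cube_def by simp
  note li = loc_integrable_mult[OF _ b(1) K sub(1) b(4) babs]
  have "cube_avg W f z s - f x = cube_avg W f z s - cube_avg W (\<lambda>_. f x) z s"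
    using cube_avg_const[OF s sub(1)] by simp
  also have "\<dots> = (LINT y:W|lebesgue. (f y - f x) * cube_bump z s y)"
    unfolding cube_avg_def left_diff_distrib
    by (rule set_integral_diff(2)[symmetric, OF li(1)[OF f] li(1)[OF loc_integrable_const]])
  finally have "ennreal \<bar>cube_avg W f z s - f x\<bar> = ennreal \<bar>LINT y:W|lebesgue. (f y - f x) * cube_bump z s y\<bar>" by simp
  also have "\<dots> \<le> ennreal ((step_bound / s) ^ DIM('n)) * (\<integral>\<^sup>+y\<in>cube z s. ennreal \<bar>f y - f x\<bar> \<partial>lebesgue)"
    by (rule li(2)[OF loc_integrable_diff[OF f loc_integrable_const]])
  also have "\<dots> \<le> ennreal ((step_bound / s) ^ DIM('n)) * (\<integral>\<^sup>+y\<in>cball x r. ennreal \<bar>f y - f x\<bar> \<partial>lebesgue)"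
    using sub(2) by (intro mult_left_mono nn_integral_mono) (auto simp: indicator_def)
  finally show ?thesis .
qed

text \<open>The l1 size of the gradient, matching \<open>H_norm_vec\<close>, which adds up the norms
  of the components.\<close>

definition abs_sum :: "('n::euclidean_space \<Rightarrow> 'n) \<Rightarrow> 'n \<Rightarrow> ennreal" where
  "abs_sum g y = (\<Sum>i\<in>Basis. ennreal \<bar>g y \<bullet> i\<bar>)"

lemma cube_avg_diff_box:
  fixes W :: "'n::euclidean_space set"
  assumes wg: "weak_gradient W f g" and sub: "cube z S \<subseteq> W" and r: "0 < r" "r \<le> s0" "r \<le> s1"
    and c: "cube z0 s0 \<subseteq> cube z S" "cube z1 s1 \<subseteq> cube z S"
  shows "ennreal \<bar>cube_avg W f z0 s0 - cube_avg W f z1 s1\<bar> \<le>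
    ennreal ((step_bound / r) ^ (DIM('n) - 1)) * (\<integral>\<^sup>+y\<in>cube z S. abs_sum g y \<partial>lebesgue)"
proof -
  have s: "s0 > 0" "s1 > 0" using r by auto
  have c': "z \<bullet> i - S \<le> z' \<bullet> i - s' \<and> z' \<bullet> i + s' \<le> z \<bullet> i + S"
    if i: "i \<in> Basis" and sb: "cube z' s' \<subseteq> cube z S" and s': "s' > 0" for z' :: 'n and s' i
  proof -
    \<comment> \<open>Testing the inclusion at two opposite corners of the smaller cube yields the
      coordinatewise inequalities.\<close>
    have "z' - s' *\<^sub>R One \<in> cube z' s'" "z' + s' *\<^sub>R One \<in> cube z' s'"
      using s' by (auto simp: mem_cube inner_diff_left inner_add_left)
    then have "z' - s' *\<^sub>R One \<in> cube z S" "z' + s' *\<^sub>R One \<in> cube z S" using sb by blast+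
    then have "\<bar>(z' - s' *\<^sub>R One) \<bullet> i - z \<bullet> i\<bar> \<le> S" "\<bar>(z' + s' *\<^sub>R One) \<bullet> i - z \<bullet> i\<bar> \<le> S"
      using i unfolding mem_cube by blast+
    then show ?thesis using i by (auto simp: inner_diff_left inner_add_left abs_le_iff)
  qed
  have "ennreal \<bar>cube_avg W f z0 s0 - cube_avg W f z1 s1\<bar> \<le>
    ennreal ((step_bound / r) ^ (DIM('n) - 1)) * (\<Sum>i\<in>Basis. \<integral>\<^sup>+y\<in>cube z S. ennreal \<bar>g y \<bullet> i\<bar> \<partial>lebesgue)"
    unfolding cube_def
    by (rule cube_avg_diff[OF wg sub[unfolded cube_def] r])
      (use c'[OF _ c(1) s(1)] c'[OF _ c(2) s(2)] in \<open>auto simp: inner_diff_left inner_add_left\<close>)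
  also have "(\<Sum>i\<in>Basis. \<integral>\<^sup>+y\<in>cube z S. ennreal \<bar>g y \<bullet> i\<bar> \<partial>lebesgue) = (\<integral>\<^sup>+y. (\<Sum>i\<in>Basis. ennreal \<bar>g y \<bullet> i\<bar> * indicator (cube z S) y) \<partial>lebesgue)"
  proof (rule nn_integral_sum[symmetric])
    fix i :: 'n assume i: "i \<in> Basis"
    have "loc_integrable W (\<lambda>y. g y \<bullet> i)" using wg i unfolding weak_gradient_def by blast
    moreover have "compact (cube z S)" unfolding cube_def by simp
    ultimately have "set_integrable lebesgue (cube z S) (\<lambda>y. g y \<bullet> i)"
      using sub unfolding loc_integrable_def by blast
    then have "(\<lambda>y. indicator (cube z S) y *\<^sub>R (g y \<bullet> i)) \<in> borel_measurable lebesgue"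
      unfolding set_integrable_def by (rule borel_measurable_integrable)
    then have "(\<lambda>y. ennreal \<bar>indicator (cube z S) y *\<^sub>R (g y \<bullet> i)\<bar>) \<in> borel_measurable lebesgue" by measurable
    also have "(\<lambda>y. ennreal \<bar>indicator (cube z S) y *\<^sub>R (g y \<bullet> i)\<bar>) = (\<lambda>y. ennreal \<bar>g y \<bullet> i\<bar> * indicator (cube z S) y)"
      by (auto simp: indicator_def fun_eq_iff)
    finally show "(\<lambda>y. ennreal \<bar>g y \<bullet> i\<bar> * indicator (cube z S) y) \<in> borel_measurable lebesgue" .
  qed
  finally show ?thesis unfolding abs_sum_def sum_distrib_right .
qed

text \<open>With a = \<kappa>/(4n) the cube of half-side 2 a t fits into the ball of radius \<kappa>
  t, since n * 2 a t = \<kappa> t/2. Shrinking t by the factor 1 - a moves the centre by at most a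
  t, so the next cube, of half-side at most a t, stays in that same cube.\<close>

definition chain_ratio :: "'n::euclidean_space itself \<Rightarrow> real \<Rightarrow> real" where
  "chain_ratio _ \<kappa> = \<kappa> / (4 * real DIM('n))"

text \<open>The smaller of two consecutive cubes has half-side a (1 - a) t, which enters with the
  power n - 1 from \<open>cube_avg_diff\<close>. The factor 2^n turns the normalisation by t^n into
  that of the ball of radius 2 t.\<close>

definition chain_const :: "'n::euclidean_space itself \<Rightarrow> real \<Rightarrow> real" where
  "chain_const T \<kappa> = (step_bound / (chain_ratio T \<kappa> * (1 - chain_ratio T \<kappa>))) ^ (DIM('n) - 1) * 2 ^ DIM('n)"

lemma chain_ratio_bounds:
  assumes "0 < \<kappa>" "\<kappa> \<le> 1"
  shows "0 < chain_ratio TYPE('n::euclidean_space) \<kappa>" "chain_ratio TYPE('n) \<kappa> \<le> 1 / 4"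
    "real DIM('n) * chain_ratio TYPE('n) \<kappa> = \<kappa> / 4"
proof -
  have N: "real DIM('n) \<ge> 1" using DIM_positive[where 'a='n] by simp
  then show "0 < chain_ratio TYPE('n) \<kappa>" "real DIM('n) * chain_ratio TYPE('n) \<kappa> = \<kappa> / 4"
    using assms by (auto simp: chain_ratio_def)
  have "\<kappa> \<le> real DIM('n)" using N assms by linarith
  then show "chain_ratio TYPE('n) \<kappa> \<le> 1 / 4"
    unfolding chain_ratio_def using N by (simp add: divide_le_eq)
qed

text \<open>A chain of cubes of geometrically decreasing size descends along the axis of a cone to its
  vertex; consecutive cubes lie in a common cube inside the cone.\<close>

lemma cone_chain:
  fixes W :: "'n::euclidean_space set" and x e :: 'n
  assumes wg: "weak_gradient W f g" and e: "norm e \<le> 1" and \<kappa>: "0 < \<kappa>" "\<kappa> \<le> 1" and t0: "t0 > 0"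
    and cone: "\<And>t. 0 < t \<Longrightarrow> t \<le> t0 \<Longrightarrow> ball (x + t *\<^sub>R e) (\<kappa> * t) \<subseteq> W"
    and a: "a = chain_ratio TYPE('n) \<kappa>" and t: "\<And>k. t k = t0 * (1 - a) ^ k"
    and leb: "\<And>d. d > 0 \<Longrightarrow> \<forall>\<^sub>F k in sequentially.
      (\<integral>\<^sup>+y\<in>cball x (2 * t k). ennreal \<bar>f y - f x\<bar> \<partial>lebesgue) \<le> ennreal d * emeasure lborel (cball x (2 * t k))"
  shows "ennreal \<bar>f x - cube_avg W f (x + t0 *\<^sub>R e) (a * t0)\<bar> \<le>
    (\<Sum>k. ennreal (chain_const TYPE('n) \<kappa> * t k) * (ennreal (1 / (2 * t k) ^ DIM('n)) *
      (\<integral>\<^sup>+y\<in>cball x (2 * t k) \<inter> W. abs_sum g y \<partial>lebesgue)))"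
proof -
  let ?N = "DIM('n)"
  note ab = chain_ratio_bounds[OF \<kappa>, where 'n='n, folded a]
  have a1: "0 < 1 - a" using ab by linarith
  have tp: "t k > 0" for k unfolding t using t0 a1 by simp
  have tle: "t k \<le> t0" for k
    unfolding t using t0 a1 ab by (intro mult_left_le power_le_one) auto
  have tS: "t (Suc k) = (1 - a) * t k" for k unfolding t by simp
  define z where "z = (\<lambda>k. x + t k *\<^sub>R e)"
  define A where "A = (\<lambda>k. cube_avg W f (z k) (a * t k))"
  have W1: "ball (z k) (\<kappa> * t k) \<subseteq> W" for k unfolding z_def using cone tp tle by blast
  have big: "cube (z k) (2 * a * t k) \<subseteq> ball (z k) (\<kappa> * t k)" for k
  proof (rule cube_subset_ball)
    have "real ?N * (2 * a * t k) = \<kappa> / 2 * t k" using ab(3) by (simp add: algebra_simps)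
    also have "\<dots> < \<kappa> * t k" using \<kappa> tp[of k] by simp
    finally show "real ?N * (2 * a * t k) < \<kappa> * t k" .
  qed
  have bigc: "ball (z k) (\<kappa> * t k) \<subseteq> cball x (2 * t k)" for k
  proof
    fix y assume "y \<in> ball (z k) (\<kappa> * t k)"
    then have "dist (z k) y < \<kappa> * t k" by simp
    moreover have "\<kappa> * t k \<le> t k" using \<kappa> tp[of k] by simp
    moreover have "dist x (z k) \<le> t k" unfolding z_def using e tp[of k] by (simp add: dist_norm mult_left_le)
    ultimately show "y \<in> cball x (2 * t k)" using dist_triangle[of x y "z k"] by simp
  qed
  have self: "cube (z k) (a * t k) \<subseteq> cube (z k) (2 * a * t k)" for k
  proof -
    have "a * t k \<le> 2 * a * t k" using ab tp[of k] by simp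
    show ?thesis
    proof
      fix y assume "y \<in> cube (z k) (a * t k)"
      with \<open>a * t k \<le> 2 * a * t k\<close> show "y \<in> cube (z k) (2 * a * t k)"
        unfolding mem_cube by (meson order_trans)
    qed
  qed
  have next_sub: "cube (z (Suc k)) (a * t (Suc k)) \<subseteq> cube (z k) (2 * a * t k)" for k
  proof
    fix y assume y: "y \<in> cube (z (Suc k)) (a * t (Suc k))"
    show "y \<in> cube (z k) (2 * a * t k)"
      unfolding mem_cube
    proof
      fix i :: 'n assume i: "i \<in> Basis"
      have "\<bar>y \<bullet> i - z (Suc k) \<bullet> i\<bar> \<le> a * t (Suc k)" using y i unfolding mem_cube by blast
      also have "\<dots> \<le> a * t k" unfolding tS using ab tp[of k] by (intro mult_left_mono mult_left_le_one_le) auto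
      finally have 1: "\<bar>y \<bullet> i - z (Suc k) \<bullet> i\<bar> \<le> a * t k" .
      have "z (Suc k) \<bullet> i - z k \<bullet> i = - (a * t k) * (e \<bullet> i)"
        unfolding z_def tS by (simp add: inner_add_left algebra_simps)
      moreover have "\<bar>e \<bullet> i\<bar> \<le> 1" using Basis_le_norm[OF i, of e] e by linarith
      ultimately have "\<bar>z (Suc k) \<bullet> i - z k \<bullet> i\<bar> \<le> a * t k"
        using ab tp[of k] by (simp add: abs_mult mult_left_le)
      with 1 show "\<bar>y \<bullet> i - z k \<bullet> i\<bar> \<le> 2 * a * t k" by linarith
    qed
  qed
  have step: "ennreal \<bar>A (Suc k) - A k\<bar> \<le> ennreal (chain_const TYPE('n) \<kappa> * t k) * (ennreal (1 / (2 * t k) ^ ?N) *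
      (\<integral>\<^sup>+y\<in>cball x (2 * t k) \<inter> W. abs_sum g y \<partial>lebesgue))" for k
  proof -
    let ?I = "\<integral>\<^sup>+y\<in>cball x (2 * t k) \<inter> W. abs_sum g y \<partial>lebesgue"
    have "ennreal \<bar>A (Suc k) - A k\<bar> \<le>
      ennreal ((step_bound / (a * t (Suc k))) ^ (?N - 1)) * (\<integral>\<^sup>+y\<in>cube (z k) (2 * a * t k). abs_sum g y \<partial>lebesgue)"
      unfolding A_def
    proof (rule cube_avg_diff_box[OF wg _ _ _ _ next_sub self])
      show "cube (z k) (2 * a * t k) \<subseteq> W" using big W1 by blast
      show "0 < a * t (Suc k)" using ab tp by simp
      show "a * t (Suc k) \<le> a * t k" unfolding tS using ab tp[of k] by (intro mult_left_mono mult_left_le_one_le) auto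
    qed simp
    also have "\<dots> \<le> ennreal ((step_bound / (a * t (Suc k))) ^ (?N - 1)) * ?I"
    proof (rule mult_left_mono[OF nn_integral_mono])
      fix y :: 'n
      have "cube (z k) (2 * a * t k) \<subseteq> cball x (2 * t k) \<inter> W" using big W1 bigc by blast
      then show "abs_sum g y * indicator (cube (z k) (2 * a * t k)) y \<le> abs_sum g y * indicator (cball x (2 * t k) \<inter> W) y"
        by (auto simp: indicator_def)
    qed simp
    \<comment> \<open>The power \<open>DIM('n) - 1\<close> of 1 / \<open>t k\<close> is
      \<open>t k\<close> times the normalisation of the average over the ball of radius
      \<open>2 * t k\<close>. The surviving \<open>t k\<close> makes the links summable.\<close>
    also have "(step_bound / (a * t (Suc k))) ^ (?N - 1) = chain_const TYPE('n) \<kappa> * t k * (1 / (2 * t k) ^ ?N)"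
    proof -
      have e1: "step_bound / (a * t (Suc k)) = step_bound / (a * (1 - a)) / t k" unfolding tS by simp
      have "t k ^ ?N = t k * t k ^ (?N - 1)" by (simp add: power_eq_if)
      then show ?thesis
        unfolding e1 chain_const_def a[symmetric] using tp[of k]
        by (simp add: power_divide power_mult_distrib)
    qed
    also have "ennreal (chain_const TYPE('n) \<kappa> * t k * (1 / (2 * t k) ^ ?N)) =
      ennreal (chain_const TYPE('n) \<kappa> * t k) * ennreal (1 / (2 * t k) ^ ?N)"
      using tp[of k] by (intro ennreal_mult'') simp
    finally show ?thesis by (simp add: mult.assoc)
  qed
  have conv: "A \<longlonglongrightarrow> f x"
  proof (rule tendstoI)
    fix d :: real assume d: "d > 0"
    \<comment> \<open>Height of the bump times volume of the surrounding ball. It does not depend on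
      k, so the Lebesgue point property at x applies although the cubes are not centred at
      x.\<close>
    define B where "B = (step_bound / a) ^ ?N * (unit_ball_vol (real ?N) * 2 ^ ?N)"
    have B: "B > 0" unfolding B_def using step_fun(2) ab by simp
    have "\<forall>\<^sub>F k in sequentially. (\<integral>\<^sup>+y\<in>cball x (2 * t k). ennreal \<bar>f y - f x\<bar> \<partial>lebesgue)
      \<le> ennreal (d / (2 * B)) * emeasure lborel (cball x (2 * t k))" using d B by (intro leb) simp
    then show "\<forall>\<^sub>F k in sequentially. dist (A k) (f x) < d"
    proof eventually_elim
      case (elim k)
      have "ennreal \<bar>A k - f x\<bar> \<le> ennreal ((step_bound / (a * t k)) ^ ?N) * (\<integral>\<^sup>+y\<in>cball x (2 * t k). ennreal \<bar>f y - f x\<bar> \<partial>lebesgue)"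
        unfolding A_def
      proof (rule cube_avg_near_value)
        show "loc_integrable W f" using wg unfolding weak_gradient_def by blast
        show "a * t k > 0" using ab tp by simp
        show "cube (z k) (a * t k) \<subseteq> W" using self big W1 by blast
        show "cube (z k) (a * t k) \<subseteq> cball x (2 * t k)" using self big bigc by blast
      qed
      also have "\<dots> \<le> ennreal ((step_bound / (a * t k)) ^ ?N) * (ennreal (d / (2 * B)) * emeasure lborel (cball x (2 * t k)))"
        by (rule mult_left_mono[OF elim]) simp
      also have "\<dots> = ennreal (d / 2)"
      proof -
        define X where "X = (step_bound / (a * t k)) ^ ?N"
        define V where "V = unit_ball_vol (real ?N) * (2 * t k) ^ ?N"
        have X0: "X \<ge> 0" unfolding X_def using step_fun(2) ab tp[of k] by simp
        have V0: "V \<ge> 0" unfolding V_def using tp[of k] by simp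
        have "X * V = B"
          unfolding X_def V_def B_def using tp[of k] by (simp add: power_divide power_mult_distrib)
        then have "X * (d / (2 * B) * V) = d / (2 * B) * B" by (metis mult.left_commute)
        also have "\<dots> = d / 2" using B by simp
        finally have XV: "X * (d / (2 * B) * V) = d / 2" .
        have e1: "ennreal X * (ennreal (d / (2 * B)) * ennreal V) = ennreal (X * (d / (2 * B) * V))"
          using X0 V0 d B by (simp only: ennreal_mult[symmetric] mult_nonneg_nonneg divide_nonneg_pos
              mult_pos_pos zero_less_numeral less_imp_le)
        have e2: "emeasure lborel (cball x (2 * t k)) = ennreal V"
          unfolding V_def using tp[of k] by (intro emeasure_cball) simp
        show ?thesis unfolding X_def[symmetric] e2 e1 XV ..
      qed
      finally have "\<bar>A k - f x\<bar> \<le> d / 2" using d by (simp add: ennreal_le_iff)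
      then show ?case using d by (simp add: dist_real_def)
    qed
  qed
  have "(\<lambda>k. A (Suc k) - A k) sums (f x - A 0)" by (rule telescope_sums[OF conv])
  from sums_ennreal_abs_le[OF this]
  have "ennreal \<bar>f x - A 0\<bar> \<le> (\<Sum>k. ennreal \<bar>A (Suc k) - A k\<bar>)" .
  also have "\<dots> \<le> (\<Sum>k. ennreal (chain_const TYPE('n) \<kappa> * t k) * (ennreal (1 / (2 * t k) ^ ?N) *
      (\<integral>\<^sup>+y\<in>cball x (2 * t k) \<inter> W. abs_sum g y \<partial>lebesgue)))"
    by (intro suminf_le step) auto
  also have "A 0 = cube_avg W f (x + t0 *\<^sub>R e) (a * t0)" unfolding A_def z_def by (simp add: t)
  finally show ?thesis .
qed


section \<open>Lipschitz domains\<close>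

text \<open>Above a Lipschitz graph, moving up by t beats every perturbation of size \<kappa> t,
  which changes the height by at most \<kappa> t and the graph by at most 2 M \<kappa> t. Near a
  point of the domain itself e = 0 is taken, a degenerate cone of concentric balls; this is why |e|
  \<le> 1 is asked for instead of |e| = 1.\<close>

lemma lipschitz_cone_local:
  fixes \<Omega> :: "'n::euclidean_space set"
  assumes L: "lipschitz_domain \<Omega>" and p: "p \<in> closure \<Omega>"
  shows "\<exists>\<delta>>0. \<exists>\<kappa>>0. \<kappa> \<le> 1 \<and> (\<forall>x\<in>\<Omega> \<inter> ball p \<delta>. \<exists>e. norm e \<le> 1 \<and>
    (\<forall>t. 0 < t \<and> t \<le> \<delta> / 2 \<longrightarrow> ball (x + t *\<^sub>R e) (\<kappa> * t) \<subseteq> \<Omega>))"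
proof (cases "p \<in> \<Omega>")
  case True
  have "open \<Omega>" using L unfolding lipschitz_domain_def by blast
  then obtain d where d: "d > 0" "ball p d \<subseteq> \<Omega>" using True open_contains_ball by blast
  have A: "\<forall>x\<in>\<Omega> \<inter> ball p (d / 2). \<exists>e. norm e \<le> 1 \<and>
    (\<forall>t. 0 < t \<and> t \<le> d / 2 / 2 \<longrightarrow> ball (x + t *\<^sub>R e) (1 * t) \<subseteq> \<Omega>)"
  proof
    fix x assume x: "x \<in> \<Omega> \<inter> ball p (d / 2)"
    show "\<exists>e. norm e \<le> 1 \<and> (\<forall>t. 0 < t \<and> t \<le> d / 2 / 2 \<longrightarrow> ball (x + t *\<^sub>R e) (1 * t) \<subseteq> \<Omega>)"
    proof (intro exI[of _ 0] conjI allI impI subsetI)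
      fix t y assume t: "0 < t \<and> t \<le> d / 2 / 2" and y: "y \<in> ball (x + t *\<^sub>R 0) (1 * t)"
      have "dist p y \<le> dist p x + dist x y" by (rule dist_triangle)
      also have "\<dots> < d" using x y t by auto
      finally show "y \<in> \<Omega>" using d by auto
    qed simp
  qed
  show ?thesis
    by (rule exI[of _ "d / 2"], rule conjI, use d in simp, rule exI[of _ 1], intro conjI A) auto
next
  case False
  have "open \<Omega>" using L unfolding lipschitz_domain_def by blast
  then have "p \<in> frontier \<Omega>" using False p by (simp add: frontier_def interior_open)
  then obtain V e and gam :: "'n \<Rightarrow> real" and L' where V: "open V" "p \<in> V" and e: "norm e = 1"
    and gam: "\<And>u v. \<bar>gam u - gam v\<bar> \<le> L' * norm (u - v)"
    and loc: "\<And>y. y \<in> V \<Longrightarrow> y \<in> \<Omega> \<longleftrightarrow> y \<bullet> e > gam (y - (y \<bullet> e) *\<^sub>R e)"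
  proof -
    from L have "\<forall>p\<in>frontier \<Omega>. \<exists>V e (gam :: 'n \<Rightarrow> real) L. open V \<and> p \<in> V \<and> norm e = 1 \<and>
        (\<forall>u v. \<bar>gam u - gam v\<bar> \<le> L * norm (u - v)) \<and>
        (\<forall>y\<in>V. y \<in> \<Omega> \<longleftrightarrow> y \<bullet> e > gam (y - (y \<bullet> e) *\<^sub>R e))"
      unfolding lipschitz_domain_def by (rule conjunct2)
    from bspec[OF this \<open>p \<in> frontier \<Omega>\<close>] show thesis
      by (elim exE conjE) (rule that, auto)
  qed
  obtain d where d: "d > 0" "ball p d \<subseteq> V" using V open_contains_ball by blast
  define M where "M = \<bar>L'\<bar>"
  have gam': "\<bar>gam u - gam v\<bar> \<le> M * norm (u - v)" for u v
    unfolding M_def by (rule order_trans[OF gam mult_right_mono]) auto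
  \<comment> \<open>Chosen so that 2 M \<kappa> + \<kappa> \<le> 1. The factor 2 comes from bounding
    the part of w orthogonal to e by 2 |w|.\<close>
  define \<kappa> where "\<kappa> = 1 / (2 + 2 * M)"
  have M0: "M \<ge> 0" unfolding M_def by simp
  have \<kappa>: "\<kappa> > 0" "\<kappa> \<le> 1" "2 * M * \<kappa> + \<kappa> \<le> 1"
    unfolding \<kappa>_def using M0 by (auto simp: field_simps)
  have A: "\<forall>x\<in>\<Omega> \<inter> ball p (d / 2). \<exists>e. norm e \<le> 1 \<and>
    (\<forall>t. 0 < t \<and> t \<le> d / 2 / 2 \<longrightarrow> ball (x + t *\<^sub>R e) (\<kappa> * t) \<subseteq> \<Omega>)"
  proof
    fix x assume x: "x \<in> \<Omega> \<inter> ball p (d / 2)"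
    show "\<exists>e. norm e \<le> 1 \<and> (\<forall>t. 0 < t \<and> t \<le> d / 2 / 2 \<longrightarrow> ball (x + t *\<^sub>R e) (\<kappa> * t) \<subseteq> \<Omega>)"
    proof (intro exI[of _ e] conjI allI impI subsetI)
      fix t y assume t: "0 < t \<and> t \<le> d / 2 / 2" and y: "y \<in> ball (x + t *\<^sub>R e) (\<kappa> * t)"
      define w where "w = y - x - t *\<^sub>R e"
      have w: "norm w < \<kappa> * t" using y unfolding w_def by (simp add: dist_norm norm_minus_commute algebra_simps)
      have yx: "y = x + t *\<^sub>R e + w" unfolding w_def by simp
      have kt: "\<kappa> * t \<le> t" using \<kappa> t by simp
      \<comment> \<open>As t \<le> d/4 and |w| < t, the point y is within d/2 of x, hence within d
        of p, where the graph description is valid.\<close>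
      have "y - x = t *\<^sub>R e + w" unfolding yx by simp
      then have "dist x y = norm (t *\<^sub>R e + w)" by (metis dist_commute dist_norm)
      also have "\<dots> \<le> norm (t *\<^sub>R e) + norm w" by (rule norm_triangle_ineq)
      also have "norm (t *\<^sub>R e) = t" using t e by simp
      also have "t + norm w < d / 2" using w kt t by linarith
      finally have "dist p y < d" using x dist_triangle[of p y x] by simp
      then have yV: "y \<in> V" using d by auto
      have xV: "x \<in> V" using x d by (auto simp: subset_eq)
      have ee: "e \<bullet> e = 1" using e by (simp add: dot_square_norm)
      have we: "\<bar>w \<bullet> e\<bar> \<le> norm w" using Cauchy_Schwarz_ineq2[of w e] e by simp
      define x' where "x' = x - (x \<bullet> e) *\<^sub>R e"
      have y': "y - (y \<bullet> e) *\<^sub>R e = x' + (w - (w \<bullet> e) *\<^sub>R e)"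
        unfolding yx x'_def by (simp add: inner_add_left ee algebra_simps)
      have "norm (w - (w \<bullet> e) *\<^sub>R e) \<le> norm w + \<bar>w \<bullet> e\<bar>"
        using norm_triangle_ineq4[of w "(w \<bullet> e) *\<^sub>R e"] e by simp
      then have "norm (w - (w \<bullet> e) *\<^sub>R e) \<le> 2 * norm w" using we by linarith
      moreover have "gam (y - (y \<bullet> e) *\<^sub>R e) \<le> gam x' + M * norm (w - (w \<bullet> e) *\<^sub>R e)"
        unfolding y' using gam'[of "x' + (w - (w \<bullet> e) *\<^sub>R e)" x'] by (simp add: abs_le_iff)
      ultimately have "gam (y - (y \<bullet> e) *\<^sub>R e) \<le> gam x' + M * (2 * norm w)"
        using M0 by (meson add_left_mono mult_left_mono order_trans)
      also have "\<dots> < x \<bullet> e + M * (2 * norm w)" using loc[OF xV] x unfolding x'_def by simp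
      also have "\<dots> \<le> x \<bullet> e + M * (2 * (\<kappa> * t))" using w M0 by (intro add_left_mono mult_left_mono) auto
      also have "\<dots> \<le> x \<bullet> e + t - \<kappa> * t"
        using mult_right_mono[OF \<kappa>(3), of t] t by (simp add: algebra_simps)
      also have "\<dots> \<le> y \<bullet> e" using we w unfolding yx by (simp add: inner_add_left ee)
      finally show "y \<in> \<Omega>" using loc[OF yV] by simp
    qed (use e in simp)
  qed
  show ?thesis
    by (rule exI[of _ "d / 2"], rule conjI, use d in simp, rule exI[of _ \<kappa>], intro conjI A \<kappa>)
qed

text \<open>The cone condition survives shrinking the height and the opening, so the finitely many
  local pairs that cover the compact closure have a common one.\<close>

lemma lipschitz_cone:
  fixes \<Omega> :: "'n::euclidean_space set"
  assumes L: "lipschitz_domain \<Omega>" and bd: "bounded \<Omega>"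
  shows "\<exists>t0>0. \<exists>\<kappa>>0. \<kappa> \<le> 1 \<and> (\<forall>x\<in>\<Omega>. \<exists>e. norm e \<le> 1 \<and>
    (\<forall>t. 0 < t \<and> t \<le> t0 \<longrightarrow> ball (x + t *\<^sub>R e) (\<kappa> * t) \<subseteq> \<Omega>))"
proof -
  have "\<forall>p\<in>closure \<Omega>. \<exists>\<delta> \<kappa>. \<delta> > 0 \<and> \<kappa> > 0 \<and> \<kappa> \<le> 1 \<and> (\<forall>x\<in>\<Omega> \<inter> ball p \<delta>. \<exists>e. norm e \<le> 1 \<and>
    (\<forall>t. 0 < t \<and> t \<le> \<delta> / 2 \<longrightarrow> ball (x + t *\<^sub>R e) (\<kappa> * t) \<subseteq> \<Omega>))"
    using lipschitz_cone_local[OF L] by blast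
  then obtain \<delta> \<kappa> where dk: "\<And>p. p \<in> closure \<Omega> \<Longrightarrow> \<delta> p > 0 \<and> \<kappa> p > 0 \<and> \<kappa> p \<le> 1 \<and>
    (\<forall>x\<in>\<Omega> \<inter> ball p (\<delta> p). \<exists>e. norm e \<le> 1 \<and>
    (\<forall>t. 0 < t \<and> t \<le> \<delta> p / 2 \<longrightarrow> ball (x + t *\<^sub>R e) (\<kappa> p * t) \<subseteq> \<Omega>))"
    by metis
  have "compact (closure \<Omega>)" using bd by (simp add: compact_closure)
  then obtain D where D: "D \<subseteq> closure \<Omega>" "finite D" "closure \<Omega> \<subseteq> (\<Union>p\<in>D. ball p (\<delta> p))"
  proof (rule compactE_image[of "closure \<Omega>" "closure \<Omega>" "\<lambda>p. ball p (\<delta> p)"])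
    show "closure \<Omega> \<subseteq> (\<Union>p\<in>closure \<Omega>. ball p (\<delta> p))" using dk by force
  qed auto
  \<comment> \<open>The inserted 1 keeps both minima defined for empty D and, for the opening, also
    enforces the bound 1.\<close>
  define t0 where "t0 = Min (insert 1 ((\<lambda>p. \<delta> p / 2) ` D))"
  define k0 where "k0 = Min (insert 1 (\<kappa> ` D))"
  have t0: "t0 > 0" unfolding t0_def using D dk by (subst Min_gr_iff) auto
  have k0: "k0 > 0" unfolding k0_def using D dk by (subst Min_gr_iff) auto
  have k1: "k0 \<le> 1" unfolding k0_def using D by simp
  have A: "\<forall>x\<in>\<Omega>. \<exists>e. norm e \<le> 1 \<and> (\<forall>t. 0 < t \<and> t \<le> t0 \<longrightarrow> ball (x + t *\<^sub>R e) (k0 * t) \<subseteq> \<Omega>)"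
  proof
    fix x assume x: "x \<in> \<Omega>"
    then have "x \<in> closure \<Omega>" using closure_subset by blast
    then obtain p where p: "p \<in> D" "x \<in> ball p (\<delta> p)" using D(3) by blast
    then have "p \<in> closure \<Omega>" using D(1) by blast
    from dk[OF this] p x obtain e where e: "norm e \<le> 1"
      "\<And>t. 0 < t \<and> t \<le> \<delta> p / 2 \<Longrightarrow> ball (x + t *\<^sub>R e) (\<kappa> p * t) \<subseteq> \<Omega>" by blast
    have tp: "t0 \<le> \<delta> p / 2" unfolding t0_def using D(2) p(1) by (intro Min_le) auto
    have kp: "k0 \<le> \<kappa> p" unfolding k0_def using D(2) p(1) by (intro Min_le) auto
    show "\<exists>e. norm e \<le> 1 \<and> (\<forall>t. 0 < t \<and> t \<le> t0 \<longrightarrow> ball (x + t *\<^sub>R e) (k0 * t) \<subseteq> \<Omega>)"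
    proof (intro exI[of _ e] conjI e(1) allI impI)
      fix t assume t: "0 < t \<and> t \<le> t0"
      have "ball (x + t *\<^sub>R e) (k0 * t) \<subseteq> ball (x + t *\<^sub>R e) (\<kappa> p * t)"
        using t kp by (intro subset_ball mult_right_mono) auto
      also have "\<dots> \<subseteq> \<Omega>" using e(2) t tp by auto
      finally show "ball (x + t *\<^sub>R e) (k0 * t) \<subseteq> \<Omega>" .
    qed
  qed
  show ?thesis
    by (rule exI[of _ t0], rule conjI, rule t0, rule exI[of _ k0], intro conjI k0 k1 A)
qed

section \<open>Linking cubes in a connected domain\<close>

lemma cube_mono: "s \<le> s' \<Longrightarrow> cube z s \<subseteq> cube z s'"
proof
  fix y assume "s \<le> s'" "y \<in> cube z s"
  then show "y \<in> cube z s'" unfolding mem_cube by (meson order_trans)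
qed

lemma cube_subset_shift:
  assumes "dist z w \<le> d" "s + d \<le> s'"
  shows "cube z s \<subseteq> cube w s'"
proof
  fix y assume y: "y \<in> cube z s"
  show "y \<in> cube w s'" unfolding mem_cube
  proof
    fix i :: 'a assume i: "i \<in> Basis"
    have "\<bar>z \<bullet> i - w \<bullet> i\<bar> \<le> dist z w"
      using Basis_le_norm[OF i, of "z - w"] by (simp add: dist_norm inner_diff_left)
    moreover have "\<bar>y \<bullet> i - z \<bullet> i\<bar> \<le> s" using y i unfolding mem_cube by blast
    ultimately show "\<bar>y \<bullet> i - w \<bullet> i\<bar> \<le> s'" using assms by linarith
  qed
qed

lemma open_contains_cube:
  fixes W :: "'n::euclidean_space set"
  assumes "open W" "z \<in> W"
  obtains s where "s > 0" "cube z s \<subseteq> W"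
proof -
  obtain d where d: "d > 0" "ball z d \<subseteq> W" using assms open_contains_ball by blast
  have "real DIM('n) * (d / (2 * real DIM('n))) < d" using d by simp
  from cube_subset_ball[OF this, of z] d that[of "d / (2 * real DIM('n))"] show thesis by auto
qed

text \<open>The constant must serve all f and g at once. The relation then concerns the cubes alone,
  and arguments by connectedness and compactness yield one constant for all functions.\<close>

definition cubes_linked :: "'n::euclidean_space set \<Rightarrow> 'n \<Rightarrow> real \<Rightarrow> 'n \<Rightarrow> real \<Rightarrow> real \<Rightarrow> bool" where
  "cubes_linked W z s w r C \<longleftrightarrow> C \<ge> 0 \<and> (\<forall>f g. weak_gradient W f g \<longrightarrow>
     ennreal \<bar>cube_avg W f z s - cube_avg W f w r\<bar> \<le> ennreal C * (\<integral>\<^sup>+y\<in>W. abs_sum g y \<partial>lebesgue))"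

lemma cubes_linked_sym: "cubes_linked W z s w r C \<Longrightarrow> cubes_linked W w r z s C"
  unfolding cubes_linked_def by (simp add: abs_minus_commute)

lemma cubes_linked_trans:
  assumes "cubes_linked W z s w r C" "cubes_linked W w r v p C'"
  shows "cubes_linked W z s v p (C + C')"
  unfolding cubes_linked_def
proof (intro conjI allI impI)
  show "0 \<le> C + C'" using assms unfolding cubes_linked_def by simp
  fix f g assume wg: "weak_gradient W f g"
  let ?I = "\<integral>\<^sup>+y\<in>W. abs_sum g y \<partial>lebesgue"
  have "ennreal \<bar>cube_avg W f z s - cube_avg W f v p\<bar> \<le>
    ennreal (\<bar>cube_avg W f z s - cube_avg W f w r\<bar> + \<bar>cube_avg W f w r - cube_avg W f v p\<bar>)"
    by (rule ennreal_leI) auto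
  also have "\<dots> = ennreal \<bar>cube_avg W f z s - cube_avg W f w r\<bar> + ennreal \<bar>cube_avg W f w r - cube_avg W f v p\<bar>"
    by simp
  also have "\<dots> \<le> ennreal C * ?I + ennreal C' * ?I"
    using assms wg unfolding cubes_linked_def by (intro add_mono) blast+
  also have "\<dots> = ennreal (C + C') * ?I"
    using assms unfolding cubes_linked_def by (simp add: distrib_right)
  finally show "ennreal \<bar>cube_avg W f z s - cube_avg W f v p\<bar> \<le> ennreal (C + C') * ?I" .
qed

lemma cubes_linked_mono: "cubes_linked W z s w r C \<Longrightarrow> C \<le> C' \<Longrightarrow> cubes_linked W z s w r C'"
  unfolding cubes_linked_def by (meson ennreal_leI mult_right_mono order_trans zero_le)

lemma cubes_linked_box:
  fixes W :: "'n::euclidean_space set"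
  assumes "cube z S \<subseteq> W" "cube z0 s0 \<subseteq> cube z S" "cube z1 s1 \<subseteq> cube z S" "0 < s0" "0 < s1"
  shows "cubes_linked W z0 s0 z1 s1 ((step_bound / min s0 s1) ^ (DIM('n) - 1))"
  unfolding cubes_linked_def
proof (intro conjI allI impI)
  show "0 \<le> (step_bound / min s0 s1) ^ (DIM('n) - 1)" using step_fun(2) assms by simp
  fix f g assume wg: "weak_gradient W f g"
  have "ennreal \<bar>cube_avg W f z0 s0 - cube_avg W f z1 s1\<bar> \<le>
    ennreal ((step_bound / min s0 s1) ^ (DIM('n) - 1)) * (\<integral>\<^sup>+y\<in>cube z S. abs_sum g y \<partial>lebesgue)"
    using assms by (intro cube_avg_diff_box[OF wg]) auto
  also have "\<dots> \<le> ennreal ((step_bound / min s0 s1) ^ (DIM('n) - 1)) * (\<integral>\<^sup>+y\<in>W. abs_sum g y \<partial>lebesgue)"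
    using assms(1) by (intro mult_left_mono[OF nn_integral_mono]) (auto simp: indicator_def)
  finally show "ennreal \<bar>cube_avg W f z0 s0 - cube_avg W f z1 s1\<bar> \<le>
    ennreal ((step_bound / min s0 s1) ^ (DIM('n) - 1)) * (\<integral>\<^sup>+y\<in>W. abs_sum g y \<partial>lebesgue)" .
qed

text \<open>Being linked is an equivalence relation on the points of the domain with open classes,
  and connectedness leaves a single class.\<close>

lemma cubes_linked_connected:
  fixes W :: "'n::euclidean_space set"
  assumes W: "open W" "connected W" and zw: "z \<in> W" "w \<in> W"
    and s: "s0 > 0" "s1 > 0" "cube z s0 \<subseteq> W" "cube w s1 \<subseteq> W"
  shows "\<exists>C. cubes_linked W z s0 w s1 C"
proof -
  \<comment> \<open>Quantifying over all admissible sizes turns a relation between cubes into one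
    between points, so that transitivity does not depend on matching sizes at the middle
    point.\<close>
  define R where "R = (\<lambda>z w. \<forall>s0 s1. s0 > 0 \<and> s1 > 0 \<and> cube z s0 \<subseteq> W \<and> cube w s1 \<subseteq> W \<longrightarrow>
    (\<exists>C. cubes_linked W z s0 w s1 C))"
  have "R z w"
  proof (rule connected_equivalence_relation[OF W(2) zw])
    show "R b a" if "R a b" for a b using that cubes_linked_sym unfolding R_def by blast
    show "R a c" if tr: "R a b" "R b c" "a \<in> W" "b \<in> W" "c \<in> W" for a b c
    proof -
      obtain s where s: "s > 0" "cube b s \<subseteq> W" using open_contains_cube[OF W(1) tr(4)] .
      show ?thesis unfolding R_def
      proof (intro allI impI)
        fix s0 s1 assume a: "s0 > 0 \<and> s1 > 0 \<and> cube a s0 \<subseteq> W \<and> cube c s1 \<subseteq> W"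
        obtain C where "cubes_linked W a s0 b s C" using tr(1) a s unfolding R_def by blast
        moreover obtain C' where "cubes_linked W b s c s1 C'" using tr(2) a s unfolding R_def by blast
        ultimately show "\<exists>C. cubes_linked W a s0 c s1 C" using cubes_linked_trans by blast
      qed
    qed
    show "\<exists>T. openin (top_of_set W) T \<and> a \<in> T \<and> (\<forall>x\<in>T. R a x)" if a: "a \<in> W" for a
    proof -
      obtain s where s: "s > 0" "cube a s \<subseteq> W" using open_contains_cube[OF W(1) a] .
      show ?thesis
      proof (intro exI[of _ "W \<inter> ball a (s / 2)"] conjI ballI)
        show "openin (top_of_set W) (W \<inter> ball a (s / 2))" by (intro openin_open_Int) simp
        show "a \<in> W \<inter> ball a (s / 2)" using a s by simp
        fix x assume x: "x \<in> W \<inter> ball a (s / 2)"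
        show "R a x" unfolding R_def
        proof (intro allI impI)
          fix s0 s1 assume h: "s0 > 0 \<and> s1 > 0 \<and> cube a s0 \<subseteq> W \<and> cube x s1 \<subseteq> W"
          \<comment> \<open>Each cube is first shrunk to size r about its own centre; r \<le> s/2
            puts both small cubes into \<open>cube a s\<close>.\<close>
          define r where "r = min (min s0 s1) (s / 2)"
          have r: "r > 0" "r \<le> s0" "r \<le> s1" "r \<le> s / 2" unfolding r_def using h s by auto
          have 1: "cubes_linked W a s0 a r ((step_bound / min s0 r) ^ (DIM('n) - 1))"
            using h r by (intro cubes_linked_box[of a s0] cube_mono) auto
          have xa: "cube x r \<subseteq> cube a s"
            by (rule cube_subset_shift[of _ _ "s / 2"]) (use x r in \<open>auto simp: dist_commute\<close>)
          have 2: "cubes_linked W a r x r ((step_bound / min r r) ^ (DIM('n) - 1))"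
            by (rule cubes_linked_box[OF s(2) cube_mono xa]) (use r s in auto)
          have 3: "cubes_linked W x r x s1 ((step_bound / min r s1) ^ (DIM('n) - 1))"
            using h r by (intro cubes_linked_box[of x s1] cube_mono) auto
          show "\<exists>C. cubes_linked W a s0 x s1 C"
            using cubes_linked_trans[OF cubes_linked_trans[OF 1 2] 3] by blast
        qed
      qed
    qed
  qed
  then show ?thesis unfolding R_def using s by blast
qed

text \<open>Connectedness alone gives a constant for each z with no uniformity. The admissible
  centres form a set with compact closure, so finitely many of them serve as anchors; any other is
  within \<rho> of an anchor and is linked to it inside the cube of half-side 2 * \<rho>, which fits
  into the domain by the condition on \<eta>.\<close>

lemma cubes_linked_uniform:
  fixes W :: "'n::euclidean_space set"
  assumes W: "open W" "connected W" "bounded W" and w: "w \<in> W" "s > 0" "cube w s \<subseteq> W"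
    and \<rho>: "\<rho> > 0" "real DIM('n) * (2 * \<rho>) < \<eta>"
  shows "\<exists>C. \<forall>z. ball z \<eta> \<subseteq> W \<longrightarrow> cubes_linked W z \<rho> w s C"
proof -
  define K where "K = {z. ball z \<eta> \<subseteq> W}"
  have "\<eta> > 0" using \<rho> by (smt (verit) mult_nonneg_nonneg of_nat_0_le_iff)
  then have KW: "K \<subseteq> W" unfolding K_def by (auto simp: subset_eq)
  then have "bounded K" using W(3) bounded_subset by blast
  then have "compact (closure K)" by (simp add: compact_closure)
  then obtain D where D: "D \<subseteq> K" "finite D" "closure K \<subseteq> (\<Union>p\<in>D. ball p \<rho>)"
  proof (rule compactE_image[of "closure K" K "\<lambda>p. ball p \<rho>"])
    \<comment> \<open>Every point of the closure is within \<rho> of K itself, so the anchors can be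
      chosen in K and no closedness of K is used.\<close>
    show "closure K \<subseteq> (\<Union>p\<in>K. ball p \<rho>)"
    proof
      fix x assume "x \<in> closure K"
      then obtain y where "y \<in> K" "dist y x < \<rho>" using \<rho>(1) closure_approachable by blast
      then show "x \<in> (\<Union>p\<in>K. ball p \<rho>)" by auto
    qed
  qed auto
  have Kc: "cube p (2 * \<rho>) \<subseteq> W" if "p \<in> K" for p
    using cube_subset_ball[OF \<rho>(2), of p] that unfolding K_def by blast
  have "\<exists>C. cubes_linked W p \<rho> w s C" if "p \<in> D" for p
  proof (rule cubes_linked_connected[OF W(1,2) _ w(1) \<rho>(1) w(2) _ w(3)])
    show "p \<in> W" using that D KW by blast
    show "cube p \<rho> \<subseteq> W" using Kc[of p] cube_mono[of \<rho> "2 * \<rho>" p] that D \<rho>(1) by auto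
  qed
  then obtain C where C: "\<And>p. p \<in> D \<Longrightarrow> cubes_linked W p \<rho> w s (C p)" by metis
  have C0: "C p \<ge> 0" if "p \<in> D" for p using C[OF that] unfolding cubes_linked_def by blast
  let ?B = "(step_bound / min \<rho> \<rho>) ^ (DIM('n) - 1)"
  show ?thesis
  proof (intro exI[of _ "?B + (\<Sum>p\<in>D. C p)"] allI impI)
    fix z assume "ball z \<eta> \<subseteq> W"
    then have "z \<in> K" unfolding K_def by simp
    then have "z \<in> closure K" using closure_subset[of K] by blast
    then obtain p where p: "p \<in> D" "dist p z < \<rho>" using D(3) by auto
    have 1: "cubes_linked W z \<rho> p \<rho> ?B"
    proof (rule cubes_linked_box)
      show "cube p (2 * \<rho>) \<subseteq> W" using Kc p D by blast
      show "cube z \<rho> \<subseteq> cube p (2 * \<rho>)"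
        by (rule cube_subset_shift[of _ _ \<rho>]) (use p in \<open>auto simp: dist_commute\<close>)
      show "cube p \<rho> \<subseteq> cube p (2 * \<rho>)" using \<rho>(1) by (intro cube_mono) simp
    qed (use \<rho> in auto)
    have "C p \<le> (\<Sum>p\<in>D. C p)" using D(2) p(1) C0 by (intro member_le_sum) auto
    then have "?B + C p \<le> ?B + (\<Sum>p\<in>D. C p)" by simp
    from cubes_linked_mono[OF cubes_linked_trans[OF 1 C[OF p(1)]] this]
    show "cubes_linked W z \<rho> w s (?B + (\<Sum>p\<in>D. C p))" .
  qed
qed


section \<open>Integration by parts and uniqueness of the weak gradient\<close>

lemma integrable_continuous_compact_support:
  fixes h :: "'n::euclidean_space \<Rightarrow> real"
  assumes "continuous_on UNIV h" "compact K" "\<And>x. x \<notin> K \<Longrightarrow> h x = 0"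
  shows "integrable lborel h"
proof -
  have "integrable lborel (\<lambda>x. indicator K x *\<^sub>R h x)"
    using assms by (intro borel_integrable_compact) (auto intro: continuous_on_subset)
  moreover have "(\<lambda>x. indicator K x *\<^sub>R h x) = h" using assms(3) by (auto simp: indicator_def fun_eq_iff)
  ultimately show ?thesis by simp
qed

lemma bounded_continuous_compact_support:
  fixes h :: "'n::euclidean_space \<Rightarrow> real"
  assumes "continuous_on UNIV h" "compact K" "\<And>x. x \<notin> K \<Longrightarrow> h x = 0"
  obtains B where "B > 0" "\<And>x. \<bar>h x\<bar> \<le> B"
proof -
  have "bounded (h ` K)"
    using assms by (intro compact_imp_bounded compact_continuous_image) (auto intro: continuous_on_subset)
  then obtain B where B: "B > 0" "\<And>x. x \<in> K \<Longrightarrow> \<bar>h x\<bar> \<le> B"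
    unfolding bounded_pos by auto
  have "\<bar>h x\<bar> \<le> B" for x using B assms(3)[of x] by (cases "x \<in> K") auto
  with B(1) show thesis using that by blast
qed

text \<open>Difference quotients in direction i have integral zero by translation invariance, and
  the mean value theorem bounds them by the supremum of |\<Phi>'|, so dominated convergence passes
  to the derivative.\<close>

lemma integral_partial_derivative_eq_0:
  fixes \<Phi> :: "'n::euclidean_space \<Rightarrow> real"
  assumes i: "i \<in> Basis" and der: "\<And>x. (\<Phi> has_derivative F x) (at x)" and F: "\<And>x. F x i = \<Phi>' x"
    and cont: "continuous_on UNIV \<Phi>'" and K: "compact K" and z: "\<And>x. x \<notin> K \<Longrightarrow> \<Phi> x = 0" "\<And>x. x \<notin> K \<Longrightarrow> \<Phi>' x = 0"
  shows "(LINT x|lborel. \<Phi>' x) = 0"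
proof -
  have contP: "continuous_on UNIV \<Phi>"
    using der by (intro continuous_at_imp_continuous_on) (auto intro: has_derivative_continuous)
  have intP: "integrable lborel \<Phi>" by (rule integrable_continuous_compact_support[OF contP K z(1)])
  have Pm [measurable]: "\<Phi> \<in> borel_measurable borel" using contP by (rule borel_measurable_continuous_onI)
  obtain B where B: "B > 0" "\<And>x. \<bar>\<Phi>' x\<bar> \<le> B"
    using bounded_continuous_compact_support[OF cont K z(2)] by blast
  have line: "((\<lambda>s. \<Phi> (x + s *\<^sub>R i)) has_real_derivative \<Phi>' (x + s *\<^sub>R i)) (at s)" for x s
  proof -
    have "((\<lambda>s. x + s *\<^sub>R i) has_derivative (\<lambda>h. h *\<^sub>R i)) (at s)"
      by (auto intro!: derivative_eq_intros)
    from has_derivative_compose[OF this der]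
    have "((\<lambda>s. \<Phi> (x + s *\<^sub>R i)) has_derivative (\<lambda>h. F (x + s *\<^sub>R i) (h *\<^sub>R i))) (at s)" .
    moreover have "F (x + s *\<^sub>R i) (h *\<^sub>R i) = \<Phi>' (x + s *\<^sub>R i) * h" for h
    proof -
      have "linear (F (x + s *\<^sub>R i))" using der has_derivative_linear by blast
      then show ?thesis using F by (simp add: linear_scale mult.commute)
    qed
    ultimately show ?thesis unfolding has_field_derivative_def by simp
  qed
  define c where "c = (\<lambda>n. (1 / real (Suc n)) *\<^sub>R i)"
  define Q where "Q = (\<lambda>n x. real (Suc n) * (\<Phi> (c n + x) - \<Phi> x))"
  have Qb: "\<bar>Q n x\<bar> \<le> B" for n x
  proof -
    have "(0::real) < 1 / real (Suc n)" by simp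
    from MVT2[OF this line] obtain s where
      "\<Phi> (x + (1 / real (Suc n)) *\<^sub>R i) - \<Phi> (x + 0 *\<^sub>R i) = (1 / real (Suc n) - 0) * \<Phi>' (x + s *\<^sub>R i)" by blast
    then have "Q n x = \<Phi>' (x + s *\<^sub>R i)" unfolding Q_def c_def by (simp add: add.commute)
    then show ?thesis using B by simp
  qed
  obtain r where r: "K \<subseteq> cball 0 r" 
    using bounded_subset_ballD[OF compact_imp_bounded[OF K], of 0] ball_subset_cball by blast
  \<comment> \<open>The increments have length at most 1, so all quotients vanish outside one common
    ball, which makes the dominating function integrable.\<close>
  have Qz: "Q n x = 0" if "x \<notin> cball 0 (r + 1)" for n x
  proof -
    have "norm (c n) \<le> 1" unfolding c_def using i by simp
    moreover have "norm x \<le> norm (c n + x) + norm (c n)" by (metis add_diff_cancel_left' norm_triangle_ineq4 add.commute)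
    ultimately have "c n + x \<notin> cball 0 r" "x \<notin> cball 0 r" using that by auto
    then have "c n + x \<notin> K" "x \<notin> K" using r by blast+
    then show ?thesis unfolding Q_def by (simp add: z(1))
  qed
  have lim: "(\<lambda>n. Q n x) \<longlonglongrightarrow> \<Phi>' x" for x
  proof -
    have "((\<lambda>h. (\<Phi> (x + h *\<^sub>R i) - \<Phi> (x + 0 *\<^sub>R i)) / (h - 0)) \<longlongrightarrow> \<Phi>' (x + 0 *\<^sub>R i)) (at 0)"
      using line[of x 0] unfolding has_field_derivative_iff .
    moreover have "filterlim (\<lambda>n. 1 / real (Suc n)) (at 0) sequentially"
      unfolding filterlim_at using LIMSEQ_Suc[OF lim_1_over_n] by auto
    ultimately have "((\<lambda>n. (\<Phi> (x + (1 / real (Suc n)) *\<^sub>R i) - \<Phi> (x + 0 *\<^sub>R i)) / (1 / real (Suc n) - 0)) \<longlongrightarrow> \<Phi>' (x + 0 *\<^sub>R i)) sequentially"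
      by (rule filterlim_compose)
    then show ?thesis unfolding Q_def c_def by (simp add: add.commute mult.commute)
  qed
  have tr: "integrable lborel (\<lambda>x. \<Phi> (v + x)) \<and> (LINT x|lborel. \<Phi> (v + x)) = (LINT x|lborel. \<Phi> x)" for v
  proof
    have "integrable (distr lborel borel ((+) v)) \<Phi>" using intP by (simp add: lborel_distr_plus)
    then show "integrable lborel (\<lambda>x. \<Phi> (v + x))" by (subst (asm) integrable_distr_eq) auto
    have "(LINT x|lborel. \<Phi> (v + x)) = (LINT x|distr lborel borel ((+) v). \<Phi> x)"
      by (subst integral_distr) auto
    then show "(LINT x|lborel. \<Phi> (v + x)) = (LINT x|lborel. \<Phi> x)" by (simp add: lborel_distr_plus)
  qed
  have int0: "(LINT x|lborel. Q n x) = 0" for n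
    unfolding Q_def using tr[of "c n"] intP by simp
  have "(\<lambda>n. LINT x|lborel. Q n x) \<longlonglongrightarrow> (LINT x|lborel. \<Phi>' x)"
  proof (rule integral_dominated_convergence)
    show "\<Phi>' \<in> borel_measurable lborel" using borel_measurable_continuous_onI[OF cont] by simp
    show "Q n \<in> borel_measurable lborel" for n unfolding Q_def by measurable
    have "integrable lborel (\<lambda>x::'n. indicator (cball 0 (r + 1)) x *\<^sub>R B)"
      by (intro borel_integrable_compact) auto
    then show "integrable lborel (\<lambda>x::'n. B * indicator (cball 0 (r + 1)) x)" by (simp add: mult.commute)
    show "AE x in lborel. (\<lambda>n. Q n x) \<longlonglongrightarrow> \<Phi>' x" using lim by simp
    show "AE x in lborel. norm (Q n x) \<le> B * indicator (cball 0 (r + 1)) x" for n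
    proof (rule AE_I2)
      fix x show "norm (Q n x) \<le> B * indicator (cball 0 (r + 1)) x"
        using Qb[of n x] Qz[of x n] by (cases "x \<in> cball 0 (r + 1)") auto
    qed
  qed
  then show ?thesis unfolding int0 by (simp add: LIMSEQ_const_iff)
qed

lemma sum_inner_Basis_mult:
  fixes u :: "'n::euclidean_space \<Rightarrow> real"
  assumes i: "i \<in> Basis"
  shows "(\<Sum>j\<in>Basis. (i \<bullet> j) * u j) = u i"
proof -
  have "(\<Sum>j\<in>Basis. (i \<bullet> j) * u j) = (\<Sum>j\<in>Basis. if j = i then u j else 0)"
    using i by (intro sum.cong) (auto simp: inner_Basis)
  then show ?thesis using i by simp
qed

lemma smooth_with_has_derivative:
  assumes "smooth_with UNIV \<phi> D"
  shows "(\<phi> has_derivative (\<lambda>h. \<Sum>j\<in>Basis. (h \<bullet> j) * D [j] x)) (at x)"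
proof -
  have "D [] = \<phi>" using assms unfolding smooth_with_def by (rule conjunct1)
  moreover have "\<forall>vs x. x \<in> UNIV \<longrightarrow> (D vs has_derivative (\<lambda>h. \<Sum>i\<in>Basis. (h \<bullet> i) * D (i # vs) x)) (at x)"
    using assms unfolding smooth_with_def by (elim conjE)
  from this[rule_format, of x "[]"] have "(D [] has_derivative (\<lambda>h. \<Sum>j\<in>Basis. (h \<bullet> j) * D [j] x)) (at x)" by simp
  ultimately show ?thesis by (simp only:)
qed

lemma smooth_with_continuous_on:
  assumes "smooth_with UNIV \<phi> D"
  shows "continuous_on UNIV (D vs)" "continuous_on UNIV \<phi>"
proof -
  show c: "continuous_on UNIV (D vs)" for vs using assms unfolding smooth_with_def by (elim conjE) (rule spec)
  have "D [] = \<phi>" using assms unfolding smooth_with_def by (rule conjunct1)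
  with c[of "[]"] show "continuous_on UNIV \<phi>" by (simp only:)
qed

lemma smooth_with_partial_zero_outside:
  fixes \<phi> :: "'n::euclidean_space \<Rightarrow> real"
  assumes sm: "smooth_with UNIV \<phi> D" and K: "closed K" "\<And>x. x \<notin> K \<Longrightarrow> \<phi> x = 0" and i: "i \<in> Basis" and x: "x \<notin> K"
  shows "D [i] x = 0"
proof -
  have d: "(\<phi> has_derivative (\<lambda>h. \<Sum>j\<in>Basis. (h \<bullet> j) * D [j] x)) (at x)"
    by (rule smooth_with_has_derivative[OF sm])
  have "((\<lambda>_. 0) has_derivative (\<lambda>h. \<Sum>j\<in>Basis. (h \<bullet> j) * D [j] x)) (at x)"
    by (rule has_derivative_transform_within_open[OF d, of "- K"]) (use K x in auto)
  then have "(\<lambda>h. \<Sum>j\<in>Basis. (h \<bullet> j) * D [j] x) = (\<lambda>_. 0)"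
    using has_derivative_unique has_derivative_const by blast
  then have "(\<Sum>j\<in>Basis. (i \<bullet> j) * D [j] x) = 0" by metis
  then show ?thesis using sum_inner_Basis_mult[OF i, of "\<lambda>j. D [j] x"] by simp
qed

lemma smooth_integration_by_parts:
  fixes \<phi> \<psi> :: "'n::euclidean_space \<Rightarrow> real"
  assumes \<phi>: "smooth_with UNIV \<phi> D" and \<psi>: "smooth_with UNIV \<psi> E" and K: "compact K" "\<And>x. x \<notin> K \<Longrightarrow> \<phi> x = 0"
    and i: "i \<in> Basis"
  shows "integrable lborel (\<lambda>x. \<phi> x * E [i] x + D [i] x * \<psi> x)"
    "(LINT x|lborel. \<phi> x * E [i] x + D [i] x * \<psi> x) = 0"
proof -
  have d1: "(\<phi> has_derivative (\<lambda>h. \<Sum>j\<in>Basis. (h \<bullet> j) * D [j] x)) (at x)" for x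
    by (rule smooth_with_has_derivative[OF \<phi>])
  have d2: "(\<psi> has_derivative (\<lambda>h. \<Sum>j\<in>Basis. (h \<bullet> j) * E [j] x)) (at x)" for x
    by (rule smooth_with_has_derivative[OF \<psi>])
  have Dz: "D [i] x = 0" if "x \<notin> K" for x
    by (rule smooth_with_partial_zero_outside[OF \<phi> compact_imp_closed[OF K(1)] K(2) i that])
  have c: "continuous_on UNIV \<phi>" "continuous_on UNIV \<psi>" "continuous_on UNIV (D [i])" "continuous_on UNIV (E [i])"
    using smooth_with_continuous_on[OF \<phi>] smooth_with_continuous_on[OF \<psi>] by auto
  have cont: "continuous_on UNIV (\<lambda>x. \<phi> x * E [i] x + D [i] x * \<psi> x)"
    by (intro continuous_intros c)
  have z: "\<phi> x * E [i] x + D [i] x * \<psi> x = 0" if "x \<notin> K" for x using K(2) Dz that by simp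
  show "integrable lborel (\<lambda>x. \<phi> x * E [i] x + D [i] x * \<psi> x)"
    by (rule integrable_continuous_compact_support[OF cont K(1) z])
  show "(LINT x|lborel. \<phi> x * E [i] x + D [i] x * \<psi> x) = 0"
    by (rule integral_partial_derivative_eq_0[OF i has_derivative_mult[OF d1 d2] _ cont K(1) _ z])
      (use K(2) in \<open>auto simp: sum_inner_Basis_mult[OF i]\<close>)
qed

text \<open>On W the function is the limit of its integrable truncations along a compact
  exhaustion.\<close>

lemma loc_integrable_imp_measurable:
  fixes W :: "'n::euclidean_space set"
  assumes "loc_integrable W f" "open W"
  shows "set_borel_measurable lebesgue W f"
proof -
  obtain C where C: "\<And>n. compact (C n)" "\<And>n. C n \<subseteq> W" "\<And>n. C n \<subseteq> interior (C (Suc n))" "\<Union> (range C) = W"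
    using open_Union_compact_subsets[OF assms(2)] by metis
  have "incseq C" by (rule incseq_SucI) (meson C(3) interior_subset order_trans)
  show ?thesis unfolding set_borel_measurable_def
  proof (rule borel_measurable_LIMSEQ_real)
    fix x :: 'n
    show "(\<lambda>n. indicator (C n) x *\<^sub>R f x) \<longlonglongrightarrow> indicator W x *\<^sub>R f x"
    proof (cases "x \<in> W")
      case True
      then obtain m where "x \<in> C m" using C(4) by blast
      then have "x \<in> C n" if "n \<ge> m" for n using \<open>incseq C\<close> that by (meson incseqD subsetD)
      then have "\<forall>\<^sub>F n in sequentially. indicator (C n) x *\<^sub>R f x = indicator W x *\<^sub>R f x"
        using True by (auto simp: eventually_sequentially intro!: exI[of _ m])
      then show ?thesis by (rule tendsto_eventually)
    next
      case False
      then have "x \<notin> C n" for n using C(2) by blast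
      then show ?thesis using False by simp
    qed
    show "(\<lambda>x. indicator (C n) x *\<^sub>R f x) \<in> borel_measurable lebesgue" for n
    proof -
      have "set_integrable lebesgue (C n) f" using assms(1) C unfolding loc_integrable_def by blast
      then show ?thesis unfolding set_integrable_def by (rule borel_measurable_integrable)
    qed
  qed
qed

lemma cube_bump_test_fun:
  fixes z :: "'n::euclidean_space"
  assumes "s > 0" "cube z s \<subseteq> W"
  shows "\<exists>D. test_fun W (cube_bump z s) D"
proof -
  have "smooth_with UNIV (\<lambda>x. \<Prod>i\<in>Basis. axis_step (z \<bullet> i) s (Suc 0) (x \<bullet> i))
    (\<lambda>vs x. \<Prod>i\<in>Basis. axis_step (z \<bullet> i) s (Suc (count_list vs i)) (x \<bullet> i))"
    by (rule smooth_with_prod[where u = "\<lambda>i n. axis_step (z \<bullet> i) s (Suc n)"])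
      (rule deriv_seq_shift[OF deriv_seq_axis_step])
  then have "smooth_with UNIV (cube_bump z s) (\<lambda>vs x. \<Prod>i\<in>Basis. axis_step (z \<bullet> i) s (Suc (count_list vs i)) (x \<bullet> i))"
    unfolding cube_bump_def[abs_def] .
  then have "test_fun W (cube_bump z s) (\<lambda>vs x. \<Prod>i\<in>Basis. axis_step (z \<bullet> i) s (Suc (count_list vs i)) (x \<bullet> i))"
    by (rule test_funI_compact[where K = "cube z s"])
      (use assms in \<open>auto simp: cube_def[of z s] cube_bump_props(4)\<close>)
  then show ?thesis by blast
qed

text \<open>The cube bumps are test functions, so all averages of h over small cubes inside W
  vanish, while at a Lebesgue point x they tend to h x.\<close>

lemma fundamental_lemma:
  fixes W :: "'n::euclidean_space set"
  assumes W: "open W" and h: "loc_integrable W h"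
    and zero: "\<And>\<phi> D. test_fun W \<phi> D \<Longrightarrow> (LINT y:W|lebesgue. h y * \<phi> y) = 0"
  shows "AE x in lebesgue. x \<in> W \<longrightarrow> h x = 0"
proof -
  let ?N = "real DIM('n)"
  define s where "s = (\<lambda>k. 1 / real (Suc k))"
  define t where "t = (\<lambda>k. 2 * ?N * s k)"
  have sp: "s k > 0" for k unfolding s_def by simp
  have N: "?N \<ge> 1" using DIM_positive[where 'a='n] by simp
  have tp: "t k > 0" for k unfolding t_def using sp N by simp
  have s0: "s \<longlonglongrightarrow> 0" unfolding s_def using LIMSEQ_Suc[OF lim_1_over_n] by simp
  have t0: "t \<longlonglongrightarrow> 0" unfolding t_def using tendsto_mult_right[OF s0, of "2 * ?N"] by simp
  \<comment> \<open>Height of the bump on \<open>cube x (s k)\<close> times the volume of the ball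
    of radius \<open>t k\<close>; the powers of \<open>s k\<close> cancel.\<close>
  define B where "B = step_bound ^ DIM('n) * (unit_ball_vol ?N * (2 * ?N) ^ DIM('n))"
  have B: "B > 0" unfolding B_def using step_fun(2) N by simp
  from lebesgue_points[OF h W tp t0] show ?thesis
  proof eventually_elim
    case (elim x)
    show ?case
    proof
      assume x: "x \<in> W"
      obtain d where d: "d > 0" "ball x d \<subseteq> W" using W x open_contains_ball by blast
      have "\<bar>h x\<bar> \<le> 0 + e" if e: "e > 0" for e
      proof -
        have "\<forall>\<^sub>F k in sequentially. (\<integral>\<^sup>+y\<in>cball x (t k). ennreal \<bar>h y - h x\<bar> \<partial>lebesgue) \<le> ennreal (e / B) * emeasure lborel (cball x (t k))"
          by (rule elim[rule_format, OF x]) (use e B in simp)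
        moreover have "\<forall>\<^sub>F k in sequentially. t k < d" using t0 d(1) by (rule order_tendstoD)
        ultimately have "\<forall>\<^sub>F k in sequentially. (\<integral>\<^sup>+y\<in>cball x (t k). ennreal \<bar>h y - h x\<bar> \<partial>lebesgue) \<le> ennreal (e / B) * emeasure lborel (cball x (t k)) \<and> t k < d"
          by (rule eventually_conj)
        from eventually_happens'[OF sequentially_bot this] obtain k where k: "(\<integral>\<^sup>+y\<in>cball x (t k). ennreal \<bar>h y - h x\<bar> \<partial>lebesgue) \<le> ennreal (e / B) * emeasure lborel (cball x (t k))" "t k < d"
          by blast
        have "?N * s k < t k" unfolding t_def using N sp[of k] by simp
        from cube_subset_ball[OF this, of x] have sub: "cube x (s k) \<subseteq> ball x (t k)" .
        then have sub1: "cube x (s k) \<subseteq> cball x (t k)" using ball_subset_cball by blast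
        have sub2: "cube x (s k) \<subseteq> W" using sub k(2) d(2) subset_ball[of "t k" d x] by auto
        obtain D where "test_fun W (cube_bump x (s k)) D" using cube_bump_test_fun[OF sp sub2] by blast
        from zero[OF this] have 0: "cube_avg W h x (s k) = 0" unfolding cube_avg_def .
        define X where "X = (step_bound / s k) ^ DIM('n)"
        define V where "V = unit_ball_vol ?N * t k ^ DIM('n)"
        have X0: "X \<ge> 0" unfolding X_def using step_fun(2) sp[of k] by simp
        have V0: "V \<ge> 0" unfolding V_def using tp[of k] by simp
        have XV: "X * V = B"
          unfolding X_def V_def B_def t_def using sp[of k] by (simp add: power_divide power_mult_distrib)
        have "ennreal \<bar>h x\<bar> = ennreal \<bar>cube_avg W h x (s k) - h x\<bar>" unfolding 0 by simp
        also have "\<dots> \<le> ennreal X * (\<integral>\<^sup>+y\<in>cball x (t k). ennreal \<bar>h y - h x\<bar> \<partial>lebesgue)"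
          unfolding X_def by (rule cube_avg_near_value[OF h sp sub2 sub1])
        also have "\<dots> \<le> ennreal X * (ennreal (e / B) * emeasure lborel (cball x (t k)))"
          by (rule mult_left_mono[OF k(1)]) simp
        also have "emeasure lborel (cball x (t k)) = ennreal V"
          unfolding V_def using tp[of k] by (intro emeasure_cball) simp
        also have "ennreal X * (ennreal (e / B) * ennreal V) = ennreal (X * (e / B * V))"
          using X0 V0 e B by (simp only: ennreal_mult[symmetric] mult_nonneg_nonneg divide_nonneg_pos less_imp_le)
        also have "X * (e / B * V) = e / B * (X * V)" by (rule mult.left_commute)
        also have "\<dots> = e" unfolding XV using B by simp
        finally show ?thesis using e by (simp add: ennreal_le_iff)
      qed
      then have "\<bar>h x\<bar> \<le> 0" by (rule field_le_epsilon)
      then show "h x = 0" by simp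
    qed
  qed
qed

text \<open>Membership in the closure of the test functions supplies some weak gradient, whereas the
  inequality is about a given one; this lemma identifies their sizes.\<close>

lemma weak_gradient_unique:
  fixes W :: "'n::euclidean_space set"
  assumes W: "open W" and g: "weak_gradient W f g" "weak_gradient W f g'"
  shows "AE x in lebesgue. x \<in> W \<longrightarrow> abs_sum g x = abs_sum g' x"
proof -
  have "AE x in lebesgue. x \<in> W \<longrightarrow> g x \<bullet> i - g' x \<bullet> i = 0" if i: "i \<in> Basis" for i
  proof (rule fundamental_lemma[OF W])
    have l: "loc_integrable W (\<lambda>y. g y \<bullet> i)" "loc_integrable W (\<lambda>y. g' y \<bullet> i)"
      using g i unfolding weak_gradient_def by blast+
    show "loc_integrable W (\<lambda>x. g x \<bullet> i - g' x \<bullet> i)" by (rule loc_integrable_diff[OF l])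
    fix \<phi> D assume tf: "test_fun W \<phi> D"
    then have sm: "smooth_with UNIV \<phi> D" and K: "compact (closure (support_on UNIV \<phi>))" "closure (support_on UNIV \<phi>) \<subseteq> W"
      unfolding test_fun_def by auto
    have z: "\<phi> x = 0" if "x \<notin> closure (support_on UNIV \<phi>)" for x
      using that closure_subset[of "support_on UNIV \<phi>"] by (auto simp: support_on_def)
    have c: "continuous_on UNIV \<phi>" by (rule smooth_with_continuous_on[OF sm])
    obtain B where B: "\<And>x. \<bar>\<phi> x\<bar> \<le> B" using bounded_continuous_compact_support[OF c K(1) z] by blast
    note li = loc_integrable_mult(1)[OF _ borel_measurable_continuous_onI[OF c] K z B]
    have "(LINT y:W|lebesgue. f y * D [i] y) = - (LINT y:W|lebesgue. (g y \<bullet> i) * \<phi> y)"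
      "(LINT y:W|lebesgue. f y * D [i] y) = - (LINT y:W|lebesgue. (g' y \<bullet> i) * \<phi> y)"
      using g tf i unfolding weak_gradient_def by blast+
    then have "(LINT y:W|lebesgue. (g y \<bullet> i) * \<phi> y) = (LINT y:W|lebesgue. (g' y \<bullet> i) * \<phi> y)" by linarith
    then show "(LINT y:W|lebesgue. (g y \<bullet> i - g' y \<bullet> i) * \<phi> y) = 0"
      unfolding left_diff_distrib using set_integral_diff(2)[OF li[OF l(1)] li[OF l(2)]] by simp
  qed
  then have "AE x in lebesgue. \<forall>i\<in>Basis. x \<in> W \<longrightarrow> g x \<bullet> i - g' x \<bullet> i = 0"
    by (intro AE_finite_allI) auto
  then show ?thesis by eventually_elim (auto simp: abs_sum_def intro!: sum.cong)
qed


section \<open>Embedding into the integrable functions and extension by zero\<close>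

context block_space
begin

text \<open>Follows from the bound for majorants by letting s decrease to the norm. Convergence in
  the block norm thereby passes under integrals against bounded functions.\<close>

lemma in_H_integral:
  "\<exists>C>0. \<forall>h. in_H \<Omega> q lam h \<longrightarrow> (\<integral>\<^sup>+y\<in>\<Omega>. ennreal \<bar>h y\<bar> \<partial>lebesgue) \<le> ennreal (C * H_norm \<Omega> q lam h)"
proof -
  obtain C where C: "C > 0" "\<And>F s. majorized F s \<Longrightarrow> (\<integral>\<^sup>+y\<in>\<Omega>. F y \<partial>lebesgue) \<le> ennreal C * s"
    using majorized_integral by blast
  show ?thesis
  proof (intro exI[of _ C] conjI C(1) allI impI)
    fix h assume h: "in_H \<Omega> q lam h"
    let ?n = "H_norm \<Omega> q lam h"
    note n0 = H_norm_nonneg[OF h]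
    let ?I = "\<integral>\<^sup>+y\<in>\<Omega>. ennreal \<bar>h y\<bar> \<partial>lebesgue"
    have le: "?I \<le> ennreal (C * s)" if "s > ?n" for s
      using C(2)[OF majorized_of_in_H[OF h that]] C(1) n0 that by (simp add: ennreal_mult)
    show "?I \<le> ennreal (C * ?n)"
    proof (rule ennreal_le_epsilon)
      fix e :: real assume e: "e > 0"
      have "?I \<le> ennreal (C * (?n + e / C))" by (rule le) (use e C in simp)
      also have "C * (?n + e / C) = C * ?n + e" using C(1) by (simp add: field_simps)
      also have "ennreal (C * ?n + e) = ennreal (C * ?n) + ennreal e" using C(1) n0 e by simp
      finally show "?I \<le> ennreal (C * ?n) + ennreal e" .
    qed
  qed
qed

lemma set_integrable_of_in_H:
  assumes "in_H \<Omega> q lam h" "loc_integrable \<Omega> h"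
  shows "set_integrable lebesgue \<Omega> h"
proof -
  obtain C where "(\<integral>\<^sup>+y\<in>\<Omega>. ennreal \<bar>h y\<bar> \<partial>lebesgue) \<le> ennreal (C * H_norm \<Omega> q lam h)"
    using in_H_integral assms(1) by blast
  then have "(\<integral>\<^sup>+y\<in>\<Omega>. ennreal \<bar>h y\<bar> \<partial>lebesgue) < \<infinity>" by (simp add: order_le_less_trans)
  moreover have "(\<integral>\<^sup>+y\<in>\<Omega>. ennreal \<bar>h y\<bar> \<partial>lebesgue) = (\<integral>\<^sup>+y. ennreal (norm (indicator \<Omega> y *\<^sub>R h y)) \<partial>lebesgue)"
    by (intro nn_integral_cong) (auto simp: indicator_def)
  ultimately show ?thesis
    using loc_integrable_imp_measurable[OF assms(2) open_domain]
    unfolding set_integrable_def set_borel_measurable_def by (intro integrableI_bounded) auto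
qed

text \<open>The approximating test functions satisfy integration by parts against every smooth
  compactly supported \<psi> on the whole space, even if \<psi> does not vanish at the boundary.
  Both sides converge, since \<psi> and its partial derivatives are bounded and the approximation
  holds in L^1 of the domain, so no boundary term arises in the limit.\<close>

lemma zero_extension:
  assumes "in_W10H \<Omega> q lam f"
  shows "\<exists>g. weak_gradient \<Omega> f g \<and>
    weak_gradient UNIV (\<lambda>y. indicator \<Omega> y * f y) (\<lambda>y. indicator \<Omega> y *\<^sub>R g y)"
proof -
  from assms obtain g \<phi> D where fH: "in_H \<Omega> q lam f" and wg: "weak_gradient \<Omega> f g"
    and gH: "\<And>i. i \<in> Basis \<Longrightarrow> in_H \<Omega> q lam (\<lambda>y. g y \<bullet> i)"
    and tf: "\<And>j. test_fun \<Omega> (\<phi> j) (D j)"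
    and d1: "\<And>j. in_H \<Omega> q lam (\<lambda>y. f y - \<phi> j y)"
    and d2: "\<And>j i. i \<in> Basis \<Longrightarrow> in_H \<Omega> q lam (\<lambda>y. g y \<bullet> i - D j [i] y)"
    and lim: "(\<lambda>j. H_norm \<Omega> q lam (\<lambda>y. f y - \<phi> j y) +
      (\<Sum>i\<in>Basis. H_norm \<Omega> q lam (\<lambda>y. g y \<bullet> i - D j [i] y))) \<longlonglongrightarrow> 0"
    unfolding in_W10H_def by blast
  obtain C where C: "C > 0" "\<And>h. in_H \<Omega> q lam h \<Longrightarrow>
      (\<integral>\<^sup>+y\<in>\<Omega>. ennreal \<bar>h y\<bar> \<partial>lebesgue) \<le> ennreal (C * H_norm \<Omega> q lam h)"
    using in_H_integral by blast
  have lf: "loc_integrable \<Omega> f" and lg: "\<And>i. i \<in> Basis \<Longrightarrow> loc_integrable \<Omega> (\<lambda>y. g y \<bullet> i)"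
    using wg unfolding weak_gradient_def by auto
  let ?f = "\<lambda>y. indicator \<Omega> y * f y" and ?g = "\<lambda>i y. indicator \<Omega> y * (g y \<bullet> i)"
  have fi: "integrable lebesgue ?f"
    using set_integrable_of_in_H[OF fH lf] unfolding set_integrable_def by simp
  have gi: "integrable lebesgue (?g i)" if "i \<in> Basis" for i
    using set_integrable_of_in_H[OF gH lg] that unfolding set_integrable_def by simp
  have loc: "loc_integrable UNIV h" if "integrable lebesgue h" for h :: "'n \<Rightarrow> real"
    unfolding loc_integrable_def set_integrable_def
  proof (intro allI impI)
    fix K :: "'n set" assume "compact K \<and> K \<subseteq> UNIV"
    then have "K \<in> sets lebesgue" by (auto simp: compact_imp_closed borel_closed)
    then show "integrable lebesgue (\<lambda>x. indicator K x *\<^sub>R h x)" using that by (rule integrable_mult_indicator)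
  qed
  have ibp: "(LINT y|lebesgue. ?f y * E [i] y) + (LINT y|lebesgue. ?g i y * \<psi> y) = 0"
    if tE: "test_fun UNIV \<psi> E" and i: "i \<in> Basis" for \<psi> E i
  proof -
    have smE: "smooth_with UNIV \<psi> E" and K: "compact (closure (support_on UNIV \<psi>))"
      using tE unfolding test_fun_def by auto
    let ?K = "closure (support_on UNIV \<psi>)"
    have z: "\<psi> x = 0" if "x \<notin> ?K" for x
      using that closure_subset[of "support_on UNIV \<psi>"] by (auto simp: support_on_def)
    have zE: "E [i] x = 0" if "x \<notin> ?K" for x
      by (rule smooth_with_partial_zero_outside[OF smE compact_imp_closed[OF K] z i that])
    note cont = smooth_with_continuous_on[OF smE]
    obtain B1 where B1: "B1 > 0" "\<And>x. \<bar>\<psi> x\<bar> \<le> B1"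
      using bounded_continuous_compact_support[OF cont(2) K z] by blast
    obtain B2 where B2: "B2 > 0" "\<And>x. \<bar>E [i] x\<bar> \<le> B2"
      using bounded_continuous_compact_support[OF cont(1) K zE] by blast
    define B where "B = max B1 B2"
    have B: "B > 0" "\<And>x. \<bar>\<psi> x\<bar> \<le> B" "\<And>x. \<bar>E [i] x\<bar> \<le> B"
      unfolding B_def using B1 B2 by (auto simp: le_max_iff_disj)
    have m: "\<psi> \<in> borel_measurable borel" "E [i] \<in> borel_measurable borel"
      using cont by (auto intro!: borel_measurable_continuous_onI)
    have int1: "integrable lebesgue (\<lambda>y. ?f y * E [i] y)"
      using loc_integrable_mult(1)[OF loc[OF fi] m(2) K _ zE B(3)] unfolding set_integrable_def by simp
    have int2: "integrable lebesgue (\<lambda>y. ?g i y * \<psi> y)"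
      using loc_integrable_mult(1)[OF loc[OF gi[OF i]] m(1) K _ z B(2)] unfolding set_integrable_def by simp
    let ?S = "(LINT y|lebesgue. ?f y * E [i] y) + (LINT y|lebesgue. ?g i y * \<psi> y)"
    let ?e = "\<lambda>j. H_norm \<Omega> q lam (\<lambda>y. f y - \<phi> j y) + (\<Sum>i\<in>Basis. H_norm \<Omega> q lam (\<lambda>y. g y \<bullet> i - D j [i] y))"
    have bound: "\<bar>?S\<bar> \<le> B * (C * ?e j)" for j
    proof -
      have sm: "smooth_with UNIV (\<phi> j) (D j)" and Kj: "compact (closure (support_on UNIV (\<phi> j)))"
        "closure (support_on UNIV (\<phi> j)) \<subseteq> \<Omega>"
        using tf[of j] unfolding test_fun_def by auto
      have zj: "\<phi> j x = 0" if "x \<notin> closure (support_on UNIV (\<phi> j))" for x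
        using that closure_subset[of "support_on UNIV (\<phi> j)"] by (auto simp: support_on_def)
      have zD: "D j [i] x = 0" if "x \<notin> closure (support_on UNIV (\<phi> j))" for x
        by (rule smooth_with_partial_zero_outside[OF sm compact_imp_closed[OF Kj(1)] zj i that])
      let ?b = "\<lambda>x. \<phi> j x * E [i] x + D j [i] x * \<psi> x"
      note parts = smooth_integration_by_parts[OF sm smE Kj(1) zj i]
      have pm: "?b \<in> borel_measurable borel" using parts(1) by auto
      have p1: "integrable lebesgue ?b" using parts(1) by (simp add: integrable_completion pm)
      have p2: "(LINT x|lebesgue. ?b x) = 0" using parts(2) pm by (simp add: integral_completion)
      \<comment> \<open>Subtracting \<open>?b\<close>, whose integral is zero, changes nothing in
        the sum \<open>?S\<close> but makes the integrand small: on the domain it is the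
        approximation error paired with \<psi> and its derivative, and off the domain it
        vanishes.\<close>
      let ?r = "\<lambda>y. (?f y * E [i] y + ?g i y * \<psi> y) - ?b y"
      have ri: "integrable lebesgue ?r" using int1 int2 p1 by auto
      have "?S = (LINT y|lebesgue. ?r y)" using int1 int2 p1 p2 by simp
      then have "ennreal \<bar>?S\<bar> \<le> (\<integral>\<^sup>+y. ennreal (norm (?r y)) \<partial>lebesgue)"
        using integral_norm_bound_ennreal[OF ri] by simp
      also have "\<dots> \<le> (\<integral>\<^sup>+y. ennreal B * (ennreal \<bar>f y - \<phi> j y\<bar> * indicator \<Omega> y) + ennreal B * (ennreal \<bar>g y \<bullet> i - D j [i] y\<bar> * indicator \<Omega> y) \<partial>lebesgue)"
      proof (rule nn_integral_mono)
        fix y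
        show "ennreal (norm (?r y)) \<le> ennreal B * (ennreal \<bar>f y - \<phi> j y\<bar> * indicator \<Omega> y) + ennreal B * (ennreal \<bar>g y \<bullet> i - D j [i] y\<bar> * indicator \<Omega> y)"
        proof (cases "y \<in> \<Omega>")
          case True
          have "?r y = (f y - \<phi> j y) * E [i] y + (g y \<bullet> i - D j [i] y) * \<psi> y"
            using True by (simp add: algebra_simps)
          then have "norm (?r y) \<le> \<bar>(f y - \<phi> j y) * E [i] y\<bar> + \<bar>(g y \<bullet> i - D j [i] y) * \<psi> y\<bar>"
            by (simp only: real_norm_def abs_triangle_ineq)
          also have "\<dots> \<le> B * \<bar>f y - \<phi> j y\<bar> + B * \<bar>g y \<bullet> i - D j [i] y\<bar>"
            unfolding abs_mult using mult_right_mono[OF B(3)[of y], of "\<bar>f y - \<phi> j y\<bar>"]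
              mult_right_mono[OF B(2)[of y], of "\<bar>g y \<bullet> i - D j [i] y\<bar>"] by (simp add: mult.commute)
          finally have "ennreal (norm (?r y)) \<le> ennreal (B * \<bar>f y - \<phi> j y\<bar> + B * \<bar>g y \<bullet> i - D j [i] y\<bar>)"
            by (rule ennreal_leI)
          also have "\<dots> = ennreal B * ennreal \<bar>f y - \<phi> j y\<bar> + ennreal B * ennreal \<bar>g y \<bullet> i - D j [i] y\<bar>"
            using B(1) by (simp add: ennreal_mult)
          finally show ?thesis using True by simp
        next
          case False
          then have "y \<notin> closure (support_on UNIV (\<phi> j))" using Kj(2) by blast
          then show ?thesis using False zj zD by simp
        qed
      qed
      also have "\<dots> = ennreal B * (\<integral>\<^sup>+y\<in>\<Omega>. ennreal \<bar>f y - \<phi> j y\<bar> \<partial>lebesgue) + ennreal B * (\<integral>\<^sup>+y\<in>\<Omega>. ennreal \<bar>g y \<bullet> i - D j [i] y\<bar> \<partial>lebesgue)"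
      proof -
        have mm: "(\<lambda>y. ennreal \<bar>u y - v y\<bar> * indicator \<Omega> y) \<in> borel_measurable lebesgue"
          if "(\<lambda>y. indicator \<Omega> y * u y) \<in> borel_measurable lebesgue" "v \<in> borel_measurable borel" for u v :: "'n \<Rightarrow> real"
        proof -
          have [measurable]: "v \<in> borel_measurable lebesgue" using that(2) by (simp add: measurable_completion)
          have "(\<lambda>y. ennreal \<bar>indicator \<Omega> y * u y - v y\<bar> * indicator \<Omega> y) \<in> borel_measurable lebesgue"
            using that(1) by measurable
          also have "(\<lambda>y. ennreal \<bar>indicator \<Omega> y * u y - v y\<bar> * indicator \<Omega> y) = (\<lambda>y. ennreal \<bar>u y - v y\<bar> * indicator \<Omega> y)"
            by (auto simp: indicator_def fun_eq_iff)
          finally show ?thesis .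
        qed
        note c = smooth_with_continuous_on[OF sm]
        have m1: "(\<lambda>y. ennreal \<bar>f y - \<phi> j y\<bar> * indicator \<Omega> y) \<in> borel_measurable lebesgue"
          by (rule mm[OF borel_measurable_integrable[OF fi] borel_measurable_continuous_onI[OF c(2)]])
        have m2: "(\<lambda>y. ennreal \<bar>g y \<bullet> i - D j [i] y\<bar> * indicator \<Omega> y) \<in> borel_measurable lebesgue"
          by (rule mm[OF borel_measurable_integrable[OF gi[OF i]] borel_measurable_continuous_onI[OF c(1)]])
        show ?thesis using m1 m2 by (simp add: nn_integral_add nn_integral_cmult)
      qed
      also have "\<dots> \<le> ennreal B * ennreal (C * H_norm \<Omega> q lam (\<lambda>y. f y - \<phi> j y)) + ennreal B * ennreal (C * H_norm \<Omega> q lam (\<lambda>y. g y \<bullet> i - D j [i] y))"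
        by (intro add_mono mult_left_mono C(2) d1 d2[OF i]) auto
      also have "\<dots> = ennreal (B * (C * (H_norm \<Omega> q lam (\<lambda>y. f y - \<phi> j y) + H_norm \<Omega> q lam (\<lambda>y. g y \<bullet> i - D j [i] y))))"
        using B(1) C(1) H_norm_nonneg[OF d1[of j]] H_norm_nonneg[OF d2[OF i, of j]]
        by (simp add: ennreal_mult[symmetric] ennreal_plus[symmetric] distrib_left del: ennreal_plus)
      also have "\<dots> \<le> ennreal (B * (C * ?e j))"
      proof (intro ennreal_leI mult_left_mono add_left_mono)
        show "H_norm \<Omega> q lam (\<lambda>y. g y \<bullet> i - D j [i] y) \<le> (\<Sum>i\<in>Basis. H_norm \<Omega> q lam (\<lambda>y. g y \<bullet> i - D j [i] y))"
          using i H_norm_nonneg[OF d2] by (intro member_le_sum[where f = "\<lambda>i. H_norm \<Omega> q lam (\<lambda>y. g y \<bullet> i - D j [i] y)"]) auto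
      qed (use B C in auto)
      finally have le: "ennreal \<bar>?S\<bar> \<le> ennreal (B * (C * ?e j))" .
      have "0 \<le> B * (C * ?e j)"
        using B(1) C(1) H_norm_nonneg[OF d1] H_norm_nonneg[OF d2]
        by (intro mult_nonneg_nonneg add_nonneg_nonneg sum_nonneg) auto
      with le show ?thesis by (simp add: ennreal_le_iff)
    qed
    have "(\<lambda>j. B * (C * ?e j)) \<longlonglongrightarrow> B * (C * 0)" by (intro tendsto_mult tendsto_const lim)
    then have "\<bar>?S\<bar> \<le> B * (C * 0)" by (rule LIMSEQ_le_const) (use bound in blast)
    then show "?S = 0" by simp
  qed
  have "weak_gradient UNIV (\<lambda>y. indicator \<Omega> y * f y) (\<lambda>y. indicator \<Omega> y *\<^sub>R g y)"
    unfolding weak_gradient_def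
  proof (intro conjI ballI allI impI)
    show "loc_integrable UNIV ?f" by (rule loc[OF fi])
    show "loc_integrable UNIV (\<lambda>y. (indicator \<Omega> y *\<^sub>R g y) \<bullet> i)" if "i \<in> Basis" for i
      using loc[OF gi[OF that]] by simp
    fix \<psi> :: "'n \<Rightarrow> real" and E and i :: 'n assume t: "test_fun UNIV \<psi> E" and i: "i \<in> Basis"
    from ibp[OF t i] show "(LINT y:UNIV|lebesgue. ?f y * E [i] y) = - (LINT y:UNIV|lebesgue. ((indicator \<Omega> y *\<^sub>R g y) \<bullet> i) * \<psi> y)"
      by (simp add: set_lebesgue_integral_def)
  qed
  with wg show ?thesis by blast
qed

end


section \<open>The Poincare inequality\<close>

lemma chain_const_nonneg: "0 < \<kappa> \<Longrightarrow> \<kappa> \<le> 1 \<Longrightarrow> 0 \<le> chain_const TYPE('n::euclidean_space) \<kappa>"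
  using chain_ratio_bounds[of \<kappa>, where 'n='n] step_fun(2) unfolding chain_const_def by simp

context block_space
begin

lemma majorized_chain_sum:
  assumes maj: "majorized G (ennreal s)" and s: "s \<ge> 0" and a: "0 < a" "a < 1" and t0: "t0 > 0" and K: "K \<ge> 0"
  shows "majorized (\<lambda>x. \<Sum>k. ennreal (K * (t0 * (1 - a) ^ k)) * ball_avg (2 * (t0 * (1 - a) ^ k)) G x)
    (ennreal (K * t0 / a * avg_const * s))"
proof -
  have "majorized (\<lambda>x. \<Sum>k. ennreal (K * (t0 * (1 - a) ^ k)) * ball_avg (2 * (t0 * (1 - a) ^ k)) G x)
    (\<Sum>k. ennreal (K * (t0 * (1 - a) ^ k)) * (ennreal avg_const * ennreal s))"
    using a t0 by (intro majorized_suminf majorized_cmult majorized_ball_avg maj) auto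
  moreover have "(\<Sum>k. ennreal (K * (t0 * (1 - a) ^ k)) * (ennreal avg_const * ennreal s)) = ennreal (K * t0 / a * avg_const * s)"
  proof -
    \<comment> \<open>The radii form a geometric series with sum t0/a, and the averages all have the
      same constant \<open>avg_const\<close>.\<close>
    have "(\<lambda>k. (1 - a) ^ k) sums (1 / (1 - (1 - a)))" using a by (intro geometric_sums) auto
    from sums_mult[OF this, of "K * t0"] have sm: "(\<lambda>k. K * (t0 * (1 - a) ^ k)) sums (K * t0 / a)"
      by (simp only: mult.assoc diff_diff_eq2 add_diff_cancel_left' times_divide_eq_right mult_1_right)
    have "K * (t0 * (1 - a) ^ k) \<ge> 0" for k using K t0 a by simp
    from suminf_ennreal2[OF this sums_summable[OF sm]] sums_unique[OF sm]
    have e: "(\<Sum>k. ennreal (K * (t0 * (1 - a) ^ k))) = ennreal (K * t0 / a)" by (simp only:)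
    have X: "K * t0 / a \<ge> 0" using K t0 a by simp
    have Y: "avg_const \<ge> 0" using avg_const_pos by simp
    show ?thesis
      unfolding ennreal_suminf_multc e using X Y s
      by (simp only: ennreal_mult[symmetric] mult_nonneg_nonneg mult.assoc)
  qed
  ultimately show ?thesis by simp
qed

lemma majorized_const_mult:
  assumes "majorized (\<lambda>_. 1) (ennreal C0)" "c \<ge> 0" "C0 > 0"
  shows "majorized (\<lambda>_. ennreal c) (ennreal (c * C0))"
  using majorized_cmult[OF assms(1), of "ennreal c"] assms(2,3) by (simp add: ennreal_mult)

text \<open>Stated for an arbitrary majorant size s, so that no infimum is handled until the end.
  The domain is bounded, so constants are majorized too; this is how the bounds on the difference of
  averages and on A itself enter the estimate of f.\<close>

lemma poincare_mean_majorant: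
  assumes L: "lipschitz_domain \<Omega>" and conn: "connected \<Omega>"
    and U: "U \<in> sets lebesgue" "U \<subseteq> \<Omega>" "emeasure lebesgue U > 0"
  shows "\<exists>c>0. \<forall>f g s. weak_gradient \<Omega> f g \<and> set_integrable lebesgue \<Omega> f \<and> (LINT y:U|lebesgue. f y) = 0 \<and>
    s \<ge> 0 \<and> majorized (abs_sum g) (ennreal s) \<longrightarrow> majorized (\<lambda>y. ennreal \<bar>f y\<bar>) (ennreal (c * s))"
proof -
  obtain t0 \<kappa> where t0: "t0 > 0" and \<kappa>: "\<kappa> > 0" "\<kappa> \<le> 1" and cone: "\<And>x. x \<in> \<Omega> \<Longrightarrow> \<exists>e. norm e \<le> 1 \<and>
    (\<forall>t. 0 < t \<and> t \<le> t0 \<longrightarrow> ball (x + t *\<^sub>R e) (\<kappa> * t) \<subseteq> \<Omega>)"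
    using lipschitz_cone[OF L bounded_domain] by blast
  define a where "a = chain_ratio TYPE('n) \<kappa>"
  note ab = chain_ratio_bounds[OF \<kappa>, where 'n='n, folded a_def]
  define K where "K = chain_const TYPE('n) \<kappa>"
  have K: "K \<ge> 0" unfolding K_def by (rule chain_const_nonneg[OF \<kappa>])
  obtain w where w: "w \<in> \<Omega>" using nonempty_domain by blast
  obtain r where r: "r > 0" "cube w r \<subseteq> \<Omega>" using open_contains_cube[OF open_domain w] .
  have "\<exists>C. \<forall>z. ball z (\<kappa> * t0) \<subseteq> \<Omega> \<longrightarrow> cubes_linked \<Omega> z (a * t0) w r C"
  proof (rule cubes_linked_uniform[OF open_domain conn bounded_domain w r])
    show "a * t0 > 0" using ab t0 by simp
    have "real DIM('n) * (2 * (a * t0)) = \<kappa> * t0 / 2" using ab(3) by (simp add: algebra_simps)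
    then show "real DIM('n) * (2 * (a * t0)) < \<kappa> * t0" using \<kappa> t0 by simp
  qed
  then obtain C2' where C2': "\<And>z. ball z (\<kappa> * t0) \<subseteq> \<Omega> \<Longrightarrow> cubes_linked \<Omega> z (a * t0) w r C2'" by blast
  \<comment> \<open>\<open>C2'\<close> is known to be nonnegative only if some admissible centre z
    exists; the absolute value settles this beforehand.\<close>
  define C2 where "C2 = \<bar>C2'\<bar>"
  have C2: "cubes_linked \<Omega> z (a * t0) w r C2" if "ball z (\<kappa> * t0) \<subseteq> \<Omega>" for z
    using cubes_linked_mono[OF C2'[OF that]] unfolding C2_def by simp
  have C20: "C2 \<ge> 0" unfolding C2_def by simp
  obtain C1 where C1: "C1 > 0" "\<And>F s. majorized F s \<Longrightarrow> (\<integral>\<^sup>+y\<in>\<Omega>. F y \<partial>lebesgue) \<le> ennreal C1 * s"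
    using majorized_integral by blast
  obtain C0 where C0: "majorized (\<lambda>_. 1) (ennreal C0)" "C0 > 0" using majorized_const by blast
  define \<mu> where "\<mu> = measure lebesgue U"
  have Ufin: "emeasure lebesgue U < \<infinity>"
  proof -
    have "emeasure lebesgue U \<le> emeasure lebesgue \<Omega>" using U by (intro emeasure_mono) auto
    also have "\<dots> < \<infinity>" using emeasure_bounded_finite[OF bounded_domain] by (simp add: less_top)
    finally show ?thesis .
  qed
  have \<mu>: "\<mu> > 0" "emeasure lebesgue U = ennreal \<mu>"
    using U(3) Ufin unfolding \<mu>_def by (auto simp: emeasure_eq_ennreal_measure less_top zero_less_measure_iff)
  \<comment> \<open>In \<open>c1\<close> the first term is the sum over the chain and the second the
    link to the fixed cube, with \<open>C1\<close> from integrating the gradient and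
    \<open>C0\<close> from majorizing a constant. The further term in \<open>c\<close> is the bound
    for |A|, and the final 1 secures positivity.\<close>
  define c1 where "c1 = K * t0 / a * avg_const + C2 * C1 * C0"
  define c where "c = c1 + C1 * c1 / \<mu> * C0 + 1"
  have c1: "c1 \<ge> 0" unfolding c1_def using K t0 ab avg_const_pos C20 C1 C0 by (intro add_nonneg_nonneg mult_nonneg_nonneg divide_nonneg_pos) auto
  have c: "c > 0" unfolding c_def using c1 C1 C0 \<mu> by (intro add_nonneg_pos add_nonneg_nonneg mult_nonneg_nonneg divide_nonneg_pos) auto
  show ?thesis
  proof (intro exI[of _ c] conjI c allI impI)
    fix f g s
    assume "weak_gradient \<Omega> f g \<and> set_integrable lebesgue \<Omega> f \<and> (LINT y:U|lebesgue. f y) = 0 \<and>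
      s \<ge> 0 \<and> majorized (abs_sum g) (ennreal s)"
    then have wg: "weak_gradient \<Omega> f g" and fi: "set_integrable lebesgue \<Omega> f" and f0: "(LINT y:U|lebesgue. f y) = 0"
      and s: "s \<ge> 0" and maj: "majorized (abs_sum g) (ennreal s)" by auto
    define A where "A = cube_avg \<Omega> f w r"
    define P where "P = (\<lambda>x. \<Sum>k. ennreal (K * (t0 * (1 - a) ^ k)) * ball_avg (2 * (t0 * (1 - a) ^ k)) (abs_sum g) x)"
    have Pmaj: "majorized P (ennreal (K * t0 / a * avg_const * s))"
      unfolding P_def by (rule majorized_chain_sum[OF maj s]) (use ab t0 K in auto)
    have I: "(\<integral>\<^sup>+y\<in>\<Omega>. abs_sum g y \<partial>lebesgue) \<le> ennreal (C1 * s)"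
      using C1(2)[OF maj] C1(1) s by (simp add: ennreal_mult)
    have lf: "loc_integrable \<Omega> f" using wg unfolding weak_gradient_def by blast
    have tp: "2 * (t0 * (1 - a) ^ k) > 0" for k using t0 ab by simp
    have "(\<lambda>k. (1 - a) ^ k) \<longlonglongrightarrow> 0" using ab by (intro LIMSEQ_realpow_zero) auto
    from tendsto_mult_left[OF this, of "2 * t0"] have tlim: "(\<lambda>k. 2 * (t0 * (1 - a) ^ k)) \<longlonglongrightarrow> 0"
      by (simp only: mult.assoc mult_zero_right)
    have ptw: "AE x in lebesgue. x \<in> \<Omega> \<longrightarrow> ennreal \<bar>f x - A\<bar> \<le> P x + ennreal (C2 * (C1 * s))"
      using lebesgue_points[OF lf open_domain tp tlim]
    proof eventually_elim
      case (elim x)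
      show ?case
      proof
        assume x: "x \<in> \<Omega>"
        obtain e where e: "norm e \<le> 1" "\<And>t. 0 < t \<Longrightarrow> t \<le> t0 \<Longrightarrow> ball (x + t *\<^sub>R e) (\<kappa> * t) \<subseteq> \<Omega>"
          using cone[OF x] by blast
        let ?A0 = "cube_avg \<Omega> f (x + t0 *\<^sub>R e) (a * t0)"
        have 1: "ennreal \<bar>f x - ?A0\<bar> \<le> P x"
          unfolding P_def ball_avg_def K_def
          by (rule cone_chain[OF wg e(1) \<kappa> t0 e(2) a_def refl]) (use elim x in auto)
        have "ball (x + t0 *\<^sub>R e) (\<kappa> * t0) \<subseteq> \<Omega>" using e(2) t0 by simp
        from C2[OF this] have "ennreal \<bar>?A0 - A\<bar> \<le> ennreal C2 * (\<integral>\<^sup>+y\<in>\<Omega>. abs_sum g y \<partial>lebesgue)"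
          unfolding cubes_linked_def A_def using wg by blast
        also have "\<dots> \<le> ennreal C2 * ennreal (C1 * s)" by (rule mult_left_mono[OF I]) simp
        also have "\<dots> = ennreal (C2 * (C1 * s))" using C20 by (simp add: ennreal_mult')
        finally have 2: "ennreal \<bar>?A0 - A\<bar> \<le> ennreal (C2 * (C1 * s))" .
        have "ennreal \<bar>f x - A\<bar> \<le> ennreal (\<bar>f x - ?A0\<bar> + \<bar>?A0 - A\<bar>)" by (rule ennreal_leI) auto
        also have "\<dots> = ennreal \<bar>f x - ?A0\<bar> + ennreal \<bar>?A0 - A\<bar>" by simp
        also have "\<dots> \<le> P x + ennreal (C2 * (C1 * s))" by (rule add_mono[OF 1 2])
        finally show "ennreal \<bar>f x - A\<bar> \<le> P x + ennreal (C2 * (C1 * s))" .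
      qed
    qed
    have fA: "majorized (\<lambda>x. ennreal \<bar>f x - A\<bar>) (ennreal (c1 * s))"
    proof (rule majorized_mono[OF majorized_add[OF Pmaj majorized_const_mult[OF C0(1) _ C0(2)]] ptw])
      show "0 \<le> C2 * (C1 * s)" using C20 C1 s by simp
      show "ennreal (K * t0 / a * avg_const * s) + ennreal (C2 * (C1 * s) * C0) \<le> ennreal (c1 * s)"
        using K t0 ab avg_const_pos C20 C1 C0 s unfolding c1_def
        by (simp add: ennreal_plus[symmetric] algebra_simps del: ennreal_plus)
    qed
    have fU: "set_integrable lebesgue U f" by (rule set_integrable_subset[OF fi U(1,2)])
    have AU: "set_integrable lebesgue U (\<lambda>_. A)"
      using Ufin U(1) unfolding set_integrable_def by (simp add: integrable_indicator_iff)
    \<comment> \<open>Since f has integral zero over U, integrating f - A there isolates A, and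
      \<mu> > 0 allows dividing by it.\<close>
    have "(LINT y:U|lebesgue. f y - A) = - (\<mu> * A)"
      using set_integral_diff(2)[OF fU AU] f0 U(1) Ufin by (simp add: \<mu>_def set_lebesgue_integral_def)
    then have "ennreal (\<mu> * \<bar>A\<bar>) = ennreal \<bar>LINT y:U|lebesgue. f y - A\<bar>"
      using \<mu>(1) by (simp add: abs_mult)
    also have "\<dots> \<le> (\<integral>\<^sup>+y. ennreal (norm (indicator U y *\<^sub>R (f y - A))) \<partial>lebesgue)"
      using set_integral_diff(1)[OF fU AU] unfolding set_lebesgue_integral_def set_integrable_def real_norm_def[symmetric]
      by (rule integral_norm_bound_ennreal)
    also have "\<dots> \<le> (\<integral>\<^sup>+y\<in>\<Omega>. ennreal \<bar>f y - A\<bar> \<partial>lebesgue)"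
      using U(2) by (intro nn_integral_mono) (auto simp: indicator_def)
    also have "\<dots> \<le> ennreal C1 * ennreal (c1 * s)" by (rule C1(2)[OF fA])
    also have "\<dots> = ennreal (C1 * (c1 * s))" using C1(1) by (simp add: ennreal_mult')
    finally have "\<mu> * \<bar>A\<bar> \<le> C1 * (c1 * s)" using C1 c1 s by (simp add: ennreal_le_iff)
    then have A: "\<bar>A\<bar> \<le> C1 * c1 / \<mu> * s" using \<mu>(1) by (simp add: field_simps)
    have "majorized (\<lambda>x. ennreal \<bar>f x - A\<bar> + ennreal \<bar>A\<bar>) (ennreal (c1 * s) + ennreal (\<bar>A\<bar> * C0))"
      by (intro majorized_add fA majorized_const_mult C0) simp
    then show "majorized (\<lambda>y. ennreal \<bar>f y\<bar>) (ennreal (c * s))"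
    proof (rule majorized_mono)
      show "AE y in lebesgue. y \<in> \<Omega> \<longrightarrow> ennreal \<bar>f y\<bar> \<le> ennreal \<bar>f y - A\<bar> + ennreal \<bar>A\<bar>"
        by (intro AE_I2 impI) (simp add: ennreal_plus[symmetric] ennreal_leI del: ennreal_plus)
      have "\<bar>A\<bar> * C0 \<le> C1 * c1 / \<mu> * s * C0" using A C0 by (intro mult_right_mono) auto
      then have "c1 * s + \<bar>A\<bar> * C0 \<le> c * s"
      proof -
        have "c * s = c1 * s + C1 * c1 / \<mu> * s * C0 + s" unfolding c_def by (simp add: algebra_simps)
        with \<open>\<bar>A\<bar> * C0 \<le> C1 * c1 / \<mu> * s * C0\<close> s show ?thesis by linarith
      qed
      then show "ennreal (c1 * s) + ennreal (\<bar>A\<bar> * C0) \<le> ennreal (c * s)"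
        using c1 s C0 by (simp add: ennreal_plus[symmetric] ennreal_leI del: ennreal_plus)
    qed
  qed
qed

text \<open>On the whole space every cone is admissible, so the opening is \<kappa> = 1 and any
  basis vector can be the axis. The extension comes with its own gradient, which uniqueness ties to
  the given one.\<close>

lemma poincare_zero_majorant:
  "\<exists>c>0. \<forall>f g s. weak_gradient \<Omega> f g \<and> in_W10H \<Omega> q lam f \<and>
    s \<ge> 0 \<and> majorized (abs_sum g) (ennreal s) \<longrightarrow> majorized (\<lambda>y. ennreal \<bar>f y\<bar>) (ennreal (c * s))"
proof -
  obtain x0 where x0: "x0 \<in> \<Omega>" using nonempty_domain by blast
  obtain R where R: "R > 0" "\<Omega> \<subseteq> ball x0 R" using bounded_subset_ballD[OF bounded_domain, of x0] by blast
  \<comment> \<open>The starting cube lies within T/2 of a point at distance T from x, hence farther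
    than T/2 = 2 * R from x, while two points of the domain are less than 2 * R apart.\<close>
  define T where "T = 4 * R"
  have T: "T > 0" unfolding T_def using R by simp
  obtain e :: 'n where e: "e \<in> Basis" using nonempty_Basis by blast
  define a where "a = chain_ratio TYPE('n) 1"
  have k1: "(0::real) < 1" "(1::real) \<le> 1" by auto
  note ab = chain_ratio_bounds[OF k1, where 'n='n, folded a_def]
  define K where "K = chain_const TYPE('n) 1"
  have K: "K \<ge> 0" unfolding K_def by (rule chain_const_nonneg[OF k1])
  define c where "c = K * T / a * avg_const + 1"
  have c: "c > 0" unfolding c_def using K T ab avg_const_pos
    by (intro add_nonneg_pos mult_nonneg_nonneg divide_nonneg_pos) auto
  show ?thesis
  proof (intro exI[of _ c] conjI c allI impI)
    fix f g s assume "weak_gradient \<Omega> f g \<and> in_W10H \<Omega> q lam f \<and> s \<ge> 0 \<and> majorized (abs_sum g) (ennreal s)"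
    then have wg: "weak_gradient \<Omega> f g" and W: "in_W10H \<Omega> q lam f" and s: "s \<ge> 0"
      and maj: "majorized (abs_sum g) (ennreal s)" by auto
    obtain g' where wg': "weak_gradient \<Omega> f g'"
      and ext: "weak_gradient UNIV (\<lambda>y. indicator \<Omega> y * f y) (\<lambda>y. indicator \<Omega> y *\<^sub>R g' y)"
      using zero_extension[OF W] by blast
    let ?f = "\<lambda>y. indicator \<Omega> y * f y" and ?g = "\<lambda>y. indicator \<Omega> y *\<^sub>R g' y"
    have maj': "majorized (abs_sum g') (ennreal s)"
      by (rule majorized_mono[OF maj]) (use weak_gradient_unique[OF open_domain wg wg'] in \<open>auto elim: eventually_mono\<close>)
    have tp: "2 * (T * (1 - a) ^ k) > 0" for k using T ab by simp
    have "(\<lambda>k. (1 - a) ^ k) \<longlonglongrightarrow> 0" using ab by (intro LIMSEQ_realpow_zero) auto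
    from tendsto_mult_left[OF this, of "2 * T"] have tlim: "(\<lambda>k. 2 * (T * (1 - a) ^ k)) \<longlonglongrightarrow> 0"
      by (simp only: mult.assoc mult_zero_right)
    have lf: "loc_integrable UNIV ?f" using ext unfolding weak_gradient_def by blast
    \<comment> \<open>The gradient extended by zero does not see the part of the ball outside the
      domain, so the averages of the chain on the whole space are those of
      \<open>ball_avg\<close>.\<close>
    have int: "(\<integral>\<^sup>+y\<in>cball x t \<inter> UNIV. abs_sum ?g y \<partial>lebesgue) = (\<integral>\<^sup>+y\<in>cball x t \<inter> \<Omega>. abs_sum g' y \<partial>lebesgue)" for x t
      by (intro nn_integral_cong) (auto simp: indicator_def abs_sum_def)
    have ptw: "AE x in lebesgue. x \<in> \<Omega> \<longrightarrow> ennreal \<bar>f x\<bar> \<le>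
      (\<Sum>k. ennreal (K * (T * (1 - a) ^ k)) * ball_avg (2 * (T * (1 - a) ^ k)) (abs_sum g') x)"
      using lebesgue_points[OF lf open_UNIV tp tlim]
    proof eventually_elim
      case (elim x)
      show ?case
      proof
        assume x: "x \<in> \<Omega>"
        have "ennreal \<bar>?f x - cube_avg UNIV ?f (x + T *\<^sub>R e) (a * T)\<bar> \<le>
          (\<Sum>k. ennreal (K * (T * (1 - a) ^ k)) * ball_avg (2 * (T * (1 - a) ^ k)) (abs_sum g') x)"
          unfolding ball_avg_def K_def int[symmetric]
          by (rule cone_chain[OF ext _ k1 T _ a_def refl]) (use elim e in auto)
        moreover have "cube_avg UNIV ?f (x + T *\<^sub>R e) (a * T) = 0"
        proof -
          have bz: "?f y * cube_bump (x + T *\<^sub>R e) (a * T) y = 0" for y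
          proof (cases "y \<in> cube (x + T *\<^sub>R e) (a * T)")
            case True
            have "real DIM('n) * (a * T) = T / 4" using ab(3) by (simp add: algebra_simps)
            then have "real DIM('n) * (a * T) < T / 2" using T by simp
            from subsetD[OF cube_subset_ball[OF this] True] have "dist (x + T *\<^sub>R e) y < T / 2" by simp
            moreover have "dist x (x + T *\<^sub>R e) = T" using e T by (simp add: dist_norm)
            ultimately have "dist x y > 2 * R"
              using dist_triangle[of x "x + T *\<^sub>R e" y] unfolding T_def by (simp add: dist_commute)
            moreover have "dist x y < 2 * R" if "y \<in> \<Omega>"
            proof -
              have "dist x0 x < R" "dist x0 y < R" using R x that by auto
              then show ?thesis using dist_triangle3[of x y x0] by simp
            qed
            ultimately have "y \<notin> \<Omega>" by auto
            then show ?thesis by simp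
          next
            case False
            have "a * T > 0" using ab T by simp
            from cube_bump_props(4)[OF this False] show ?thesis by simp
          qed
          show ?thesis unfolding cube_avg_def set_lebesgue_integral_def bz by simp
        qed
        ultimately show "ennreal \<bar>f x\<bar> \<le>
          (\<Sum>k. ennreal (K * (T * (1 - a) ^ k)) * ball_avg (2 * (T * (1 - a) ^ k)) (abs_sum g') x)"
          using x by simp
      qed
    qed
    have "majorized (\<lambda>x. \<Sum>k. ennreal (K * (T * (1 - a) ^ k)) * ball_avg (2 * (T * (1 - a) ^ k)) (abs_sum g') x)
      (ennreal (K * T / a * avg_const * s))"
      by (rule majorized_chain_sum[OF maj' s]) (use ab T K in auto)
    then show "majorized (\<lambda>y. ennreal \<bar>f y\<bar>) (ennreal (c * s))"
      by (rule majorized_mono[OF _ ptw]) (use s in \<open>auto simp: c_def distrib_right intro!: ennreal_leI\<close>)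
  qed
qed

lemma majorized_abs_sum:
  assumes g: "\<And>i. i \<in> Basis \<Longrightarrow> in_H \<Omega> q lam (\<lambda>y. g y \<bullet> i)" and s: "H_norm_vec \<Omega> q lam g < s"
  shows "majorized (abs_sum g) (ennreal s)"
proof -
  let ?h = "\<lambda>i. H_norm \<Omega> q lam (\<lambda>y. g y \<bullet> i)"
  let ?N = "real DIM('n)"
  \<comment> \<open>The gap between s and the norm is shared equally among the components, each of
    which needs a strict inequality.\<close>
  define d where "d = (s - H_norm_vec \<Omega> q lam g) / ?N"
  have d: "d > 0" unfolding d_def using s by simp
  have "majorized (\<lambda>y. \<Sum>i\<in>Basis. ennreal \<bar>g y \<bullet> i\<bar>) (\<Sum>i\<in>Basis. ennreal (?h i + d))"
    by (intro majorized_sum majorized_of_in_H g) (use d in auto)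
  moreover have "(\<Sum>i\<in>Basis. ennreal (?h i + d)) = ennreal s"
  proof -
    have "(\<Sum>i\<in>Basis. ennreal (?h i + d)) = ennreal (\<Sum>i\<in>Basis. ?h i + d)"
      using d H_norm_nonneg[OF g] by (intro sum_ennreal) (auto intro: add_nonneg_nonneg)
    also have "(\<Sum>i\<in>Basis. ?h i + d) = s"
      unfolding sum.distrib d_def by (simp add: H_norm_vec_def)
    finally show ?thesis .
  qed
  ultimately show ?thesis unfolding abs_sum_def[abs_def] by simp
qed

text \<open>Majorants of the gradient exist for every s strictly above its norm, so the estimate is
  obtained for these s first; an excess of e / c in s costs e in the norm of f.\<close>

lemma in_H_of_majorants:
  assumes wg: "weak_gradient \<Omega> f g" and g: "\<And>i. i \<in> Basis \<Longrightarrow> in_H \<Omega> q lam (\<lambda>y. g y \<bullet> i)" and c: "c > 0"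
    and maj: "\<And>s. s \<ge> 0 \<Longrightarrow> majorized (abs_sum g) (ennreal s) \<Longrightarrow> majorized (\<lambda>y. ennreal \<bar>f y\<bar>) (ennreal (c * s))"
  shows "in_H \<Omega> q lam f" "H_norm \<Omega> q lam f \<le> c * H_norm_vec \<Omega> q lam g"
proof -
  let ?v = "H_norm_vec \<Omega> q lam g"
  have v0: "?v \<ge> 0" unfolding H_norm_vec_def using H_norm_nonneg[OF g] by (intro sum_nonneg) auto
  have m: "set_borel_measurable lebesgue \<Omega> f"
    using wg loc_integrable_imp_measurable[OF _ open_domain] unfolding weak_gradient_def by blast
  have *: "in_H \<Omega> q lam f \<and> H_norm \<Omega> q lam f \<le> c * s" if "s > ?v" for s
    using in_H_of_majorized[OF maj[OF _ majorized_abs_sum[OF g that]] _ m] that v0 c by simp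
  then show "in_H \<Omega> q lam f" using gt_ex by blast
  show "H_norm \<Omega> q lam f \<le> c * ?v"
  proof (rule field_le_epsilon)
    fix e :: real assume e: "e > 0"
    have "H_norm \<Omega> q lam f \<le> c * (?v + e / c)" using *[of "?v + e / c"] e c by simp
    then show "H_norm \<Omega> q lam f \<le> c * ?v + e" using c by (simp add: distrib_left)
  qed
qed

end

theorem mainTheorem15:
  fixes \<Omega> U :: "'n::euclidean_space set" and q lam :: real
  assumes "bounded \<Omega>" and "connected \<Omega>" and "lipschitz_domain \<Omega>"
    and "1 < q" and "0 \<le> lam" and "lam < real DIM('n)"
    and "U \<in> sets lebesgue" and "U \<subseteq> \<Omega>" and "emeasure lebesgue U > 0"
  shows "\<exists>c>0. \<forall>f g.
     weak_gradient \<Omega> f g \<and> (\<forall>i\<in>Basis. in_H \<Omega> q lam (\<lambda>y. g y \<bullet> i)) \<and>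
     ((set_integrable lebesgue \<Omega> f \<and> (LINT y:U|lebesgue. f y) = 0) \<or> in_W10H \<Omega> q lam f)
     \<longrightarrow> in_H \<Omega> q lam f \<and> H_norm \<Omega> q lam f \<le> c * H_norm_vec \<Omega> q lam g"
proof -
  \<comment> \<open>The positive measure of U is what makes the domain nonempty.\<close>
  have "\<Omega> \<noteq> {}" using assms(8,9) by auto
  moreover have "open \<Omega>" using assms(3) unfolding lipschitz_domain_def by (rule conjunct1)
  ultimately interpret block_space \<Omega> q lam using assms by unfold_locales auto
  obtain c1 where c1: "c1 > 0" "\<And>f g s. weak_gradient \<Omega> f g \<and> set_integrable lebesgue \<Omega> f \<and> (LINT y:U|lebesgue. f y) = 0 \<and>
    s \<ge> 0 \<and> majorized (abs_sum g) (ennreal s) \<Longrightarrow> majorized (\<lambda>y. ennreal \<bar>f y\<bar>) (ennreal (c1 * s))"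
    using poincare_mean_majorant[OF assms(3,2,7,8,9)] by blast
  obtain c2 where c2: "c2 > 0" "\<And>f g s. weak_gradient \<Omega> f g \<and> in_W10H \<Omega> q lam f \<and>
    s \<ge> 0 \<and> majorized (abs_sum g) (ennreal s) \<Longrightarrow> majorized (\<lambda>y. ennreal \<bar>f y\<bar>) (ennreal (c2 * s))"
    using poincare_zero_majorant by blast
  show ?thesis
  proof (intro exI[of _ "max c1 c2"] conjI allI impI)
    show "max c1 c2 > 0" using c1 by simp
    fix f g
    assume h: "weak_gradient \<Omega> f g \<and> (\<forall>i\<in>Basis. in_H \<Omega> q lam (\<lambda>y. g y \<bullet> i)) \<and>
     ((set_integrable lebesgue \<Omega> f \<and> (LINT y:U|lebesgue. f y) = 0) \<or> in_W10H \<Omega> q lam f)"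
    have maj: "majorized (\<lambda>y. ennreal \<bar>f y\<bar>) (ennreal (max c1 c2 * s))"
      if s: "s \<ge> 0" and G: "majorized (abs_sum g) (ennreal s)" for s
    proof -
      have "majorized (\<lambda>y. ennreal \<bar>f y\<bar>) (ennreal (c1 * s)) \<or> majorized (\<lambda>y. ennreal \<bar>f y\<bar>) (ennreal (c2 * s))"
        using h c1(2)[of f g s] c2(2)[of f g s] s G by blast
      moreover have "ennreal (c1 * s) \<le> ennreal (max c1 c2 * s)" "ennreal (c2 * s) \<le> ennreal (max c1 c2 * s)"
        using s by (auto intro!: ennreal_leI mult_right_mono)
      ultimately show ?thesis by (auto intro: majorized_mono)
    qed
    have c: "max c1 c2 > 0" using c1 by simp
    have wg: "weak_gradient \<Omega> f g" and g: "\<And>i. i \<in> Basis \<Longrightarrow> in_H \<Omega> q lam (\<lambda>y. g y \<bullet> i)" using h by auto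
    show "in_H \<Omega> q lam f" by (rule in_H_of_majorants(1)[OF wg g c maj])
    show "H_norm \<Omega> q lam f \<le> max c1 c2 * H_norm_vec \<Omega> q lam g"
      by (rule in_H_of_majorants(2)[OF wg g c maj])
  qed
qed

end
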